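(* Under the standing assumptions below with $r=1$, let $\theta>0$ denote the sole nonzero eigenvalue of $P_n$. Let $j\in\{1,\dots,\ell\}$ be such that $1/\theta\notin\big(G_{\mu_X}(a_{j-1}^-),G_{\mu_X}(b_j^+)\big)$, $G'_{\mu_X}(b_j^+)=-\infty$, and, if $j\ge 2$, $G'_{\mu_X}(a_{j-1}^-)=-\infty$. For each $n$ let $\widetilde u$ be a unit-norm eigenvector of $\widetilde X_n$ associated with $\lambda_{\lceil nc_{j-1}\rceil+1}(\widetilde X_n)$. Then $\langle\widetilde u,\ker(\theta I_n-P_n)\rangle\xrightarrow{a.s.}0$ as $n\to\infty$.
   Context: Standing assumptions (Hermitian setting). For each $n$, $X_n$ is an $n\times n$ real symmetric (resp. complex Hermitian) random matrix whose distribution is invariant under conjugation by orthogonal (resp. unitary) matrices, with ordered eigenvalues $\lambda_1(X_n)\ge\cdots\ge\lambda_n(X_n)$. The empirical eigenvalue distribution $\mu_{X_n}=\frac1n\sum_{i=1}^n\delta_{\lambda_i(X_n)}$ converges almost surely weakly to a non-random compactly supported probability measure $\mu_X=\sum_{j=1}^{\ell}p_j\mu_j$, where $p_j>0$, $\sum_j p_j=1$, each $\mu_j$ is a non-random probability measure supported on $[a_j,b_j]$ with $d\mu_j(z)>0$ for $z\in(a_j,b_j)$, and $a_\ell<b_\ell<a_{\ell-1}<b_{\ell-1}<\cdots<a_1<b_1$. Set $c_0=0$, $c_k=\sum_{i=1}^k p_i$. It is assumed that for $j=1,\dots,\ell$, $\lambda_{\lceil nc_{j-1}\rceil+1}(X_n)\to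 b_j$ and $\lambda_{\lceil nc_j\rceil}(X_n)\to a_j$ almost surely. $P_n$ is a deterministic $n\times n$ symmetric (resp. Hermitian) matrix of rank $r$ with fixed positive nonzero eigenvalues independent of $n$; $X_n$ and $P_n$ are independent; $\widetilde X_n=X_n+P_n$ with ordered eigenvalues $\lambda_1(\widetilde X_n)\ge\cdots\ge\lambda_n(\widetilde X_n)$. $G_{\mu_X}(z)=\int\frac{1}{z-t}d\mu_X(t)$ for $z\notin\mathrm{supp}\,\mu_X$; $f(c^+)=\lim_{z\downarrow c}f(z)$, $f(c^-)=\lim_{z\uparrow c}f(z)$; $a_0:=+\infty$ (so $G_{\mu_X}(a_0^-)=0$). For a subspace $F$ and vector $x$, $\langle x,F\rangle$ denotes the norm of the orthogonal projection of $x$ onto $F$. *)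

theory Defs
  imports "HOL-Probability.Probability" "Jordan_Normal_Form.Char_Poly"
begin

text \<open>Matrices are Jordan_Normal_Form complex matrices; in the real symmetric setting
  we additionally require all entries to be real.\<close>

definition cadj :: "complex mat \<Rightarrow> complex mat" where
  "cadj A = mat (dim_col A) (dim_row A) (\<lambda>(i,j). cnj (A $$ (j,i)))"

definition hermitian_mat :: "nat \<Rightarrow> complex mat \<Rightarrow> bool" where
  "hermitian_mat n A \<longleftrightarrow> A \<in> carrier_mat n n \<and> cadj A = A"

definition unitary_mat :: "nat \<Rightarrow> complex mat \<Rightarrow> bool" where
  "unitary_mat n U \<longleftrightarrow> U \<in> carrier_mat n n \<and> U * cadj U = 1\<^sub>m n"

definition real_mat :: "complex mat \<Rightarrow> bool" where
  "real_mat A \<longleftrightarrow> (\<forall>i < dim_row A. \<forall>j < dim_col A. Im (A $$ (i,j)) = 0)"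

definition real_vec :: "complex vec \<Rightarrow> bool" where
  "real_vec v \<longleftrightarrow> (\<forall>i < dim_vec v. Im (v $ i) = 0)"

definition invariance_group :: "bool \<Rightarrow> nat \<Rightarrow> complex mat set" where
  "invariance_group real_case n =
     {U. unitary_mat n U \<and> (real_case \<longrightarrow> real_mat U)}"

text \<open>Ordered eigenvalues (with multiplicity) of a Hermitian matrix:
  eig k A = lambda_k(A), with lambda_1(A) >= ... >= lambda_n(A), for 1 <= k <= n.\<close>
definition eig_list :: "complex mat \<Rightarrow> real list" where
  "eig_list A = rev (sorted_list_of_multiset (image_mset Re (proots (char_poly A))))"

definition eig :: "nat \<Rightarrow> complex mat \<Rightarrow> real" where
  "eig k A = eig_list A ! (k - 1)"

definition cinner :: "complex vec \<Rightarrow> complex vec \<Rightarrow> complex" where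
  "cinner x y = (\<Sum>i<dim_vec x. x $ i * cnj (y $ i))"

definition vnorm :: "complex vec \<Rightarrow> real" where
  "vnorm x = sqrt (\<Sum>i<dim_vec x. (cmod (x $ i))\<^sup>2)"

definition proj_norm :: "complex vec set \<Rightarrow> complex vec \<Rightarrow> real" where
  "proj_norm F x = vnorm (THE p. p \<in> F \<and> (\<forall>w\<in>F. cinner (x - p) w = 0))"

definition mat_ker :: "nat \<Rightarrow> complex mat \<Rightarrow> complex vec set" where
  "mat_ker n A = {v \<in> carrier_vec n. A *\<^sub>v v = 0\<^sub>v n}"

definition entries :: "nat \<Rightarrow> complex mat \<Rightarrow> (nat \<times> nat \<Rightarrow> complex)" where
  "entries n A = (\<lambda>ij\<in>{..<n} \<times> {..<n}. A $$ ij)"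

definition entries_space :: "nat \<Rightarrow> (nat \<times> nat \<Rightarrow> complex) measure" where
  "entries_space n = PiM ({..<n} \<times> {..<n}) (\<lambda>_. borel)"

definition cauchy_transform :: "real measure \<Rightarrow> real \<Rightarrow> real" where
  "cauchy_transform \<mu> z = (\<integral>t. 1 / (z - t) \<partial>\<mu>)"

definition lim_right :: "(real \<Rightarrow> real) \<Rightarrow> real \<Rightarrow> ereal" where
  "lim_right f c = Lim (at_right c) (\<lambda>z. ereal (f z))"

definition lim_left :: "(real \<Rightarrow> real) \<Rightarrow> real \<Rightarrow> ereal" where
  "lim_left f c = Lim (at_left c) (\<lambda>z. ereal (f z))"

end

(*
  Write P = theta v v* and expand v and the eigenvector u in an eigenbasis of X_n. With y the
  perturbed eigenvalue, w_i = |<v, e_i>|^2 and s = <u, v>, the eigenvector equation says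
  theta^2 |s|^2 w_i = (y - lambda_i)^2 |<u, e_i>|^2; hence theta^2 |s|^2 sum_i w_i / (y - lambda_i)^2 = 1
  and, when s is nonzero, theta sum_i w_i / (y - lambda_i) = 1.
  Invariance makes the measures sum_i w_i delta_{lambda_i} converge weakly to mu_X almost surely:
  by Weierstrass it suffices to treat the moments v* X_n^m v, and there v may be replaced by a uniformly
  random sign vector, for which Bonami's fourth-moment bound for Rademacher chaos gives a summable
  error. By interlacing, the limit points rho of y lie in the gap closure [b_j, a_(j-1)]. If |s| stayed
  away from 0 along a subsequence, then rho would be interior to the gap, because the infinite slope of G
  at the edges means that 1/(rho - t)^2 is not integrable there; but then G(rho) = 1/theta, which is
  excluded because G is strictly decreasing on the gap.
*)
theory Submission
  imports Defs
begin

text \<open>The obstacle is that the weights come from a random eigenbasis, about which only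
  invariance is known. So all probability is done on
  \<open>cinner (A ^\<^sub>m m *\<^sub>v v) v\<close> and on traces, which are polynomials in the
  entries, and only on a conjugation-invariant event that bounds a trace. Nothing is known about the
  joint law for different n, so errors must be summable: a second moment gives order 1/n, the fourth
  moment gives order 1/n^2. Sign vectors are reached by Householder reflections, which are real
  between real vectors, so one argument serves both the orthogonal and the unitary group. The rest
  is deterministic, for one fixed outcome. Weak convergence sees only bounded continuous functions,
  so the singular kernels are replaced: 1/s^2 by 1/(s^2 + e), which makes sense even where y meets
  an eigenvalue, and 1/s by a function cut off near 0, used once the limit point is known to be
  interior. To the right of the first component the gap is unbounded: there y is confined by the
  largest eigenvalue plus \<theta>, and 0 takes the place of the limit of G at the far end.\<close>

section \<open>Hermitian matrices\<close>

lemma cadj_carrier [simp]: "cadj A \<in> carrier_mat n m \<longleftrightarrow> A \<in> carrier_mat m n"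
  unfolding carrier_mat_def by (auto simp: cadj_def)

lemma cadj_dim [simp]: "dim_row (cadj A) = dim_col A" "dim_col (cadj A) = dim_row A"
  by (auto simp: cadj_def)

lemma cadj_index [simp]: "i < dim_col A \<Longrightarrow> j < dim_row A \<Longrightarrow> cadj A $$ (i,j) = cnj (A $$ (j,i))"
  by (auto simp: cadj_def)

lemma cadj_cadj [simp]: "cadj (cadj A) = A"
  by (rule eq_matI) auto

lemma index_mult_sum:
  "i < dim_row A \<Longrightarrow> j < dim_col B \<Longrightarrow> dim_col A = dim_row B \<Longrightarrow>
    (A * B) $$ (i,j) = (\<Sum>k<dim_row B. A $$ (i,k) * B $$ (k,j))"
  by (simp add: scalar_prod_def atLeast0LessThan)

lemma index_mult_vec_sum:
  "i < dim_row A \<Longrightarrow> dim_col A = dim_vec v \<Longrightarrow>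
    (A *\<^sub>v v) $ i = (\<Sum>k<dim_vec v. A $$ (i,k) * v $ k)"
  by (simp add: scalar_prod_def atLeast0LessThan)

lemma cadj_mult:
  assumes "A \<in> carrier_mat n k" "B \<in> carrier_mat k m"
  shows "cadj (A * B) = cadj B * cadj A"
  by (rule eq_matI) (use assms in \<open>auto simp: index_mult_sum mult.commute simp del: index_mult_mat(1)\<close>)

lemma cinner_mult_left:
  assumes "A \<in> carrier_mat n m" "x \<in> carrier_vec m" "y \<in> carrier_vec n"
  shows "cinner (A *\<^sub>v x) y = cinner x (cadj A *\<^sub>v y)"
proof -
  have "cinner (A *\<^sub>v x) y = (\<Sum>i<n. \<Sum>k<m. A $$ (i,k) * x $ k * cnj (y $ i))"
    using assms by (simp add: cinner_def index_mult_vec_sum sum_distrib_right del: index_mult_mat_vec)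
  also have "\<dots> = (\<Sum>k<m. \<Sum>i<n. A $$ (i,k) * x $ k * cnj (y $ i))"
    by (rule sum.swap)
  also have "\<dots> = cinner x (cadj A *\<^sub>v y)"
    using assms by (simp add: cinner_def index_mult_vec_sum sum_distrib_left mult_ac del: index_mult_mat_vec)
  finally show ?thesis .
qed

lemma cinner_cnj: "dim_vec x = dim_vec y \<Longrightarrow> cnj (cinner x y) = cinner y x"
  by (simp add: cinner_def mult.commute)

lemma cinner_smult_left: "cinner (c \<cdot>\<^sub>v x) y = c * cinner x y"
  by (simp add: cinner_def sum_distrib_left mult_ac)

lemma cinner_smult_right: "dim_vec x = dim_vec y \<Longrightarrow> cinner x (c \<cdot>\<^sub>v y) = cnj c * cinner x y"
  by (simp add: cinner_def sum_distrib_left mult_ac)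

lemma cinner_add_left: "dim_vec x = dim_vec y \<Longrightarrow> cinner (x + y) z = cinner x z + cinner y z"
  by (simp add: cinner_def sum.distrib algebra_simps)

lemma vnorm_power2: "(vnorm x)\<^sup>2 = (\<Sum>i<dim_vec x. (cmod (x $ i))\<^sup>2)"
  by (simp add: vnorm_def sum_nonneg)

lemma vnorm_nonneg [simp]: "vnorm x \<ge> 0"
  by (simp add: vnorm_def sum_nonneg)

lemma cinner_self: "cinner x x = complex_of_real ((vnorm x)\<^sup>2)"
  unfolding vnorm_power2 cinner_def by (simp only: of_real_sum complex_norm_square)

lemma vnorm_smult: "vnorm (c \<cdot>\<^sub>v x) = cmod c * vnorm x"
proof -
  have "(vnorm (c \<cdot>\<^sub>v x))\<^sup>2 = (cmod c * vnorm x)\<^sup>2"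
    by (simp add: vnorm_power2 norm_mult power_mult_distrib sum_distrib_left)
  thus ?thesis by (simp add: power2_eq_iff_nonneg)
qed

lemma vnorm_eq_0: "v \<in> carrier_vec n \<Longrightarrow> vnorm v = 0 \<Longrightarrow> v = 0\<^sub>v n"
  unfolding vnorm_def
  by (intro eq_vecI) (auto simp: sum_nonneg_eq_0_iff)

section \<open>Unitary matrices and Householder reflections\<close>

lemma unitary_matD:
  assumes "unitary_mat n U"
  shows "U \<in> carrier_mat n n" "U * cadj U = 1\<^sub>m n" "cadj U * U = 1\<^sub>m n"
  using assms mat_mult_left_right_inverse[of U n "cadj U"] by (auto simp: unitary_mat_def)

lemma unitary_mat_cadj: "unitary_mat n U \<Longrightarrow> unitary_mat n (cadj U)"
  by (frule unitary_matD(1), frule unitary_matD(3)) (simp add: unitary_mat_def)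

lemma unitary_mat_mult:
  assumes "unitary_mat n U" "unitary_mat n V"
  shows "unitary_mat n (U * V)"
proof -
  note U = unitary_matD[OF assms(1)] and V = unitary_matD[OF assms(2)]
  have "U * V * cadj (U * V) = U * (V * cadj V) * cadj U"
    using U(1) V(1) by (simp add: cadj_mult[of _ n n _ n] assoc_mult_mat[of _ n n _ n _ n])
  thus ?thesis using U V by (auto simp: unitary_mat_def)
qed

lemma unitary_cinner:
  assumes "unitary_mat n U" "x \<in> carrier_vec n" "y \<in> carrier_vec n"
  shows "cinner (U *\<^sub>v x) (U *\<^sub>v y) = cinner x y"
proof -
  note U = unitary_matD[OF assms(1)]
  have "cinner (U *\<^sub>v x) (U *\<^sub>v y) = cinner x ((cadj U * U) *\<^sub>v y)"
    using assms U(1) by (simp add: cinner_mult_left[of U n n])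
  thus ?thesis using U assms by simp
qed

lemma unitary_vnorm:
  assumes "unitary_mat n U" "x \<in> carrier_vec n"
  shows "vnorm (U *\<^sub>v x) = vnorm x"
proof -
  have "complex_of_real ((vnorm (U *\<^sub>v x))\<^sup>2) = complex_of_real ((vnorm x)\<^sup>2)"
    using unitary_cinner[OF assms assms(2)] by (simp add: cinner_self)
  hence "(vnorm (U *\<^sub>v x))\<^sup>2 = (vnorm x)\<^sup>2" using of_real_eq_iff by blast
  thus ?thesis by (simp add: power2_eq_iff_nonneg)
qed

text \<open>In complex space the reflection along v - w takes v to w only if their inner product is
  real. Multiplying w by the phase c of <v, w> turns the inner product into its modulus, which is
  why c occurs in the conclusion. For real vectors c is real, and so is the reflection.\<close>

lemma householder:
  assumes v: "v \<in> carrier_vec n" and w: "w \<in> carrier_vec n" and nv: "vnorm v = 1" and nw: "vnorm w = 1"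
  shows "\<exists>U c. unitary_mat n U \<and> cadj U = U \<and> cmod c = 1 \<and> U *\<^sub>v v = c \<cdot>\<^sub>v w
            \<and> (real_vec v \<and> real_vec w \<longrightarrow> real_mat U)"
proof -
  define r where "r = cinner v w"
  define c where "c = (if r = 0 then 1 else r / cmod r)"
  have c1: "cmod c = 1" by (simp add: c_def norm_divide)
  have cc: "c * cnj c = 1" using c1 by (simp add: complex_norm_square[symmetric])
  have rc: "cnj c * r = cmod r"
  proof (cases "r = 0")
    case False
    have "cnj c * r = (r * cnj r) / cmod r" using False by (simp add: c_def)
    also have "\<dots> = cmod r" using False by (simp add: complex_norm_square[symmetric] power2_eq_square)
    finally show ?thesis .
  qed (simp add: c_def)
  define x where "x = v - c \<cdot>\<^sub>v w"
  have x: "x \<in> carrier_vec n" using v w by (simp add: x_def)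
  have xi: "x $ i = v $ i - c * w $ i" if "i < n" for i using that v w by (simp add: x_def)
  \<comment> \<open>If x = 0, division by zero gives \<beta> = 0 and U = I, which is right because
    then v = c w.\<close>
  define \<beta> where "\<beta> = complex_of_real (2 / (vnorm x)\<^sup>2)"
  define U where "U = mat n n (\<lambda>(i,j). (if i = j then 1 else 0) - \<beta> * x $ i * cnj (x $ j))"
  have U: "U \<in> carrier_mat n n" by (simp add: U_def)
  have cb: "cnj \<beta> = \<beta>" by (simp add: \<beta>_def)
  have herm: "cadj U = U" by (rule eq_matI) (auto simp: U_def cb mult_ac)
  have xx: "(\<Sum>k<n. cnj (x $ k) * x $ k) = complex_of_real ((vnorm x)\<^sup>2)"
    using cinner_self[of x] x by (simp add: cinner_def mult.commute)
  have bx: "\<beta> * (\<beta> * complex_of_real ((vnorm x)\<^sup>2)) = 2 * \<beta>"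
  proof -
    have "2 / (vnorm x)\<^sup>2 * (2 / (vnorm x)\<^sup>2 * (vnorm x)\<^sup>2) = 2 * (2 / (vnorm x)\<^sup>2)"
      by (cases "vnorm x = 0") auto
    thus ?thesis unfolding \<beta>_def by (metis of_real_mult of_real_numeral)
  qed
  have "U * U = 1\<^sub>m n"
  proof (rule eq_matI)
    fix i j assume "i < dim_row (1\<^sub>m n :: complex mat)" "j < dim_col (1\<^sub>m n :: complex mat)"
    hence ij: "i < n" "j < n" by auto
    let ?d = "\<lambda>i j. if i = j then 1 else (0::complex)"
    have "(U * U) $$ (i,j) = (\<Sum>k<n. U $$ (i,k) * U $$ (k,j))"
      using ij U by (simp add: index_mult_sum del: index_mult_mat(1))
    also have "\<dots> = (\<Sum>k<n. (?d i k - \<beta> * x $ i * cnj (x $ k)) * (?d k j - \<beta> * x $ k * cnj (x $ j)))"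
      using ij by (intro sum.cong) (auto simp: U_def)
    also have "\<dots> = (\<Sum>k<n. (if i = k then ?d k j else 0) - (if i = k then \<beta> * x $ k * cnj (x $ j) else 0)
        - (if k = j then \<beta> * x $ i * cnj (x $ k) else 0)
        + (\<beta> * \<beta> * x $ i * cnj (x $ j)) * (cnj (x $ k) * x $ k))"
      by (intro sum.cong refl) (auto simp: algebra_simps)
    also have "\<dots> = ?d i j - \<beta> * x $ i * cnj (x $ j) - \<beta> * x $ i * cnj (x $ j)
        + (\<beta> * \<beta> * x $ i * cnj (x $ j)) * complex_of_real ((vnorm x)\<^sup>2)"
      using ij by (simp add: sum.distrib sum_subtractf sum_distrib_left[symmetric] xx)
    also have "\<dots> = ?d i j + x $ i * cnj (x $ j) * (\<beta> * (\<beta> * complex_of_real ((vnorm x)\<^sup>2)) - 2 * \<beta>)"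
      by (simp add: algebra_simps)
    also have "\<dots> = ?d i j" unfolding bx by simp
    finally show "(U * U) $$ (i,j) = 1\<^sub>m n $$ (i,j)" using ij by simp
  qed (auto simp: U_def)
  hence un: "unitary_mat n U" using U herm by (simp add: unitary_mat_def)
  have vv: "(\<Sum>k<n. v $ k * cnj (v $ k)) = 1" using cinner_self[of v] nv v by (simp add: cinner_def)
  have ww: "(\<Sum>k<n. w $ k * cnj (w $ k)) = 1" using cinner_self[of w] nw w by (simp add: cinner_def)
  have vw: "(\<Sum>k<n. v $ k * cnj (w $ k)) = r" using v by (simp add: r_def cinner_def)
  have wv: "(\<Sum>k<n. w $ k * cnj (v $ k)) = cnj r" using cinner_cnj[of v w] v w by (simp add: r_def cinner_def)
  have vx: "(\<Sum>k<n. cnj (x $ k) * v $ k) = 1 - cmod r"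
  proof -
    have "(\<Sum>k<n. cnj (x $ k) * v $ k) = (\<Sum>k<n. v $ k * cnj (v $ k) - cnj c * (v $ k * cnj (w $ k)))"
      by (intro sum.cong) (auto simp: xi algebra_simps)
    also have "\<dots> = 1 - cnj c * r"
      by (simp add: sum_subtractf sum_distrib_left[symmetric] vv vw)
    finally show ?thesis by (simp add: rc)
  qed
  \<comment> \<open>The squared length of x is twice <v, x>, so \<beta> <v, x> = 1 for nonzero x,
    and U v = v - x = c w.\<close>
  have nx: "complex_of_real ((vnorm x)\<^sup>2) = 2 * (1 - cmod r)"
  proof -
    have rc': "c * cnj r = cmod r" using arg_cong[OF rc, of cnj] by simp
    have "(\<Sum>k<n. cnj (x $ k) * x $ k) = (\<Sum>k<n. v $ k * cnj (v $ k) - cnj c * (v $ k * cnj (w $ k))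
       - c * (w $ k * cnj (v $ k)) + c * cnj c * (w $ k * cnj (w $ k)))"
      by (intro sum.cong) (auto simp: xi algebra_simps)
    also have "\<dots> = 1 - cnj c * r - c * cnj r + 1"
      by (simp add: sum_subtractf sum.distrib sum_distrib_left[symmetric] vv vw wv ww cc)
    finally show ?thesis using xx by (simp add: rc rc')
  qed
  have "U *\<^sub>v v = c \<cdot>\<^sub>v w"
  proof (rule eq_vecI)
    fix i assume "i < dim_vec (c \<cdot>\<^sub>v w)"
    hence i: "i < n" using w by simp
    have "(U *\<^sub>v v) $ i = (\<Sum>k<n. (if i = k then v $ k else 0) - \<beta> * x $ i * (cnj (x $ k) * v $ k))"
      using i U v by (simp add: index_mult_vec_sum del: index_mult_mat_vec) (auto simp: U_def algebra_simps intro!: sum.cong)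
    also have "\<dots> = v $ i - \<beta> * (1 - cmod r) * x $ i"
      using i by (simp add: sum_subtractf sum_distrib_left[symmetric] vx)
    also have "\<dots> = c * w $ i"
    proof (cases "vnorm x = 0")
      case True
      hence "x = 0\<^sub>v n" using vnorm_eq_0 x by blast
      thus ?thesis using xi[OF i] i by simp
    next
      case False
      have "complex_of_real ((vnorm x)\<^sup>2) = complex_of_real (2 * (1 - cmod r))" using nx by simp
      hence t: "1 - cmod r = (vnorm x)\<^sup>2 / 2" unfolding of_real_eq_iff by simp
      have "\<beta> * (1 - cmod r) = complex_of_real (2 / (vnorm x)\<^sup>2 * ((vnorm x)\<^sup>2 / 2))"
        by (simp only: t \<beta>_def of_real_mult)
      also have "\<dots> = 1" using False by simp
      finally have "\<beta> * (1 - cmod r) = 1" .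
      thus ?thesis using xi[OF i] by simp
    qed
    finally show "(U *\<^sub>v v) $ i = (c \<cdot>\<^sub>v w) $ i" using i w by simp
  qed (use U w in auto)
  moreover have "real_mat U" if "real_vec v" "real_vec w"
  proof -
    have "Im r = 0" using that v w by (auto simp: r_def cinner_def real_vec_def)
    hence "Im c = 0" by (simp add: c_def)
    hence "Im (x $ i) = 0" if "i < n" for i
      using that xi[OF that] \<open>real_vec v\<close> \<open>real_vec w\<close> v w by (auto simp: real_vec_def)
    moreover have "Im \<beta> = 0" by (simp add: \<beta>_def)
    ultimately show ?thesis by (auto simp: real_mat_def U_def)
  qed
  ultimately show ?thesis using un herm c1 by blast
qed

section \<open>The spectral theorem with ordered eigenvalues\<close>

lemma hermitian_matD: "hermitian_mat n A \<Longrightarrow> A \<in> carrier_mat n n" "hermitian_mat n A \<Longrightarrow> cadj A = A"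
  by (auto simp: hermitian_mat_def)

lemma hermitian_mat_entry:
  assumes "hermitian_mat n A" "i < n" "j < n"
  shows "cnj (A $$ (i,j)) = A $$ (j,i)"
proof -
  note A = hermitian_matD[OF assms(1)]
  have "cadj A $$ (j,i) = cnj (A $$ (i,j))" using assms(2,3) A(1) by simp
  thus ?thesis unfolding A(2) by simp
qed

lemma hermitian_mat_conj:
  assumes "hermitian_mat n A" "B \<in> carrier_mat n n"
  shows "hermitian_mat n (cadj B * A * B)"
  using hermitian_matD[OF assms(1)] assms(2)
  by (simp add: hermitian_mat_def cadj_mult[of _ n n _ n] assoc_mult_mat[of _ n n _ n _ n])

text \<open>Deflation by induction on the roots. A reflection carries the first basis vector to a
  multiple of a unit eigenvector, so the conjugated matrix has e in the corner and zeros below it.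
  Being Hermitian, it also has zeros to the right, and what is left is a Hermitian block of size n -
  1.\<close>

theorem hermitian_unitary_diagonalization:
  assumes "hermitian_mat n A" "char_poly A = (\<Prod>e\<leftarrow>es. [:- e, 1:])"
  shows "\<exists>U. unitary_mat n U \<and> cadj U * A * U = mat_diag n (\<lambda>i. es ! i)"
  using assms
proof (induct es arbitrary: n A)
  case Nil
  hence A: "A \<in> carrier_mat n n" by (simp add: hermitian_mat_def)
  have n: "n = 0" using degree_monic_char_poly[OF A] Nil(2) by simp
  show ?case
    by (rule exI[of _ "1\<^sub>m n"]) (use A n in \<open>auto simp: unitary_mat_def mat_diag_def intro!: eq_matI\<close>)
next
  case (Cons e es n A)
  note A = hermitian_matD[OF Cons(2)]
  have cp: "char_poly A = [:- e, 1:] * (\<Prod>e\<leftarrow>es. [:- e, 1:])" using Cons(3) by simp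
  have ev: "eigenvalue A e" unfolding eigenvalue_root_char_poly[OF A(1)] cp by simp
  then obtain w0 where w0: "w0 \<in> carrier_vec n" "w0 \<noteq> 0\<^sub>v n" "A *\<^sub>v w0 = e \<cdot>\<^sub>v w0"
    using A by (auto simp: eigenvalue_def eigenvector_def)
  have "n \<noteq> 0"
  proof
    assume "n = 0"
    hence "w0 = 0\<^sub>v n" using w0(1) by (intro eq_vecI) auto
    thus False using w0(2) by simp
  qed
  then obtain m where n: "n = Suc m" using not0_implies_Suc by blast
  have vn0: "vnorm w0 \<noteq> 0" using vnorm_eq_0 w0 by blast
  define w where "w = complex_of_real (1 / vnorm w0) \<cdot>\<^sub>v w0"
  have w: "w \<in> carrier_vec n" using w0 by (simp add: w_def)
  have nw: "vnorm w = 1" unfolding w_def vnorm_smult using vn0 by (simp add: norm_divide)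
  have Aw: "A *\<^sub>v w = e \<cdot>\<^sub>v w"
    unfolding w_def using A w0 by (simp add: mult_mat_vec[of A n n] smult_smult_assoc mult.commute)
  let ?e0 = "unit_vec n 0 :: complex vec"
  have ne: "vnorm ?e0 = 1"
  proof -
    have "(\<Sum>i<n. (cmod (?e0 $ i))\<^sup>2) = (\<Sum>i<n. if i = 0 then 1 else 0)"
      by (intro sum.cong) (auto simp: n)
    also have "\<dots> = 1" using n by simp
    finally show ?thesis by (simp add: vnorm_def)
  qed
  obtain U c where U: "unitary_mat n U" "U *\<^sub>v ?e0 = c \<cdot>\<^sub>v w"
    using householder[OF unit_vec_carrier w ne nw] by blast
  note Uc = unitary_matD[OF U(1)]
  define A' where "A' = cadj U * A * U"
  have A': "hermitian_mat n A'" "A' \<in> carrier_mat n n"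
    unfolding A'_def using hermitian_mat_conj[OF Cons(2) Uc(1)] hermitian_matD by auto
  have A'e: "A' *\<^sub>v ?e0 = e \<cdot>\<^sub>v ?e0"
  proof -
    have "A' *\<^sub>v ?e0 = cadj U *\<^sub>v (A *\<^sub>v (U *\<^sub>v ?e0))"
      unfolding A'_def using A Uc(1) by (simp add: assoc_mult_mat_vec[of _ n n _ n])
    also have "A *\<^sub>v (U *\<^sub>v ?e0) = e \<cdot>\<^sub>v (U *\<^sub>v ?e0)"
      unfolding U(2) using A w Aw by (simp add: mult_mat_vec[of A n n] smult_smult_assoc mult.commute)
    also have "cadj U *\<^sub>v \<dots> = e \<cdot>\<^sub>v ((cadj U * U) *\<^sub>v ?e0)"
      using Uc(1) by (simp add: mult_mat_vec[of _ n n])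
    finally show ?thesis unfolding Uc(3) by simp
  qed
  have col0: "A' $$ (i,0) = (if i = 0 then e else 0)" if "i < n" for i
  proof -
    have "(A' *\<^sub>v ?e0) $ i = (\<Sum>k<dim_vec ?e0. A' $$ (i,k) * ?e0 $ k)"
      using that A'(2) by (intro index_mult_vec_sum) auto
    also have "\<dots> = (\<Sum>k<n. if k = 0 then A' $$ (i,k) else 0)"
      by (intro sum.cong) (auto simp: n)
    also have "\<dots> = A' $$ (i,0)" using n by simp
    finally show ?thesis unfolding A'e using that n by auto
  qed
  have row0: "A' $$ (0,i) = (if i = 0 then e else 0)" if "i < n" for i
    using hermitian_mat_entry[OF A'(1), of i 0] col0[OF that] n that by (cases "i = 0") (auto simp: col0)
  define B where "B = mat m m (\<lambda>(i,j). A' $$ (Suc i, Suc j))"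
  have B: "B \<in> carrier_mat m m" by (simp add: B_def)
  have Bh: "hermitian_mat m B"
    unfolding hermitian_mat_def using hermitian_mat_entry[OF A'(1)]
    by (auto simp: B_def n intro!: eq_matI)
  define E where "E = mat 1 1 (\<lambda>_. e)"
  have E: "E \<in> carrier_mat 1 1" by (simp add: E_def)
  have split: "A' = four_block_mat E (0\<^sub>m 1 m) (0\<^sub>m m 1) B"
  proof (rule eq_matI)
    fix i j assume "i < dim_row (four_block_mat E (0\<^sub>m 1 m) (0\<^sub>m m 1) B)"
        "j < dim_col (four_block_mat E (0\<^sub>m 1 m) (0\<^sub>m m 1) B)"
    hence ij: "i < n" "j < n" using E B n by auto
    show "A' $$ (i,j) = four_block_mat E (0\<^sub>m 1 m) (0\<^sub>m m 1) B $$ (i,j)"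
      using ij col0 row0 n by (cases i; cases j) (auto simp: B_def E_def)
  qed (use A' E B n in auto)
  \<comment> \<open>Similarity preserves the characteristic polynomial; cancelling the factor of e
    gives the block B exactly the remaining roots.\<close>
  have "similar_mat_wit A' A (cadj U) U"
    by (rule similar_mat_witI[of _ _ n]) (use A A' Uc A'_def in auto)
  hence "char_poly A' = char_poly A" by (intro char_poly_similar) (auto simp: similar_mat_def)
  hence "char_poly E * char_poly B = [:- e, 1:] * (\<Prod>e\<leftarrow>es. [:- e, 1:])"
    unfolding cp split using char_poly_four_block_zeros_col[OF E _ B, of "0\<^sub>m 1 m"] by simp
  also have "char_poly E = [:- e, 1:]"
    by (simp add: E_def char_poly_defs Determinant.det_def sign_def)
  finally have cpB: "char_poly B = (\<Prod>e\<leftarrow>es. [:- e, 1:])"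
    by (metis mult_cancel_left pCons_eq_0_iff zero_neq_one)
  obtain V where V: "unitary_mat m V" and Vd: "cadj V * B * V = mat_diag m (\<lambda>i. es ! i)"
    using Cons(1)[OF Bh cpB] by blast
  note Vc = unitary_matD[OF V]
  define W where "W = four_block_mat (1\<^sub>m 1) (0\<^sub>m 1 m) (0\<^sub>m m 1) V"
  have W: "W \<in> carrier_mat n n" unfolding W_def using four_block_carrier_mat[OF one_carrier_mat[of 1] Vc(1)] n by simp
  have cW: "cadj W = four_block_mat (1\<^sub>m 1) (0\<^sub>m 1 m) (0\<^sub>m m 1) (cadj V)"
    by (rule eq_matI) (use Vc in \<open>auto simp: W_def\<close>)
  have "W * cadj W = 1\<^sub>m n"
    unfolding cW unfolding W_def
    by (subst mult_four_block_mat[of _ 1 1 _ m _ m]) (use Vc n in auto)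
  hence Wu: "unitary_mat n W" using W by (simp add: unitary_mat_def)
  have "cadj W * A' * W = four_block_mat E (0\<^sub>m 1 m) (0\<^sub>m m 1) (cadj V * B * V)"
    unfolding cW split unfolding W_def
    by (subst mult_four_block_mat[of _ 1 1 _ m _ m]; (subst mult_four_block_mat[of _ 1 1 _ m _ m])?)
       (use Vc E B in auto)
  also have "\<dots> = mat_diag n (\<lambda>i. (e # es) ! i)"
    unfolding Vd by (rule eq_matI) (auto simp: mat_diag_def E_def n nth_Cons')
  finally have "cadj (U * W) * A * (U * W) = mat_diag n (\<lambda>i. (e # es) ! i)"
    unfolding A'_def using A(1) Uc(1) W
    by (simp add: cadj_mult[of _ n n _ n] assoc_mult_mat[of _ n n _ n _ n])
  thus ?case using unitary_mat_mult[OF U(1) Wu] by blast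
qed

lemma proots_linear_factors: "proots (\<Prod>e\<leftarrow>es. [:- e, 1:]) = mset (es :: complex list)"
proof (induct es)
  case (Cons e es)
  have "(\<Prod>e\<leftarrow>es. [:- e, 1:]) \<noteq> 0" by (auto simp: prod_list_zero_iff)
  thus ?case using Cons by (simp add: proots_mult del: mult_pCons_left)
qed simp

text \<open>\<open>eig_list\<close> keeps only the real parts of the roots. Nothing is lost: the
  diagonalised matrix is again Hermitian, so each diagonal entry is its own conjugate.\<close>

lemma hermitian_char_poly_eig_list:
  assumes "hermitian_mat n A"
  shows "char_poly A = (\<Prod>e\<leftarrow>map complex_of_real (eig_list A). [:- e, 1:])"
    and "length (eig_list A) = n"
proof -
  note A = hermitian_matD[OF assms]
  obtain es where es: "char_poly A = (\<Prod>e\<leftarrow>es. [:- e, 1:])" "length es = n"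
    using char_poly_factorized[OF A(1)] by blast
  have ms: "proots (char_poly A) = mset es" by (simp only: es proots_linear_factors)
  obtain U where U: "unitary_mat n U" "cadj U * A * U = mat_diag n (\<lambda>i. es ! i)"
    using hermitian_unitary_diagonalization[OF assms es(1)] by blast
  have hD: "hermitian_mat n (mat_diag n (\<lambda>i. es ! i))"
    using hermitian_mat_conj[OF assms unitary_matD(1)[OF U(1)]] by (simp only: U(2))
  have "complex_of_real (Re (es ! i)) = es ! i" if "i < n" for i
  proof -
    have "cnj (es ! i) = es ! i"
      using hermitian_mat_entry[OF hD that that] that by (simp add: mat_diag_def)
    thus ?thesis by (simp add: complex_eq_iff)
  qed
  hence re: "complex_of_real (Re e) = e" if "e \<in> set es" for e
    using that es(2) by (auto simp: in_set_conv_nth)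
  have me: "mset (eig_list A) = image_mset Re (mset es)"
    by (simp add: eig_list_def ms)
  have "mset (map complex_of_real (eig_list A)) = image_mset (\<lambda>e. complex_of_real (Re e)) (mset es)"
    by (simp add: me multiset.map_comp comp_def)
  also have "\<dots> = image_mset (\<lambda>e. e) (mset es)"
    by (intro image_mset_cong) (simp add: re)
  finally have m: "mset (map complex_of_real (eig_list A)) = mset es" by simp
  have "(\<Prod>e\<leftarrow>map complex_of_real (eig_list A). [:- e, 1:]) = (\<Prod>e\<leftarrow>es. [:- e, 1:])"
    using arg_cong[OF m, of "\<lambda>M. prod_mset (image_mset (\<lambda>e. [:- e, 1:]) M)"]
    by (simp only: mset_map[symmetric] prod_mset_prod_list)
  thus "char_poly A = (\<Prod>e\<leftarrow>map complex_of_real (eig_list A). [:- e, 1:])" using es by simp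
  have "size (mset (eig_list A)) = size (mset es)" unfolding me by simp
  thus "length (eig_list A) = n" using es(2) by simp
qed

lemma eig_antimono:
  assumes "hermitian_mat n A" "1 \<le> i" "i \<le> j" "j \<le> n"
  shows "eig j A \<le> eig i A"
  unfolding eig_def
  by (rule sorted_rev_nth_mono)
     (use assms hermitian_char_poly_eig_list(2)[OF assms(1)] in \<open>auto simp: eig_list_def\<close>)

theorem hermitian_spectral:
  assumes "hermitian_mat n A"
  obtains U where "unitary_mat n U"
    "A = U * mat_diag n (\<lambda>i. complex_of_real (eig (Suc i) A)) * cadj U"
proof -
  note A = hermitian_matD[OF assms]
  obtain U where U: "unitary_mat n U" "cadj U * A * U = mat_diag n (\<lambda>i. map complex_of_real (eig_list A) ! i)"
    using hermitian_unitary_diagonalization[OF assms hermitian_char_poly_eig_list(1)[OF assms]] by blast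
  note Uc = unitary_matD[OF U(1)]
  have "mat_diag n (\<lambda>i. map complex_of_real (eig_list A) ! i) = mat_diag n (\<lambda>i. complex_of_real (eig (Suc i) A))"
    by (rule eq_matI) (auto simp: mat_diag_def eig_def hermitian_char_poly_eig_list(2)[OF assms])
  hence "U * mat_diag n (\<lambda>i. complex_of_real (eig (Suc i) A)) * cadj U = U * (cadj U * A * U) * cadj U"
    using U(2) by simp
  also have "\<dots> = (U * cadj U) * A * (U * cadj U)"
    using Uc(1) A(1) by (simp add: assoc_mult_mat[of _ n n _ n _ n])
  also have "\<dots> = A" using Uc A by simp
  finally show ?thesis using that[OF U(1)] by simp
qed

text \<open>\<open>eig_unitary n A U\<close>: the columns of \<open>U\<close> are an orthonormal eigenbasis of \<open>A\<close> ordered like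
  \<^const>\<open>eig\<close>, so \<open>cadj U *\<^sub>v x\<close> is the coordinate vector of \<open>x\<close>.\<close>
definition eig_unitary :: "nat \<Rightarrow> complex mat \<Rightarrow> complex mat \<Rightarrow> bool" where
  "eig_unitary n A U \<longleftrightarrow> unitary_mat n U \<and>
     A = U * mat_diag n (\<lambda>i. complex_of_real (eig (Suc i) A)) * cadj U"

lemma ex_eig_unitary: "hermitian_mat n A \<Longrightarrow> \<exists>U. eig_unitary n A U"
  using hermitian_spectral[of n A] unfolding eig_unitary_def by metis

lemma eig_unitary_carrier: "eig_unitary n A U \<Longrightarrow> A \<in> carrier_mat n n"
  using unitary_matD(1)[of n U] unfolding eig_unitary_def
  by (metis mat_diag_dim cadj_carrier mult_carrier_mat)

lemma mat_diag_mult_vec: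
  "x \<in> carrier_vec n \<Longrightarrow> i < n \<Longrightarrow> (mat_diag n f *\<^sub>v x) $ i = f i * x $ i"
  for f :: "nat \<Rightarrow> complex"
proof -
  assume x: "x \<in> carrier_vec n" and i: "i < n"
  have "(mat_diag n f *\<^sub>v x) $ i = (\<Sum>k<dim_vec x. mat_diag n f $$ (i,k) * x $ k)"
    using i x carrier_matD[OF mat_diag_dim[of n f]] by (intro index_mult_vec_sum) auto
  also have "\<dots> = (\<Sum>k<n. if i = k then f i * x $ i else 0)"
    using i x by (intro sum.cong) (auto simp: mat_diag_def)
  also have "\<dots> = f i * x $ i" using i by simp
  finally show ?thesis .
qed

lemma eig_unitary_pow:
  assumes "eig_unitary n A U"
  shows "A ^\<^sub>m m = U * mat_diag n (\<lambda>i. complex_of_real (eig (Suc i) A ^ m)) * cadj U"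
proof (induct m)
  case 0
  note U = unitary_matD[of n U]
  show ?case using assms U eig_unitary_carrier[OF assms] by (simp add: eig_unitary_def)
next
  case (Suc m)
  let ?l = "\<lambda>i. eig (Suc i) A"
  have Uu: "unitary_mat n U" and AU: "A = U * mat_diag n (\<lambda>i. complex_of_real (?l i)) * cadj U"
    using assms by (auto simp: eig_unitary_def)
  note U = unitary_matD[OF Uu]
  define D where "D = (\<lambda>m. mat_diag n (\<lambda>i. complex_of_real (?l i ^ m)))"
  have D: "D m \<in> carrier_mat n n" for m by (simp add: D_def)
  have "A ^\<^sub>m Suc m = (U * D m * cadj U) * (U * D 1 * cadj U)"
    using Suc AU by (simp add: D_def)
  also have "\<dots> = U * (D m * (cadj U * U) * D 1) * cadj U"
    using U(1) D by (simp add: assoc_mult_mat[of _ n n _ n _ n] mult_carrier_mat[of _ n n _ n])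
  also have "D m * (cadj U * U) * D 1 = D (Suc m)"
    unfolding U(3) right_mult_one_mat[OF D] by (simp add: D_def mult.commute)
  finally show ?case by (simp add: D_def)
qed

lemma eig_unitary_coords:
  assumes "eig_unitary n A U" "x \<in> carrier_vec n" "i < n"
  shows "(cadj U *\<^sub>v (A *\<^sub>v x)) $ i = complex_of_real (eig (Suc i) A) * (cadj U *\<^sub>v x) $ i"
proof -
  let ?D = "mat_diag n (\<lambda>i. complex_of_real (eig (Suc i) A))"
  have Uu: "unitary_mat n U" and AU: "A = U * ?D * cadj U"
    using assms by (auto simp: eig_unitary_def)
  note U = unitary_matD[OF Uu]
  have "cadj U *\<^sub>v (A *\<^sub>v x) = (cadj U * A) *\<^sub>v x"
    using U(1) assms(2) eig_unitary_carrier[OF assms(1)] by (simp add: assoc_mult_mat_vec[of _ n n _ n])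
  also have "cadj U * A = ?D * cadj U"
  proof -
    have "cadj U * (U * ?D * cadj U) = (cadj U * U) * ?D * cadj U"
      using U(1) by (simp add: assoc_mult_mat[of _ n n _ n _ n] mult_carrier_mat[of _ n n _ n])
    thus ?thesis by (simp add: AU[symmetric] U(3) left_mult_one_mat[OF mat_diag_dim])
  qed
  also have "(?D * cadj U) *\<^sub>v x = ?D *\<^sub>v (cadj U *\<^sub>v x)"
    using U(1) assms(2) by (simp add: assoc_mult_mat_vec[of _ n n _ n])
  finally show ?thesis using U(1) assms by (simp add: mat_diag_mult_vec)
qed

text \<open>The sum is the m-th moment of the spectral measure of x. The left side does not mention
  U, so a bound on it controls the weights for every choice of eigenbasis.\<close>

lemma eig_unitary_pow_cinner:
  assumes "eig_unitary n A U" "x \<in> carrier_vec n"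
  shows "cinner (A ^\<^sub>m m *\<^sub>v x) x =
    complex_of_real (\<Sum>i<n. eig (Suc i) A ^ m * (cmod ((cadj U *\<^sub>v x) $ i))\<^sup>2)"
proof -
  let ?D = "mat_diag n (\<lambda>i. complex_of_real (eig (Suc i) A ^ m))"
  have Uu: "unitary_mat n U" using assms by (auto simp: eig_unitary_def)
  note U = unitary_matD[OF Uu]
  let ?y = "cadj U *\<^sub>v x"
  have y: "?y \<in> carrier_vec n" using U assms by simp
  have "cinner (A ^\<^sub>m m *\<^sub>v x) x = cinner (U *\<^sub>v (?D *\<^sub>v ?y)) x"
    unfolding eig_unitary_pow[OF assms(1)] using U(1) assms(2)
    by (simp add: assoc_mult_mat_vec[of _ n n _ n])
  also have "\<dots> = cinner (?D *\<^sub>v ?y) ?y"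
    using U(1) y assms(2) by (intro cinner_mult_left) (auto intro: mult_mat_vec_carrier[of _ n n])
  also have "\<dots> = (\<Sum>i<n. complex_of_real (eig (Suc i) A ^ m) * (?y $ i * cnj (?y $ i)))"
    using U(1) y carrier_matD[OF mat_diag_dim[of n "\<lambda>i. complex_of_real (eig (Suc i) A ^ m)"]]
    unfolding cinner_def by (intro sum.cong) (auto simp: mat_diag_mult_vec[OF y] simp del: index_mult_mat_vec)
  finally show ?thesis
    by (simp only: complex_norm_square[symmetric] of_real_mult[symmetric] of_real_sum[symmetric])
qed

lemma eig_unitary_cinner:
  assumes "eig_unitary n A U" "x \<in> carrier_vec n"
  shows "cinner (A *\<^sub>v x) x =
    complex_of_real (\<Sum>i<n. eig (Suc i) A * (cmod ((cadj U *\<^sub>v x) $ i))\<^sup>2)"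
  using eig_unitary_pow_cinner[OF assms, of 1] eig_unitary_carrier[OF assms(1)] by simp

lemma unitary_parseval:
  assumes "unitary_mat n U" "x \<in> carrier_vec n"
  shows "(\<Sum>i<n. (cmod ((cadj U *\<^sub>v x) $ i))\<^sup>2) = (vnorm x)\<^sup>2"
  using unitary_vnorm[OF unitary_mat_cadj[OF assms(1)] assms(2)] unitary_matD(1)[OF assms(1)]
    vnorm_power2[of "cadj U *\<^sub>v x"] by simp

lemma cadj_mult_vec_col:
  assumes "U \<in> carrier_mat n n" "x \<in> carrier_vec n" "i < n"
  shows "(cadj U *\<^sub>v x) $ i = cinner x (col U i)"
proof -
  have "(cadj U *\<^sub>v x) $ i = (\<Sum>k<dim_vec x. cadj U $$ (i,k) * x $ k)"
    using assms by (intro index_mult_vec_sum) auto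
  thus ?thesis using assms unfolding cinner_def by (auto simp: mult.commute intro!: sum.cong)
qed

section \<open>Rayleigh quotients and matrices of rank one\<close>

text \<open>There are n - 1 homogeneous linear conditions on n unknowns. A zero row pads the system
  to a square singular matrix, so that determinants supply the solution; the transposed matrix kills
  the last basis vector.\<close>

lemma ex_nonzero_orthogonal:
  assumes n: "n \<ge> 1" and f: "\<And>i. i < n - 1 \<Longrightarrow> f i \<in> carrier_vec n"
  shows "\<exists>x\<in>carrier_vec n. vnorm x \<noteq> 0 \<and> (\<forall>i<n-1. cinner x (f i) = 0)"
proof -
  define M where "M = mat n n (\<lambda>(i,j). if i < n - 1 then cnj (f i $ j) else 0)"
  have M: "M \<in> carrier_mat n n" by (simp add: M_def)
  let ?e = "unit_vec n (n - 1) :: complex vec"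
  have "transpose_mat M *\<^sub>v ?e = 0\<^sub>v n"
  proof (rule eq_vecI)
    fix i assume i: "i < dim_vec (0\<^sub>v n :: complex vec)"
    have "(transpose_mat M *\<^sub>v ?e) $ i = (\<Sum>k<dim_vec ?e. transpose_mat M $$ (i,k) * ?e $ k)"
      using i M by (intro index_mult_vec_sum) auto
    also have "\<dots> = 0" using n i by (intro sum.neutral) (auto simp: M_def)
    finally show "(transpose_mat M *\<^sub>v ?e) $ i = 0\<^sub>v n $ i" using i by simp
  qed (use M in auto)
  moreover have "?e \<noteq> 0\<^sub>v n" using n by simp
  ultimately have "Determinant.det (transpose_mat M) = 0"
    using M by (subst det_0_iff_vec_prod_zero[of _ n]) (auto intro!: exI[of _ ?e])
  hence "Determinant.det M = 0" using Determinant.det_transpose[OF M] by simp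
  then obtain x where x: "x \<in> carrier_vec n" "x \<noteq> 0\<^sub>v n" "M *\<^sub>v x = 0\<^sub>v n"
    using det_0_iff_vec_prod_zero[OF M] by blast
  have "cinner x (f i) = 0" if i: "i < n - 1" for i
  proof -
    have "(M *\<^sub>v x) $ i = (\<Sum>k<dim_vec x. M $$ (i,k) * x $ k)"
      using i M x(1) by (intro index_mult_vec_sum) auto
    also have "\<dots> = cinner x (f i)"
      using i x(1) unfolding cinner_def by (auto simp: M_def mult.commute intro!: sum.cong)
    finally show ?thesis using x(3) i by simp
  qed
  moreover have "vnorm x \<noteq> 0" using vnorm_eq_0 x by blast
  ultimately show ?thesis using x(1) by blast
qed

text \<open>In eigencoordinates the quadratic form is a weighted sum of eigenvalues. Orthogonality
  removes the m largest ones, and by Parseval the weights add up to the squared norm.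
  \<open>rayleigh_ge\<close> is the mirror image.\<close>

lemma rayleigh_le:
  assumes A: "hermitian_mat n A" and U: "eig_unitary n A U" and x: "x \<in> carrier_vec n"
    and m: "m < n" and 0: "\<And>i. i < m \<Longrightarrow> cinner x (col U i) = 0"
  shows "Re (cinner (A *\<^sub>v x) x) \<le> eig (Suc m) A * (vnorm x)\<^sup>2"
proof -
  have Uu: "unitary_mat n U" using U by (simp add: eig_unitary_def)
  have z: "(cadj U *\<^sub>v x) $ i = 0" if "i < m" for i
    using 0[OF that] cadj_mult_vec_col[OF unitary_matD(1)[OF Uu] x, of i] that m by simp
  have "Re (cinner (A *\<^sub>v x) x) = (\<Sum>i<n. eig (Suc i) A * (cmod ((cadj U *\<^sub>v x) $ i))\<^sup>2)"
    by (simp only: eig_unitary_cinner[OF U x] complex.sel Re_complex_of_real)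
  also have "\<dots> \<le> (\<Sum>i<n. eig (Suc m) A * (cmod ((cadj U *\<^sub>v x) $ i))\<^sup>2)"
  proof (intro sum_mono)
    fix i assume "i \<in> {..<n}"
    thus "eig (Suc i) A * (cmod ((cadj U *\<^sub>v x) $ i))\<^sup>2 \<le> eig (Suc m) A * (cmod ((cadj U *\<^sub>v x) $ i))\<^sup>2"
      using z[of i] eig_antimono[OF A, of "Suc m" "Suc i"] by (cases "i < m") (auto intro!: mult_right_mono)
  qed
  also have "\<dots> = eig (Suc m) A * (vnorm x)\<^sup>2"
    by (simp only: sum_distrib_left[symmetric] unitary_parseval[OF Uu x])
  finally show ?thesis .
qed

lemma rayleigh_ge:
  assumes A: "hermitian_mat n A" and U: "eig_unitary n A U" and x: "x \<in> carrier_vec n"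
    and m: "m < n" and 0: "\<And>i. m < i \<Longrightarrow> i < n \<Longrightarrow> cinner x (col U i) = 0"
  shows "Re (cinner (A *\<^sub>v x) x) \<ge> eig (Suc m) A * (vnorm x)\<^sup>2"
proof -
  have Uu: "unitary_mat n U" using U by (simp add: eig_unitary_def)
  have z: "(cadj U *\<^sub>v x) $ i = 0" if "m < i" "i < n" for i
    using 0[OF that] cadj_mult_vec_col[OF unitary_matD(1)[OF Uu] x, of i] that m by simp
  have "eig (Suc m) A * (vnorm x)\<^sup>2 = (\<Sum>i<n. eig (Suc m) A * (cmod ((cadj U *\<^sub>v x) $ i))\<^sup>2)"
    by (simp only: sum_distrib_left[symmetric] unitary_parseval[OF Uu x])
  also have "\<dots> \<le> (\<Sum>i<n. eig (Suc i) A * (cmod ((cadj U *\<^sub>v x) $ i))\<^sup>2)"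
  proof (intro sum_mono)
    fix i assume "i \<in> {..<n}"
    thus "eig (Suc m) A * (cmod ((cadj U *\<^sub>v x) $ i))\<^sup>2 \<le> eig (Suc i) A * (cmod ((cadj U *\<^sub>v x) $ i))\<^sup>2"
      using m z[of i] eig_antimono[OF A, of "Suc i" "Suc m"] by (cases "m < i") (auto intro!: mult_right_mono)
  qed
  also have "\<dots> = Re (cinner (A *\<^sub>v x) x)"
    by (simp only: eig_unitary_cinner[OF U x] complex.sel Re_complex_of_real)
  finally show ?thesis .
qed

text \<open>A Courant-Fischer dimension count. Being orthogonal to the k leading eigenvectors of B
  and to the n - 1 - k trailing ones of A is n - 1 conditions, so some nonzero x meets them all, and
  its two forms separate the eigenvalues. The family f omits column k of U, hence the shift by
  \<open>Suc\<close>.\<close>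

lemma eig_le_if_rayleigh_le:
  assumes A: "hermitian_mat n A" and B: "hermitian_mat n B" and k: "k < n"
    and le: "\<And>x. x \<in> carrier_vec n \<Longrightarrow> Re (cinner (A *\<^sub>v x) x) \<le> Re (cinner (B *\<^sub>v x) x)"
  shows "eig (Suc k) A \<le> eig (Suc k) B"
proof -
  obtain U V where U: "eig_unitary n A U" and V: "eig_unitary n B V"
    using ex_eig_unitary A B by blast
  have Uc: "U \<in> carrier_mat n n" and Vc: "V \<in> carrier_mat n n"
    using U V by (auto simp: eig_unitary_def unitary_matD)
  define f where "f = (\<lambda>i. if i < k then col V i else col U (Suc i))"
  have fc: "f i \<in> carrier_vec n" for i
    by (rule carrier_vecI) (use Uc Vc in \<open>auto simp: f_def\<close>)
  obtain x where x: "x \<in> carrier_vec n" "vnorm x \<noteq> 0" "\<And>i. i < n - 1 \<Longrightarrow> cinner x (f i) = 0"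
    using ex_nonzero_orthogonal[of n f, OF _ fc] k by auto
  have "eig (Suc k) A * (vnorm x)\<^sup>2 \<le> Re (cinner (A *\<^sub>v x) x)"
  proof (rule rayleigh_ge[OF A U x(1) k])
    fix i assume "k < i" "i < n"
    thus "cinner x (col U i) = 0" using x(3)[of "i - 1"] by (cases i) (auto simp: f_def)
  qed
  also have "\<dots> \<le> Re (cinner (B *\<^sub>v x) x)" by (rule le[OF x(1)])
  also have "\<dots> \<le> eig (Suc k) B * (vnorm x)\<^sup>2"
  proof (rule rayleigh_le[OF B V x(1) k])
    fix i assume "i < k"
    thus "cinner x (col V i) = 0" using x(3)[of i] k by (simp add: f_def)
  qed
  finally show ?thesis using x(2) by (simp add: zero_less_power2)
qed

text \<open>The same count, with orthogonality to v as one more condition. It is paid for by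
  dropping one eigenvector of A, so the index of A moves down by one.\<close>

lemma eig_le_if_rayleigh_le_hyperplane:
  assumes A: "hermitian_mat n A" and B: "hermitian_mat n B" and k: "Suc k < n"
    and v: "v \<in> carrier_vec n"
    and le: "\<And>x. x \<in> carrier_vec n \<Longrightarrow> cinner x v = 0 \<Longrightarrow>
        Re (cinner (A *\<^sub>v x) x) \<le> Re (cinner (B *\<^sub>v x) x)"
  shows "eig (Suc (Suc k)) A \<le> eig (Suc k) B"
proof -
  obtain U V where U: "eig_unitary n A U" and V: "eig_unitary n B V"
    using ex_eig_unitary A B by blast
  have Uc: "U \<in> carrier_mat n n" and Vc: "V \<in> carrier_mat n n"
    using U V by (auto simp: eig_unitary_def unitary_matD)
  define f where "f = (\<lambda>i. if i < k then col V i else if i = k then v else col U (Suc i))"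
  have fc: "f i \<in> carrier_vec n" for i
    by (rule carrier_vecI) (use Uc Vc v in \<open>auto simp: f_def\<close>)
  obtain x where x: "x \<in> carrier_vec n" "vnorm x \<noteq> 0" "\<And>i. i < n - 1 \<Longrightarrow> cinner x (f i) = 0"
    using ex_nonzero_orthogonal[of n f, OF _ fc] k by auto
  have "eig (Suc (Suc k)) A * (vnorm x)\<^sup>2 \<le> Re (cinner (A *\<^sub>v x) x)"
  proof (rule rayleigh_ge[OF A U x(1) k])
    fix i assume "Suc k < i" "i < n"
    thus "cinner x (col U i) = 0" using x(3)[of "i - 1"] by (cases i) (auto simp: f_def)
  qed
  also have "\<dots> \<le> Re (cinner (B *\<^sub>v x) x)"
    using x(3)[of k] k by (intro le[OF x(1)]) (simp add: f_def)
  also have "\<dots> \<le> eig (Suc k) B * (vnorm x)\<^sup>2"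
  proof (rule rayleigh_le[OF B V x(1)])
    fix i assume "i < k"
    thus "cinner x (col V i) = 0" using x(3)[of i] k by (simp add: f_def)
  qed (use k in simp)
  finally show ?thesis using x(2) by (simp add: zero_less_power2)
qed

lemma cinner_cauchy_schwarz: "dim_vec x = dim_vec y \<Longrightarrow> cmod (cinner x y) \<le> vnorm x * vnorm y"
proof -
  assume d: "dim_vec x = dim_vec y"
  have "cmod (cinner x y) \<le> (\<Sum>i<dim_vec x. \<bar>cmod (x $ i)\<bar> * \<bar>cmod (y $ i)\<bar>)"
    unfolding cinner_def by (rule order_trans[OF norm_sum]) (simp add: norm_mult)
  also have "\<dots> \<le> L2_set (\<lambda>i. cmod (x $ i)) {..<dim_vec x} * L2_set (\<lambda>i. cmod (y $ i)) {..<dim_vec x}"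
    by (rule L2_set_mult_ineq)
  finally show ?thesis by (simp add: L2_set_def vnorm_def d)
qed

text \<open>A nonzero vector orthogonal to all eigenvectors but the first tests the assumption at
  the largest eigenvalue.\<close>

lemma eig_1_le:
  assumes A: "hermitian_mat n A" and n: "1 \<le> n"
    and le: "\<And>x. x \<in> carrier_vec n \<Longrightarrow> Re (cinner (A *\<^sub>v x) x) \<le> c * (vnorm x)\<^sup>2"
  shows "eig 1 A \<le> c"
proof -
  obtain U where U: "eig_unitary n A U" using ex_eig_unitary A by blast
  have Uc: "U \<in> carrier_mat n n" using U by (auto simp: eig_unitary_def unitary_matD)
  have "col U (Suc i) \<in> carrier_vec n" for i by (rule carrier_vecI) (use Uc in auto)
  then obtain x where x: "x \<in> carrier_vec n" "vnorm x \<noteq> 0" "\<And>i. i < n - 1 \<Longrightarrow> cinner x (col U (Suc i)) = 0"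
    using ex_nonzero_orthogonal[OF n, of "\<lambda>i. col U (Suc i)"] by blast
  have "eig (Suc 0) A * (vnorm x)\<^sup>2 \<le> Re (cinner (A *\<^sub>v x) x)"
  proof (rule rayleigh_ge[OF A U x(1)])
    fix i assume "0 < i" "i < n"
    thus "cinner x (col U i) = 0" using x(3)[of "i - 1"] by simp
  qed (use n in simp)
  also have "\<dots> \<le> c * (vnorm x)\<^sup>2" by (rule le[OF x(1)])
  finally show ?thesis using x(2) by (simp add: zero_less_power2)
qed

section \<open>Hermitian matrices of rank one and the projection onto their eigenline\<close>

lemma rank_one_decomposition:
  assumes P: "hermitian_mat n P" and n: "1 \<le> n" and \<theta>: "\<theta> > 0"
    and eigs: "proots (char_poly P) = add_mset (complex_of_real \<theta>) (replicate_mset (n - 1) 0)"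
  obtains v where "v \<in> carrier_vec n" "vnorm v = 1" "real_mat P \<Longrightarrow> real_vec v"
    "\<And>i k. i < n \<Longrightarrow> k < n \<Longrightarrow> P $$ (i,k) = complex_of_real \<theta> * v $ i * cnj (v $ k)"
proof -
  note Pc = hermitian_matD[OF P]
  have m: "image_mset Re (proots (char_poly P)) = mset (replicate (n - 1) 0 @ [\<theta>])"
    by (simp add: eigs mset_replicate)
  have "sort (replicate (n - 1) 0 @ [\<theta>]) = replicate (n - 1) 0 @ [\<theta>]"
    by (rule sorted_sort_id) (use \<theta> in \<open>simp add: sorted_append\<close>)
  hence el: "eig_list P = \<theta> # replicate (n - 1) 0"
    by (simp add: eig_list_def m del: mset_append)
  hence ei: "eig (Suc i) P = (if i = 0 then \<theta> else 0)" if "i < n" for i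
    using that by (simp add: eig_def nth_Cons')
  obtain U where U: "unitary_mat n U"
      "P = U * mat_diag n (\<lambda>i. complex_of_real (eig (Suc i) P)) * cadj U"
    using hermitian_spectral[OF P] by blast
  note Uc = unitary_matD[OF U(1)]
  define w where "w = col U 0"
  have w: "w \<in> carrier_vec n" by (rule carrier_vecI) (use Uc(1) in \<open>simp add: w_def\<close>)
  have wi: "w $ i = U $$ (i,0)" if "i < n" for i using that Uc(1) n by (simp add: w_def)
  have Pw: "P $$ (i,k) = complex_of_real \<theta> * w $ i * cnj (w $ k)" if ik: "i < n" "k < n" for i k
  proof -
    let ?D = "mat_diag n (\<lambda>i. complex_of_real (eig (Suc i) P))"
    have UD: "U * ?D = mat n n (\<lambda>(i,j). U $$ (i,j) * complex_of_real (eig (Suc j) P))"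
      by (rule mat_diag_mult_right[OF Uc(1)])
    have "(U * ?D * cadj U) $$ (i,k) = (\<Sum>l<n. (U * ?D) $$ (i,l) * cadj U $$ (l,k))"
      unfolding UD using ik Uc(1) by (subst index_mult_sum) auto
    also have "\<dots> = (\<Sum>l<n. if l = 0 then complex_of_real \<theta> * w $ i * cnj (w $ k) else 0)"
      unfolding UD using ik Uc(1) n by (intro sum.cong) (auto simp: ei wi)
    also have "\<dots> = complex_of_real \<theta> * w $ i * cnj (w $ k)" using n by simp
    finally show ?thesis using U(2) by simp
  qed
  have nw: "vnorm w = 1"
  proof -
    have "(cadj U * U) $$ (0,0) = (\<Sum>l<n. cadj U $$ (0,l) * U $$ (l,0))"
      using n Uc(1) by (subst index_mult_sum) auto
    also have "\<dots> = cinner w w"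
      unfolding cinner_def using n Uc(1) w by (auto intro!: sum.cong simp: wi mult.commute)
    finally have "cinner w w = 1" using n by (simp add: Uc(3))
    hence "(vnorm w)\<^sup>2 = 1" unfolding cinner_self by (metis of_real_eq_1_iff)
    thus ?thesis using vnorm_nonneg[of w] by (simp add: power2_eq_1_iff)
  qed
  have "\<exists>i<n. w $ i \<noteq> 0"
  proof (rule ccontr)
    assume "\<not> ?thesis"
    hence "vnorm w = 0" using w by (simp add: vnorm_def)
    thus False using nw by simp
  qed
  then obtain l where l: "l < n" "w $ l \<noteq> 0" by blast
  \<comment> \<open>The spectral theorem gives a complex w even when P is real. This phase makes the
    l-th entry of c w positive; then c w is column l of P up to a positive factor, so it is real
    whenever P is.\<close>
  define c where "c = cnj (w $ l) / complex_of_real (cmod (w $ l))"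
  have c1: "cmod c = 1" using l by (simp add: c_def norm_divide)
  have cc: "c * cnj c = 1" using c1 by (simp add: complex_norm_square[symmetric])
  define v where "v = c \<cdot>\<^sub>v w"
  show ?thesis
  proof (rule that[of v])
    show "v \<in> carrier_vec n" using w by (simp add: v_def)
    show "vnorm v = 1" using c1 nw by (simp add: v_def vnorm_smult)
    show "P $$ (i,k) = complex_of_real \<theta> * v $ i * cnj (v $ k)" if "i < n" "k < n" for i k
    proof -
      have "complex_of_real \<theta> * v $ i * cnj (v $ k) = (c * cnj c) * (complex_of_real \<theta> * w $ i * cnj (w $ k))"
        using that w by (simp add: v_def)
      thus ?thesis by (simp only: Pw[OF that] cc mult_1_left)
    qed
    assume Pr: "real_mat P"
    show "real_vec v"
      unfolding real_vec_def
    proof (intro allI impI)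
      fix i assume "i < dim_vec v"
      hence i: "i < n" using w by (simp add: v_def)
      have "Im (P $$ (i,l)) = 0" using Pr Pc(1) i l(1) by (auto simp: real_mat_def)
      hence "Im (complex_of_real \<theta> * (w $ i * cnj (w $ l))) = 0"
        by (simp only: Pw[OF i l(1)] mult.assoc)
      hence "\<theta> * Im (w $ i * cnj (w $ l)) = 0" by simp
      hence "Im (w $ i * cnj (w $ l)) = 0" using \<theta> by (simp only: mult_eq_0_iff) auto
      moreover have "v $ i = (w $ i * cnj (w $ l)) / complex_of_real (cmod (w $ l))"
        using i w by (simp add: v_def c_def)
      ultimately show "Im (v $ i) = 0" by (simp only: Im_divide_of_real div_0)
    qed
  qed
qed

lemma rank_one_mult_vec:
  assumes "P \<in> carrier_mat n n" "v \<in> carrier_vec n" "x \<in> carrier_vec n"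
    "\<And>i k. i < n \<Longrightarrow> k < n \<Longrightarrow> P $$ (i,k) = t * v $ i * cnj (v $ k)"
  shows "P *\<^sub>v x = (t * cinner x v) \<cdot>\<^sub>v v"
proof (rule eq_vecI)
  fix i assume "i < dim_vec ((t * cinner x v) \<cdot>\<^sub>v v)"
  hence i: "i < n" using assms by simp
  have "(P *\<^sub>v x) $ i = (\<Sum>k<dim_vec x. P $$ (i,k) * x $ k)"
    using i assms by (intro index_mult_vec_sum) auto
  also have "\<dots> = (\<Sum>k<dim_vec x. t * v $ i * (x $ k * cnj (v $ k)))"
    using i assms by (intro sum.cong) auto
  also have "\<dots> = t * v $ i * cinner x v" by (simp only: cinner_def sum_distrib_left)
  finally show "(P *\<^sub>v x) $ i = ((t * cinner x v) \<cdot>\<^sub>v v) $ i" using i assms by simp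
qed (use assms in auto)

text \<open>Applied to x, the matrix gives t times the difference of x and its projection <x, v> v.
  As t is nonzero, this vanishes exactly on the line through v.\<close>

lemma mat_ker_rank_one:
  assumes "P \<in> carrier_mat n n" "v \<in> carrier_vec n" "vnorm v = 1" "t \<noteq> 0"
    "\<And>i k. i < n \<Longrightarrow> k < n \<Longrightarrow> P $$ (i,k) = t * v $ i * cnj (v $ k)"
  shows "mat_ker n (t \<cdot>\<^sub>m 1\<^sub>m n - P) = range (\<lambda>c. c \<cdot>\<^sub>v v)"
proof -
  have vv: "cinner v v = 1" using cinner_self[of v] assms by simp
  have *: "(t \<cdot>\<^sub>m 1\<^sub>m n - P) *\<^sub>v x = t \<cdot>\<^sub>v (x - cinner x v \<cdot>\<^sub>v v)" if x: "x \<in> carrier_vec n" for x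
  proof -
    have "(t \<cdot>\<^sub>m 1\<^sub>m n - P) *\<^sub>v x = (t \<cdot>\<^sub>m 1\<^sub>m n) *\<^sub>v x - P *\<^sub>v x"
      using assms(1) x by (intro minus_mult_distrib_mat_vec) auto
    also have "(t \<cdot>\<^sub>m 1\<^sub>m n) *\<^sub>v x = t \<cdot>\<^sub>v x"
      using x by (intro eq_vecI) auto
    also have "P *\<^sub>v x = (t * cinner x v) \<cdot>\<^sub>v v"
      by (rule rank_one_mult_vec[OF assms(1,2) x]) (rule assms(5))
    also have "t \<cdot>\<^sub>v x - (t * cinner x v) \<cdot>\<^sub>v v = t \<cdot>\<^sub>v (x - cinner x v \<cdot>\<^sub>v v)"
      using x assms(2) by (intro eq_vecI) (auto simp: algebra_simps)
    finally show ?thesis .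
  qed
  show ?thesis
  proof (intro subset_antisym subsetI)
    fix x assume "x \<in> mat_ker n (t \<cdot>\<^sub>m 1\<^sub>m n - P)"
    hence x: "x \<in> carrier_vec n" and k: "t \<cdot>\<^sub>v (x - cinner x v \<cdot>\<^sub>v v) = 0\<^sub>v n"
      using * by (auto simp: mat_ker_def)
    have "x = cinner x v \<cdot>\<^sub>v v"
    proof (rule eq_vecI)
      fix i assume "i < dim_vec (cinner x v \<cdot>\<^sub>v v)"
      hence i: "i < n" using assms by simp
      have "(t \<cdot>\<^sub>v (x - cinner x v \<cdot>\<^sub>v v)) $ i = 0" using k i by simp
      thus "x $ i = (cinner x v \<cdot>\<^sub>v v) $ i" using i x assms by simp
    qed (use x assms in auto)
    thus "x \<in> range (\<lambda>c. c \<cdot>\<^sub>v v)" by blast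
  next
    fix x assume "x \<in> range (\<lambda>c. c \<cdot>\<^sub>v v)"
    then obtain c where c: "x = c \<cdot>\<^sub>v v" by blast
    hence x: "x \<in> carrier_vec n" using assms by simp
    have "cinner x v = c" unfolding c by (simp add: cinner_smult_left vv)
    hence "(t \<cdot>\<^sub>m 1\<^sub>m n - P) *\<^sub>v x = 0\<^sub>v n"
      unfolding *[OF x] using c assms(2) by (intro eq_vecI) auto
    thus "x \<in> mat_ker n (t \<cdot>\<^sub>m 1\<^sub>m n - P)" using x by (simp add: mat_ker_def)
  qed
qed

text \<open>\<open>proj_norm\<close> is defined by a definite description, so the projection <x, v>
  v has to be shown to be the only point of the line with orthogonal remainder.\<close>

lemma proj_norm_line:
  assumes v: "v \<in> carrier_vec n" "vnorm v = 1" and x: "x \<in> carrier_vec n"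
  shows "proj_norm (range (\<lambda>c. c \<cdot>\<^sub>v v)) x = cmod (cinner x v)"
proof -
  have vv: "cinner v v = 1" using cinner_self[of v] v by simp
  have d: "cinner (x - c \<cdot>\<^sub>v v) v = cinner x v - c" for c
  proof -
    have "cinner (x - c \<cdot>\<^sub>v v) v = cinner x v - c * cinner v v"
      using v x by (simp add: cinner_def left_diff_distrib sum_subtractf sum_distrib_left mult.assoc)
    thus ?thesis by (simp add: vv)
  qed
  have "(THE p. p \<in> range (\<lambda>c. c \<cdot>\<^sub>v v) \<and> (\<forall>w\<in>range (\<lambda>c. c \<cdot>\<^sub>v v). cinner (x - p) w = 0)) = cinner x v \<cdot>\<^sub>v v"
  proof (rule the_equality, intro conjI ballI)
    fix w assume "w \<in> range (\<lambda>c. c \<cdot>\<^sub>v v)"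
    then obtain c where "w = c \<cdot>\<^sub>v v" by blast
    thus "cinner (x - cinner x v \<cdot>\<^sub>v v) w = 0"
      using d[of "cinner x v"] v x by (simp add: cinner_smult_right)
  next
    fix p assume p: "p \<in> range (\<lambda>c. c \<cdot>\<^sub>v v) \<and> (\<forall>w\<in>range (\<lambda>c. c \<cdot>\<^sub>v v). cinner (x - p) w = 0)"
    then obtain c where c: "p = c \<cdot>\<^sub>v v" by blast
    have "1 \<cdot>\<^sub>v v \<in> range (\<lambda>c. c \<cdot>\<^sub>v v)" by blast
    hence "cinner (x - p) (1 \<cdot>\<^sub>v v) = 0" using p by blast
    hence "c = cinner x v" using d[of c] v by (simp add: c)
    thus "p = cinner x v \<cdot>\<^sub>v v" using c by simp
  qed blast
  thus ?thesis by (simp add: proj_norm_def vnorm_smult v(2))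
qed

section \<open>Rademacher chaos\<close>

text \<open>Expectation over independent uniform signs; \<open>S\<close> is the set of coordinates with sign \<open>-1\<close>.\<close>
definition rad :: "nat \<Rightarrow> ((nat \<Rightarrow> real) \<Rightarrow> real) \<Rightarrow> real" where
  "rad n F = (\<Sum>S\<in>Pow {..<n}. F (\<lambda>i. if i \<in> S then -1 else 1)) / 2 ^ n"

lemma rad_0 [simp]: "rad 0 F = F (\<lambda>_. 1)"
  by (simp add: rad_def)

lemma rad_add: "rad n (\<lambda>e. F e + G e) = rad n F + rad n G"
  by (simp add: rad_def sum.distrib add_divide_distrib)

lemma rad_cmult: "rad n (\<lambda>e. c * F e) = c * rad n F"
  by (simp add: rad_def sum_distrib_left)

lemma rad_const [simp]: "rad n (\<lambda>e. c) = c"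
  by (simp add: rad_def card_Pow)

lemma rad_nonneg: "(\<And>e. F e \<ge> 0) \<Longrightarrow> rad n F \<ge> 0"
  by (simp add: rad_def sum_nonneg)

lemma rad_cauchy_schwarz:
  "(rad n (\<lambda>e. F e * G e))\<^sup>2 \<le> rad n (\<lambda>e. (F e)\<^sup>2) * rad n (\<lambda>e. (G e)\<^sup>2)"
proof -
  let ?s = "\<lambda>S i. if i \<in> S then -1 else (1::real)"
  have "(\<Sum>S\<in>Pow {..<n}. F (?s S) * G (?s S))\<^sup>2 / (2^n * 2^n)
      \<le> (\<Sum>S\<in>Pow {..<n}. (F (?s S))\<^sup>2) * (\<Sum>S\<in>Pow {..<n}. (G (?s S))\<^sup>2) / (2^n * 2^n)"
    by (intro divide_right_mono Cauchy_Schwarz_ineq_sum) auto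
  thus ?thesis by (simp add: rad_def power_divide power2_eq_square)
qed

text \<open>Conditioning on the last sign: the subsets of {..<n+1} split according to whether they
  contain n. All chaos moments below are computed by this recursion.\<close>

lemma rad_Suc: "rad (Suc n) F = rad n (\<lambda>e. (F (e(n := 1)) + F (e(n := -1))) / 2)"
proof -
  let ?s = "\<lambda>S i. if i \<in> S then -1 else (1::real)"
  have P: "Pow {..<Suc n} = Pow {..<n} \<union> insert n ` Pow {..<n}"
    by (simp add: lessThan_Suc Pow_insert)
  have inj: "inj_on (insert n) (Pow {..<n})"
    by (auto simp: inj_on_def)
  have "(\<Sum>S\<in>Pow {..<Suc n}. F (?s S)) =
      (\<Sum>S\<in>Pow {..<n}. F (?s S)) + (\<Sum>S\<in>insert n ` Pow {..<n}. F (?s S))"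
    unfolding P by (rule sum.union_disjoint) auto
  also have "(\<Sum>S\<in>insert n ` Pow {..<n}. F (?s S)) = (\<Sum>S\<in>Pow {..<n}. F (?s (insert n S)))"
    by (simp only: sum.reindex[OF inj] comp_def)
  also have "\<dots> = (\<Sum>S\<in>Pow {..<n}. F ((?s S)(n := -1)))"
    by (intro sum.cong refl arg_cong[of _ _ F]) auto
  also have "(\<Sum>S\<in>Pow {..<n}. F (?s S)) = (\<Sum>S\<in>Pow {..<n}. F ((?s S)(n := 1)))"
    by (intro sum.cong refl arg_cong[of _ _ F]) (auto simp: fun_eq_iff)
  finally have "(\<Sum>S\<in>Pow {..<Suc n}. F (?s S)) =
      (\<Sum>S\<in>Pow {..<n}. F ((?s S)(n := 1)) + F ((?s S)(n := -1)))"
    by (simp only: sum.distrib)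
  thus ?thesis
    by (simp only: rad_def sum_divide_distrib[symmetric] power_Suc divide_divide_eq_left)
qed

text \<open>As g and h do not see coordinate n, the cross term is odd in the last sign and averages
  out.\<close>

lemma rad_Suc_power2:
  assumes "\<And>e x. g (e(n := x)) = g e" "\<And>e x. h (e(n := x)) = h e"
  shows "rad (Suc n) (\<lambda>e. (g e + e n * h e)\<^sup>2) = rad n (\<lambda>e. (g e)\<^sup>2) + rad n (\<lambda>e. (h e)\<^sup>2)"
proof -
  have "rad (Suc n) (\<lambda>e. (g e + e n * h e)\<^sup>2) = rad n (\<lambda>e. (g e)\<^sup>2 + (h e)\<^sup>2)"
    unfolding rad_Suc by (rule arg_cong[of _ _ "rad n"]) (auto simp: assms power2_eq_square algebra_simps)
  thus ?thesis by (simp add: rad_add)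
qed

text \<open>The inductive step of Bonami's hypercontractive inequality.\<close>
lemma rad_Suc_power4:
  assumes g: "\<And>e x. g (e(n := x)) = g e" and h: "\<And>e x. h (e(n := x)) = h e"
    and g4: "rad n (\<lambda>e. (g e)^4) \<le> C\<^sup>2 * (rad n (\<lambda>e. (g e)\<^sup>2))\<^sup>2"
    and h4: "rad n (\<lambda>e. (h e)^4) \<le> D\<^sup>2 * (rad n (\<lambda>e. (h e)\<^sup>2))\<^sup>2"
    and CD: "0 \<le> D" "3 * D \<le> C"
  shows "rad (Suc n) (\<lambda>e. (g e + e n * h e)^4) \<le> C\<^sup>2 * (rad (Suc n) (\<lambda>e. (g e + e n * h e)\<^sup>2))\<^sup>2"
proof -
  define A where "A = rad n (\<lambda>e. (g e)\<^sup>2)"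
  define B where "B = rad n (\<lambda>e. (h e)\<^sup>2)"
  have AB: "A \<ge> 0" "B \<ge> 0" by (auto simp: A_def B_def intro: rad_nonneg)
  have C: "C \<ge> 0" using CD by linarith
  define G where "G = rad n (\<lambda>e. (g e)\<^sup>2 * (h e)\<^sup>2)"
  \<comment> \<open>Odd powers of the last sign cancel, leaving the terms 1, 6, 1 of the binomial
    expansion.\<close>
  have "rad (Suc n) (\<lambda>e. (g e + e n * h e)^4) =
      rad n (\<lambda>e. (g e)^4 + (6 * ((g e)\<^sup>2 * (h e)\<^sup>2) + (h e)^4))"
    unfolding rad_Suc
    by (rule arg_cong[of _ _ "rad n"]) (auto simp: g h power2_eq_square power4_eq_xxxx algebra_simps)
  hence e: "rad (Suc n) (\<lambda>e. (g e + e n * h e)^4) =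
      rad n (\<lambda>e. (g e)^4) + (6 * G + rad n (\<lambda>e. (h e)^4))"
    by (simp only: rad_add rad_cmult G_def)
  have "G\<^sup>2 \<le> rad n (\<lambda>e. ((g e)\<^sup>2)\<^sup>2) * rad n (\<lambda>e. ((h e)\<^sup>2)\<^sup>2)"
    unfolding G_def by (rule rad_cauchy_schwarz)
  also have "\<dots> = rad n (\<lambda>e. (g e)^4) * rad n (\<lambda>e. (h e)^4)" by simp
  also have "\<dots> \<le> (C\<^sup>2 * A\<^sup>2) * (D\<^sup>2 * B\<^sup>2)"
    using g4 h4 by (intro mult_mono) (auto simp: A_def B_def intro: rad_nonneg)
  also have "\<dots> = (C * A * (D * B))\<^sup>2" by (simp add: power_mult_distrib)
  finally have "G \<le> C * A * (D * B)"
    using power2_le_imp_le[of G] C CD AB by simp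
  \<comment> \<open>Here \<open>3 * D \<le> C\<close> is used: it turns the bound 6 C D A B on the
    mixed term into 2 C^2 A B, the cross term of C^2 (A + B)^2.\<close>
  moreover have "C * A * (D * B) * 3 \<le> C\<^sup>2 * (A * B)"
  proof -
    have "(C * A * B) * (3 * D) \<le> (C * A * B) * C" using CD C AB by (intro mult_left_mono) auto
    thus ?thesis by (simp add: power2_eq_square mult_ac)
  qed
  moreover have "D\<^sup>2 * B\<^sup>2 \<le> C\<^sup>2 * B\<^sup>2"
    using CD C by (intro mult_right_mono power_mono) auto
  ultimately have "rad (Suc n) (\<lambda>e. (g e + e n * h e)^4) \<le> C\<^sup>2 * A\<^sup>2 + (2 * (C\<^sup>2 * (A * B)) + C\<^sup>2 * B\<^sup>2)"
    using g4 h4 unfolding e A_def[symmetric] B_def[symmetric] by linarith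
  also have "\<dots> = C\<^sup>2 * (A + B)\<^sup>2" by (simp add: power2_sum algebra_simps)
  finally show ?thesis unfolding rad_Suc_power2[of g n h, OF g h] A_def B_def .
qed

lemma rad_linear_power2: "rad n (\<lambda>e. (\<Sum>i<n. c i * e i)\<^sup>2) = (\<Sum>i<n. (c i)\<^sup>2)"
proof (induct n)
  case (Suc n)
  have "rad (Suc n) (\<lambda>e. ((\<Sum>i<n. c i * e i) + e n * c n)\<^sup>2) =
      rad n (\<lambda>e. (\<Sum>i<n. c i * e i)\<^sup>2) + rad n (\<lambda>e. (c n)\<^sup>2)"
    by (rule rad_Suc_power2) (auto intro!: sum.cong)
  thus ?case using Suc by (simp add: mult.commute)
qed simp

text \<open>The coefficient of the last sign is a constant, for which D = 1 works, so C = 3. Each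
  further degree costs another factor 3.\<close>

lemma rad_linear_power4:
  "rad n (\<lambda>e. (\<Sum>i<n. c i * e i)^4) \<le> 3\<^sup>2 * (rad n (\<lambda>e. (\<Sum>i<n. c i * e i)\<^sup>2))\<^sup>2"
proof (induct n)
  case (Suc n)
  have "rad (Suc n) (\<lambda>e. ((\<Sum>i<n. c i * e i) + e n * c n)^4) \<le>
      3\<^sup>2 * (rad (Suc n) (\<lambda>e. ((\<Sum>i<n. c i * e i) + e n * c n)\<^sup>2))\<^sup>2"
    by (rule rad_Suc_power4[where D = 1]) (use Suc in \<open>auto intro!: sum.cong\<close>)
  thus ?case by (simp add: mult.commute)
qed simp

lemma rad_quadratic_power2:
  "rad n (\<lambda>e. (\<Sum>i<n. e i * (\<Sum>k<i. a i k * e k))\<^sup>2) = (\<Sum>i<n. \<Sum>k<i. (a i k)\<^sup>2)"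
proof (induct n)
  case (Suc n)
  have "rad (Suc n) (\<lambda>e. ((\<Sum>i<n. e i * (\<Sum>k<i. a i k * e k)) + e n * (\<Sum>k<n. a n k * e k))\<^sup>2) =
      rad n (\<lambda>e. (\<Sum>i<n. e i * (\<Sum>k<i. a i k * e k))\<^sup>2) + rad n (\<lambda>e. (\<Sum>k<n. a n k * e k)\<^sup>2)"
    by (rule rad_Suc_power2) (auto intro!: sum.cong)
  thus ?case using Suc by (simp add: rad_linear_power2)
qed simp

text \<open>The coefficient of the last sign is now linear, so D = 3 and C = 9, and 81 =
  9^2.\<close>

lemma rad_quadratic_power4:
  "rad n (\<lambda>e. (\<Sum>i<n. e i * (\<Sum>k<i. a i k * e k))^4) \<le> 81 * (\<Sum>i<n. \<Sum>k<i. (a i k)\<^sup>2)\<^sup>2"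
proof -
  have "rad n (\<lambda>e. (\<Sum>i<n. e i * (\<Sum>k<i. a i k * e k))^4)
      \<le> 9\<^sup>2 * (rad n (\<lambda>e. (\<Sum>i<n. e i * (\<Sum>k<i. a i k * e k))\<^sup>2))\<^sup>2"
  proof (induct n)
    case (Suc n)
    have "rad (Suc n) (\<lambda>e. ((\<Sum>i<n. e i * (\<Sum>k<i. a i k * e k)) + e n * (\<Sum>k<n. a n k * e k))^4) \<le>
        9\<^sup>2 * (rad (Suc n) (\<lambda>e. ((\<Sum>i<n. e i * (\<Sum>k<i. a i k * e k)) + e n * (\<Sum>k<n. a n k * e k))\<^sup>2))\<^sup>2"
      by (rule rad_Suc_power4[where D = 3])
         (use Suc rad_linear_power4[of n "a n"] in \<open>auto intro!: sum.cong\<close>)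
    thus ?case by simp
  qed simp
  thus ?thesis by (simp add: rad_quadratic_power2)
qed

lemma sum_symmetric_split:
  fixes f :: "nat \<Rightarrow> nat \<Rightarrow> real"
  assumes "\<And>i k. i < n \<Longrightarrow> k < n \<Longrightarrow> f i k = f k i"
  shows "(\<Sum>i<n. \<Sum>k<n. f i k) = (\<Sum>i<n. f i i) + 2 * (\<Sum>i<n. \<Sum>k<i. f i k)"
  using assms
proof (induct n)
  case (Suc n)
  have "(\<Sum>i<n. f i n) = (\<Sum>k<n. f n k)" by (intro sum.cong) (auto intro: Suc(2))
  moreover have "(\<Sum>i<n. \<Sum>k<n. f i k) = (\<Sum>i<n. f i i) + 2 * (\<Sum>i<n. \<Sum>k<i. f i k)"
    by (rule Suc(1)) (auto intro: Suc(2))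
  ultimately show ?case by (simp add: sum.distrib)
qed simp

text \<open>Signs square to 1, so the diagonal part of the form equals the subtracted trace. What
  remains is twice the strictly triangular chaos treated above.\<close>

lemma rad_quadratic_form_centered_power4:
  assumes b: "\<And>i k. i < n \<Longrightarrow> k < n \<Longrightarrow> b i k = b k i"
  shows "rad n (\<lambda>e. ((\<Sum>i<n. \<Sum>k<n. b i k * (e i * e k)) - (\<Sum>i<n. b i i))^4)
      \<le> 324 * (\<Sum>i<n. \<Sum>k<n. (b i k)\<^sup>2)\<^sup>2"
proof -
  let ?q = "\<lambda>e. \<Sum>i<n. e i * (\<Sum>k<i. b i k * e k)"
  let ?s = "\<lambda>S i. if i \<in> S then -1 else (1::real)"
  have eq: "(\<Sum>i<n. \<Sum>k<n. b i k * (?s S i * ?s S k)) - (\<Sum>i<n. b i i) = 2 * ?q (?s S)" for S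
  proof -
    have "(\<Sum>i<n. \<Sum>k<n. b i k * (?s S i * ?s S k)) =
        (\<Sum>i<n. b i i * (?s S i * ?s S i)) + 2 * (\<Sum>i<n. \<Sum>k<i. b i k * (?s S i * ?s S k))"
      using b by (intro sum_symmetric_split) (auto simp: mult.commute)
    also have "(\<Sum>i<n. b i i * (?s S i * ?s S i)) = (\<Sum>i<n. b i i)"
      by (intro sum.cong) auto
    also have "(\<Sum>i<n. \<Sum>k<i. b i k * (?s S i * ?s S k)) = ?q (?s S)"
      unfolding sum_distrib_left by (intro sum.cong refl) (simp only: mult_ac)
    finally show ?thesis by simp
  qed
  have "rad n (\<lambda>e. ((\<Sum>i<n. \<Sum>k<n. b i k * (e i * e k)) - (\<Sum>i<n. b i i))^4) = rad n (\<lambda>e. 16 * ?q e ^ 4)"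
    unfolding rad_def eq by (simp add: power_mult_distrib)
  also have "\<dots> = 16 * rad n (\<lambda>e. ?q e ^ 4)" by (rule rad_cmult)
  also have "\<dots> \<le> 16 * (81 * (\<Sum>i<n. \<Sum>k<i. (b i k)\<^sup>2)\<^sup>2)"
    using rad_quadratic_power4[of n b] by simp
  \<comment> \<open>2^4 * 81 = 1296, and passing from the triangular sum to its double divides by 4,
    giving 324.\<close>
  also have "\<dots> = 324 * (2 * (\<Sum>i<n. \<Sum>k<i. (b i k)\<^sup>2))\<^sup>2" by (simp add: power_mult_distrib)
  also have "\<dots> \<le> 324 * (\<Sum>i<n. \<Sum>k<n. (b i k)\<^sup>2)\<^sup>2"
  proof -
    have "(\<Sum>i<n. \<Sum>k<n. (b i k)\<^sup>2) = (\<Sum>i<n. (b i i)\<^sup>2) + 2 * (\<Sum>i<n. \<Sum>k<i. (b i k)\<^sup>2)"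
      using b by (intro sum_symmetric_split) auto
    moreover have "(\<Sum>i<n. (b i i)\<^sup>2) \<ge> 0" "(\<Sum>i<n. \<Sum>k<i. (b i k)\<^sup>2) \<ge> 0" by (auto intro!: sum_nonneg)
    ultimately show ?thesis by (intro mult_left_mono power_mono) auto
  qed
  finally show ?thesis .
qed

section \<open>Quadratic forms of invariant random matrices\<close>

definition tr :: "complex mat \<Rightarrow> complex" where
  "tr A = (\<Sum>i<dim_row A. A $$ (i,i))"

lemma tr_mult_commute:
  assumes "A \<in> carrier_mat n k" "B \<in> carrier_mat k n"
  shows "tr (A * B) = tr (B * A)"
proof -
  have "tr (A * B) = (\<Sum>i<n. \<Sum>l<k. A $$ (i,l) * B $$ (l,i))"
    unfolding tr_def using assms by (auto intro!: sum.cong simp: index_mult_sum simp del: index_mult_mat(1))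
  also have "\<dots> = (\<Sum>l<k. \<Sum>i<n. A $$ (i,l) * B $$ (l,i))" by (rule sum.swap)
  also have "\<dots> = tr (B * A)"
    unfolding tr_def using assms
    by (auto intro!: sum.cong simp: index_mult_sum mult.commute simp del: index_mult_mat(1))
  finally show ?thesis .
qed

lemma tr_unitary_conj:
  assumes "unitary_mat n U" "A \<in> carrier_mat n n"
  shows "tr (U * A * cadj U) = tr A"
proof -
  note U = unitary_matD[OF assms(1)]
  have "tr (U * A * cadj U) = tr (cadj U * (U * A))"
    using U(1) assms(2) by (intro tr_mult_commute[of _ n n]) auto
  also have "cadj U * (U * A) = (cadj U * U) * A"
    using U(1) assms(2) by (intro assoc_mult_mat[symmetric, of _ n n _ n _ n]) auto
  finally show ?thesis using assms(2) by (simp add: U(3))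
qed

lemma unitary_conj_mult:
  assumes "unitary_mat n U" "A \<in> carrier_mat n n" "B \<in> carrier_mat n n"
  shows "(U * A * cadj U) * (U * B * cadj U) = U * (A * B) * cadj U"
proof -
  note U = unitary_matD[OF assms(1)]
  have "(U * A * cadj U) * (U * B * cadj U) = U * (A * (cadj U * U) * B) * cadj U"
    using U(1) assms
    by (simp add: assoc_mult_mat[of _ n n _ n _ n] mult_carrier_mat[of _ n n _ n])
  thus ?thesis by (simp add: U(3) right_mult_one_mat[OF assms(2)])
qed

lemma unitary_conj_pow:
  assumes "unitary_mat n U" "A \<in> carrier_mat n n"
  shows "(U * A * cadj U) ^\<^sub>m m = U * A ^\<^sub>m m * cadj U"
proof (induct m)
  case 0
  show ?case using unitary_matD[OF assms(1)] assms(2) by simp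
next
  case (Suc m)
  thus ?case using unitary_conj_mult[OF assms(1) _ assms(2), of "A ^\<^sub>m m"] assms(2) by simp
qed

lemma tr_mat_diag: "tr (mat_diag n f) = (\<Sum>i<n. f i)"
  by (simp add: tr_def mat_diag_def)

lemma tr_pow:
  assumes "hermitian_mat n A"
  shows "tr (A ^\<^sub>m m) = complex_of_real (\<Sum>i<n. eig (Suc i) A ^ m)"
proof -
  obtain U where U: "eig_unitary n A U" using ex_eig_unitary[OF assms] by blast
  hence "unitary_mat n U" by (simp add: eig_unitary_def)
  thus ?thesis unfolding eig_unitary_pow[OF U] by (simp add: tr_unitary_conj tr_mat_diag)
qed

lemma tr_pow_power2:
  assumes "hermitian_mat n A"
  shows "tr (A ^\<^sub>m m * A ^\<^sub>m m) = complex_of_real (\<Sum>i<n. eig (Suc i) A ^ (2 * m))"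
proof -
  obtain U where U: "eig_unitary n A U" using ex_eig_unitary[OF assms] by blast
  hence Uu: "unitary_mat n U" by (simp add: eig_unitary_def)
  show ?thesis unfolding eig_unitary_pow[OF U]
    by (subst unitary_conj_mult[OF Uu])
       (simp_all add: tr_unitary_conj[OF Uu] tr_mat_diag mult_2 power_add)
qed

lemma hermitian_pow:
  assumes "hermitian_mat n A"
  shows "hermitian_mat n (A ^\<^sub>m m)"
proof -
  obtain U where U: "eig_unitary n A U" using ex_eig_unitary[OF assms] by blast
  hence Uu: "unitary_mat n U" by (simp add: eig_unitary_def)
  note Uc = unitary_matD[OF Uu]
  let ?D = "mat_diag n (\<lambda>i. complex_of_real (eig (Suc i) A ^ m))"
  have "cadj ?D = ?D" by (rule eq_matI) (auto simp: mat_diag_def)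
  hence "hermitian_mat n ?D" by (simp add: hermitian_mat_def)
  from hermitian_mat_conj[OF this, of "cadj U"] Uc(1) show ?thesis
    by (simp add: eig_unitary_pow[OF U])
qed

text \<open>The squared Hilbert-Schmidt norm, written as a trace so that it depends on the
  eigenvalues alone.\<close>

lemma sum_cmod_power2_hermitian:
  assumes "hermitian_mat n B"
  shows "(\<Sum>i<n. \<Sum>k<n. (cmod (B $$ (i,k)))\<^sup>2) = Re (tr (B * B))"
proof -
  note B = hermitian_matD[OF assms]
  have "tr (B * B) = (\<Sum>i<n. \<Sum>k<n. B $$ (i,k) * B $$ (k,i))"
    unfolding tr_def using B(1) by (auto intro!: sum.cong simp: index_mult_sum simp del: index_mult_mat(1))
  also have "\<dots> = (\<Sum>i<n. \<Sum>k<n. complex_of_real ((cmod (B $$ (i,k)))\<^sup>2))"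
    by (intro sum.cong refl) (simp only: complex_norm_square hermitian_mat_entry[OF assms] lessThan_iff)
  finally show ?thesis by (simp add: Re_sum)
qed

text \<open>The truncation to a conjugation-invariant event replaces any moment assumption on the matrix.\<close>
definition qf_dev :: "nat \<Rightarrow> nat \<Rightarrow> real \<Rightarrow> complex vec \<Rightarrow> complex mat \<Rightarrow> real" where
  "qf_dev n m K v A = (if Re (tr (A ^\<^sub>m m * A ^\<^sub>m m)) \<le> K * real n
     then (Re (cinner (A ^\<^sub>m m *\<^sub>v v) v) - Re (tr (A ^\<^sub>m m)) / real n) ^ 4 else 0)"

lemma qf_dev_nonneg: "qf_dev n m K v A \<ge> 0"
  by (simp add: qf_dev_def)

text \<open>Both the truncation event and the centring are traces, hence invariant under
  conjugation, so the rotation can be moved onto the vector.\<close>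

lemma qf_dev_unitary_conj:
  assumes U: "unitary_mat n U" and A: "A \<in> carrier_mat n n" and v: "v \<in> carrier_vec n"
  shows "qf_dev n m K v (U * A * cadj U) = qf_dev n m K (cadj U *\<^sub>v v) A"
proof -
  note Uc = unitary_matD[OF U]
  have p: "A ^\<^sub>m m \<in> carrier_mat n n" using A by simp
  have "cinner ((U * A ^\<^sub>m m * cadj U) *\<^sub>v v) v = cinner (U *\<^sub>v (A ^\<^sub>m m *\<^sub>v (cadj U *\<^sub>v v))) v"
    using Uc(1) p v by (simp add: assoc_mult_mat_vec[of _ n n _ n] mult_carrier_mat[of _ n n _ n])
  also have "\<dots> = cinner (A ^\<^sub>m m *\<^sub>v (cadj U *\<^sub>v v)) (cadj U *\<^sub>v v)"
    using Uc(1) p v by (intro cinner_mult_left) (auto intro!: mult_mat_vec_carrier[of _ n n])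
  finally show ?thesis
    using p unfolding qf_dev_def unitary_conj_pow[OF U A]
    by (simp add: unitary_conj_mult[OF U p p] tr_unitary_conj[OF U] mult_carrier_mat[of _ n n _ n])
qed

text \<open>This absorbs the phase c that \<open>householder\<close> leaves behind.\<close>

lemma qf_dev_phase:
  assumes "cmod c = 1" "v \<in> carrier_vec n" "A \<in> carrier_mat n n"
  shows "qf_dev n m K (c \<cdot>\<^sub>v v) A = qf_dev n m K v A"
proof -
  have cc: "c * cnj c = 1" using assms(1) by (simp add: complex_norm_square[symmetric])
  have "cinner (A ^\<^sub>m m *\<^sub>v (c \<cdot>\<^sub>v v)) (c \<cdot>\<^sub>v v) = (c * cnj c) * cinner (A ^\<^sub>m m *\<^sub>v v) v"
    using assms(2,3) by (simp add: mult_mat_vec[of _ n n] cinner_smult_left cinner_smult_right)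
  thus ?thesis by (simp add: qf_dev_def cc)
qed

text \<open>These vectors are real unit vectors, hence reachable from v in the orthogonal case too,
  and averaging over them is a finite sum.\<close>

definition sign_vec :: "nat \<Rightarrow> (nat \<Rightarrow> real) \<Rightarrow> complex vec" where
  "sign_vec n e = vec n (\<lambda>i. complex_of_real (e i / sqrt (real n)))"

lemma sign_vec_carrier [simp]: "sign_vec n e \<in> carrier_vec n"
  by (simp add: sign_vec_def)

lemma real_sign_vec: "real_vec (sign_vec n e)"
  by (simp add: real_vec_def sign_vec_def)

lemma vnorm_sign_vec:
  assumes "n \<ge> 1" "\<And>i. \<bar>e i\<bar> = 1"
  shows "vnorm (sign_vec n e) = 1"
proof -
  have "(\<Sum>i<n. (cmod (sign_vec n e $ i))\<^sup>2) = (\<Sum>i<n. 1 / real n)"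
    using assms by (intro sum.cong) (auto simp: sign_vec_def norm_divide power_divide)
  also have "\<dots> = 1" using assms by simp
  finally show ?thesis by (simp add: vnorm_def sign_vec_def)
qed

text \<open>The centred form is a chaos with coefficients b of order 1/n. On the truncation event
  the sum of their squares is at most K n / n^2 = K / n, and the fourth-moment bound squares
  this.\<close>

lemma rad_qf_dev_sign_vec:
  assumes A: "hermitian_mat n A" and n: "n \<ge> 1" and K: "K \<ge> 0"
  shows "rad n (\<lambda>e. qf_dev n m K (sign_vec n e) A) \<le> 324 * K\<^sup>2 / (real n)\<^sup>2"
proof (cases "Re (tr (A ^\<^sub>m m * A ^\<^sub>m m)) \<le> K * real n")
  case False
  thus ?thesis by (simp add: qf_dev_def)
next
  case True
  define B where "B = A ^\<^sub>m m"
  have Bh: "hermitian_mat n B" unfolding B_def by (rule hermitian_pow[OF A])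
  note B = hermitian_matD[OF Bh]
  \<comment> \<open>Real parts suffice: the imaginary part of a Hermitian matrix is antisymmetric
    and drops out of the form at a real vector.\<close>
  define b where "b = (\<lambda>i k. Re (B $$ (i,k)) / real n)"
  have sym: "b i k = b k i" if "i < n" "k < n" for i k
    using hermitian_mat_entry[OF Bh that] by (metis b_def cnj.simps(1))
  have qf: "Re (cinner (B *\<^sub>v sign_vec n e) (sign_vec n e)) = (\<Sum>i<n. \<Sum>k<n. b i k * (e i * e k))" for e
  proof -
    have "cinner (B *\<^sub>v sign_vec n e) (sign_vec n e)
        = (\<Sum>i<n. (\<Sum>k<n. B $$ (i,k) * complex_of_real (e k / sqrt n)) * complex_of_real (e i / sqrt n))"
    proof -
      have "(B *\<^sub>v sign_vec n e) $ i = (\<Sum>k<n. B $$ (i,k) * complex_of_real (e k / sqrt n))" if "i < n" for i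
      proof -
        have "(B *\<^sub>v sign_vec n e) $ i = (\<Sum>k<dim_vec (sign_vec n e). B $$ (i,k) * sign_vec n e $ k)"
          using that B(1) by (intro index_mult_vec_sum) (auto simp: sign_vec_def)
        thus ?thesis by (auto simp: sign_vec_def intro!: sum.cong)
      qed
      thus ?thesis unfolding cinner_def using B(1)
        by (intro sum.cong) (auto simp: sign_vec_def simp del: index_mult_mat_vec)
    qed
    also have "\<dots> = (\<Sum>i<n. \<Sum>k<n. B $$ (i,k) * complex_of_real (e i * e k / real n))"
    proof (intro sum.cong refl, unfold sum_distrib_right, intro sum.cong refl)
      fix i k
      have "e k / sqrt n * (e i / sqrt n) = e i * e k / (sqrt n * sqrt n)" by simp
      hence "e k / sqrt n * (e i / sqrt n) = e i * e k / real n" by simp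
      thus "B $$ (i,k) * complex_of_real (e k / sqrt n) * complex_of_real (e i / sqrt n) =
          B $$ (i,k) * complex_of_real (e i * e k / real n)"
        by (metis mult.assoc of_real_mult)
    qed
    finally show ?thesis by (simp add: Re_sum b_def)
  qed
  have tr: "Re (tr B) / real n = (\<Sum>i<n. b i i)"
    using B(1) by (simp add: tr_def b_def Re_sum sum_divide_distrib)
  have "rad n (\<lambda>e. qf_dev n m K (sign_vec n e) A)
      = rad n (\<lambda>e. ((\<Sum>i<n. \<Sum>k<n. b i k * (e i * e k)) - (\<Sum>i<n. b i i))^4)"
    using True by (simp add: qf_dev_def B_def[symmetric] qf tr)
  also have "\<dots> \<le> 324 * (\<Sum>i<n. \<Sum>k<n. (b i k)\<^sup>2)\<^sup>2"
    by (rule rad_quadratic_form_centered_power4) (rule sym)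
  also have "\<dots> \<le> 324 * (K / real n)\<^sup>2"
  proof (intro mult_left_mono power_mono)
    have "(\<Sum>i<n. \<Sum>k<n. (b i k)\<^sup>2) \<le> (\<Sum>i<n. \<Sum>k<n. (cmod (B $$ (i,k)))\<^sup>2 / (real n)\<^sup>2)"
      unfolding b_def power_divide
      by (intro sum_mono divide_right_mono) (auto simp: cmod_power2)
    also have "\<dots> = Re (tr (B * B)) / (real n)\<^sup>2"
      by (simp only: sum_divide_distrib[symmetric] sum_cmod_power2_hermitian[OF Bh])
    also have "\<dots> \<le> K * real n / (real n)\<^sup>2"
      using True by (intro divide_right_mono) (auto simp: B_def)
    finally show "(\<Sum>i<n. \<Sum>k<n. (b i k)\<^sup>2) \<le> K / real n"
      using n by (auto simp: power2_eq_square)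
  qed (auto intro!: sum_nonneg)
  finally show ?thesis by (simp add: power_divide)
qed

section \<open>Measurability as functions of the matrix entries\<close>

abbreviation entries_mat :: "nat \<Rightarrow> (nat \<times> nat \<Rightarrow> complex) \<Rightarrow> complex mat" where
  "entries_mat n e \<equiv> mat n n e"

lemma entries_mat_entries: "A \<in> carrier_mat n n \<Longrightarrow> entries_mat n (entries n A) = A"
  by (rule eq_matI) (auto simp: entries_def)

lemma measurable_entry:
  "i < n \<Longrightarrow> k < n \<Longrightarrow> (\<lambda>e. e (i,k)) \<in> borel_measurable (entries_space n)"
  unfolding entries_space_def by (intro measurable_component_singleton) auto

lemma measurable_entries:
  assumes "\<And>\<omega>. \<omega> \<in> space M \<Longrightarrow> Y \<omega> \<in> carrier_mat n n"
    "\<And>i k. i < n \<Longrightarrow> k < n \<Longrightarrow> (\<lambda>\<omega>. Y \<omega> $$ (i,k)) \<in> borel_measurable M"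
  shows "(\<lambda>\<omega>. entries n (Y \<omega>)) \<in> M \<rightarrow>\<^sub>M entries_space n"
  unfolding entries_space_def entries_def
  by (intro measurable_restrict) (use assms in auto)

lemma borel_measurable_mat_mult_entry:
  assumes "\<And>x. A x \<in> carrier_mat n n" "\<And>x. B x \<in> carrier_mat n n"
    "\<And>i k. i < n \<Longrightarrow> k < n \<Longrightarrow> (\<lambda>x. A x $$ (i,k)) \<in> borel_measurable M"
    "\<And>i k. i < n \<Longrightarrow> k < n \<Longrightarrow> (\<lambda>x. B x $$ (i,k)) \<in> borel_measurable M"
    "i < n" "k < n"
  shows "(\<lambda>x. (A x * B x) $$ (i,k) :: complex) \<in> borel_measurable M"
proof -
  have "(A x * B x) $$ (i,k) = (\<Sum>l<n. A x $$ (i,l) * B x $$ (l,k))" for x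
    using assms(1,2)[of x] assms(5,6) by (subst index_mult_sum) auto
  thus ?thesis using assms(3-6) by (simp only:) (auto intro!: borel_measurable_sum borel_measurable_times)
qed

lemma borel_measurable_mat_pow_entry:
  assumes "i < n" "k < n"
  shows "(\<lambda>e. (entries_mat n e ^\<^sub>m m) $$ (i,k)) \<in> borel_measurable (entries_space n)"
  using assms
proof (induct m arbitrary: i k)
  case (Suc m)
  show ?case unfolding pow_mat.simps
    by (rule borel_measurable_mat_mult_entry[of _ n]) (use Suc measurable_entry in auto)
qed simp

text \<open>The deviation is built from finite sums of products of entries and one comparison;
  eigenvalues and eigenvectors do not enter its definition.\<close>

lemma borel_measurable_qf_dev:
  assumes v: "v \<in> carrier_vec n"
  shows "(\<lambda>e. qf_dev n m K v (entries_mat n e)) \<in> borel_measurable (entries_space n)"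
proof -
  let ?B = "\<lambda>e. entries_mat n e ^\<^sub>m m"
  have c: "?B e \<in> carrier_mat n n" for e by simp
  have B: "i < n \<Longrightarrow> k < n \<Longrightarrow> (\<lambda>e. ?B e $$ (i,k)) \<in> borel_measurable (entries_space n)" for i k
    by (rule borel_measurable_mat_pow_entry)
  have B2: "i < n \<Longrightarrow> k < n \<Longrightarrow> (\<lambda>e. (?B e * ?B e) $$ (i,k)) \<in> borel_measurable (entries_space n)" for i k
    by (rule borel_measurable_mat_mult_entry[of _ n]) (auto intro: B c)
  have "cinner (?B e *\<^sub>v v) v = (\<Sum>i<n. (\<Sum>k<n. ?B e $$ (i,k) * v $ k) * cnj (v $ i))" for e
  proof -
    have "(?B e *\<^sub>v v) $ i = (\<Sum>k<n. ?B e $$ (i,k) * v $ k)" if "i < n" for i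
      using that v c[of e] by (subst index_mult_vec_sum) auto
    thus ?thesis unfolding cinner_def using c[of e]
      by (intro sum.cong) (auto simp del: index_mult_mat_vec)
  qed
  hence 1: "(\<lambda>e. cinner (?B e *\<^sub>v v) v) \<in> borel_measurable (entries_space n)"
    by (simp only:) (auto intro!: borel_measurable_sum borel_measurable_times B)
  have "tr (?B e) = (\<Sum>i<n. ?B e $$ (i,i))" for e using c[of e] by (simp add: tr_def)
  hence 2: "(\<lambda>e. tr (?B e)) \<in> borel_measurable (entries_space n)"
    by (simp only:) (auto intro!: borel_measurable_sum B)
  have "tr (?B e * ?B e) = (\<Sum>i<n. (?B e * ?B e) $$ (i,i))" for e
    using c[of e] by (simp add: tr_def del: index_mult_mat(1))
  hence 3: "(\<lambda>e. tr (?B e * ?B e)) \<in> borel_measurable (entries_space n)"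
    by (simp only:) (auto intro!: borel_measurable_sum B2 simp del: index_mult_mat(1))
  note [measurable] = 1 2 3
  show ?thesis unfolding qf_dev_def by measurable
qed

section \<open>Averaging with the invariance, and almost sure convergence\<close>

lemma nn_integral_qf_dev_conj:
  assumes X_herm: "\<And>\<omega>. \<omega> \<in> space M \<Longrightarrow> hermitian_mat n (X \<omega>)"
    and X_meas: "\<And>i k. i < n \<Longrightarrow> k < n \<Longrightarrow> (\<lambda>\<omega>. X \<omega> $$ (i,k)) \<in> borel_measurable M"
    and X_inv: "distr M (entries_space n) (\<lambda>\<omega>. entries n (U * X \<omega> * cadj U))
        = distr M (entries_space n) (\<lambda>\<omega>. entries n (X \<omega>))"
    and U: "unitary_mat n U" and v: "v \<in> carrier_vec n"
  shows "(\<integral>\<^sup>+\<omega>. ennreal (qf_dev n m K v (X \<omega>)) \<partial>M)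
       = (\<integral>\<^sup>+\<omega>. ennreal (qf_dev n m K (cadj U *\<^sub>v v) (X \<omega>)) \<partial>M)"
proof -
  note Uc = unitary_matD[OF U]
  have Xc: "X \<omega> \<in> carrier_mat n n" if "\<omega> \<in> space M" for \<omega> using X_herm[OF that] hermitian_matD by auto
  have UX: "U * X \<omega> * cadj U \<in> carrier_mat n n" if "\<omega> \<in> space M" for \<omega>
    using Xc[OF that] Uc(1) by (simp add: mult_carrier_mat[of _ n n _ n])
  have m1: "(\<lambda>\<omega>. entries n (X \<omega>)) \<in> M \<rightarrow>\<^sub>M entries_space n"
    by (rule measurable_entries[OF Xc X_meas])
  have m2: "(\<lambda>\<omega>. entries n (U * X \<omega> * cadj U)) \<in> M \<rightarrow>\<^sub>M entries_space n"
  proof (rule measurable_entries[OF UX])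
    fix i k assume ik: "i < n" "k < n"
    have e: "(U * X \<omega> * cadj U) $$ (i,k) = (\<Sum>l<n. (\<Sum>j<n. U $$ (i,j) * X \<omega> $$ (j,l)) * cadj U $$ (l,k))"
      if "\<omega> \<in> space M" for \<omega>
    proof -
      have "(U * X \<omega>) $$ (i,l) = (\<Sum>j<n. U $$ (i,j) * X \<omega> $$ (j,l))" if "l < n" for l
        using that ik Uc(1) Xc[OF \<open>\<omega> \<in> space M\<close>] by (subst index_mult_sum) auto
      thus ?thesis using ik Uc(1) Xc[OF that]
        by (subst index_mult_sum) (auto intro!: sum.cong simp del: index_mult_mat(1))
    qed
    show "(\<lambda>\<omega>. (U * X \<omega> * cadj U) $$ (i,k)) \<in> borel_measurable M"
      by (subst measurable_cong[OF e]) (auto intro!: borel_measurable_sum borel_measurable_times X_meas)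
  qed
  let ?f = "\<lambda>e. ennreal (qf_dev n m K v (entries_mat n e))"
  have f: "?f \<in> borel_measurable (entries_space n)"
    using borel_measurable_qf_dev[OF v] by simp
  \<comment> \<open>Invariance is an equality of laws on \<open>entries_space\<close>, so the
    statistic is pulled back to the entries, transported there, and read again as a function of the
    conjugated matrix.\<close>
  have "(\<integral>\<^sup>+\<omega>. ennreal (qf_dev n m K v (X \<omega>)) \<partial>M) = (\<integral>\<^sup>+\<omega>. ?f (entries n (X \<omega>)) \<partial>M)"
    by (intro nn_integral_cong) (simp add: entries_mat_entries[OF Xc])
  also have "\<dots> = (\<integral>\<^sup>+e. ?f e \<partial>distr M (entries_space n) (\<lambda>\<omega>. entries n (X \<omega>)))"
    by (rule nn_integral_distr[OF m1, symmetric]) (use f in simp)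
  also have "\<dots> = (\<integral>\<^sup>+\<omega>. ?f (entries n (U * X \<omega> * cadj U)) \<partial>M)"
    unfolding X_inv[symmetric] by (rule nn_integral_distr[OF m2]) (use f in simp)
  also have "\<dots> = (\<integral>\<^sup>+\<omega>. ennreal (qf_dev n m K (cadj U *\<^sub>v v) (X \<omega>)) \<partial>M)"
    by (intro nn_integral_cong)
       (simp add: entries_mat_entries[OF UX] qf_dev_unitary_conj[OF U Xc v])
  finally show ?thesis .
qed

lemma borel_measurable_qf_dev_random:
  assumes X_herm: "\<And>\<omega>. \<omega> \<in> space M \<Longrightarrow> hermitian_mat n (X \<omega>)"
    and X_meas: "\<And>i k. i < n \<Longrightarrow> k < n \<Longrightarrow> (\<lambda>\<omega>. X \<omega> $$ (i,k)) \<in> borel_measurable M"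
    and v: "v \<in> carrier_vec n"
  shows "(\<lambda>\<omega>. qf_dev n m K v (X \<omega>)) \<in> borel_measurable M"
proof -
  have Xc: "X \<omega> \<in> carrier_mat n n" if "\<omega> \<in> space M" for \<omega> using X_herm[OF that] hermitian_matD by auto
  have "(\<lambda>\<omega>. qf_dev n m K v (entries_mat n (entries n (X \<omega>)))) \<in> borel_measurable M"
    by (rule measurable_compose[OF measurable_entries[OF Xc X_meas] borel_measurable_qf_dev[OF v]])
  thus ?thesis by (subst measurable_cong) (auto simp: entries_mat_entries[OF Xc])
qed

text \<open>By invariance \<open>v\<close> may be replaced by any normalised sign vector, and averaging over all of
  these turns the quadratic form into a Rademacher chaos of order two.\<close>
lemma nn_integral_qf_dev_le:
  assumes M: "prob_space M"
    and X_herm: "\<And>\<omega>. \<omega> \<in> space M \<Longrightarrow> hermitian_mat n (X \<omega>)"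
    and X_meas: "\<And>i k. i < n \<Longrightarrow> k < n \<Longrightarrow> (\<lambda>\<omega>. X \<omega> $$ (i,k)) \<in> borel_measurable M"
    and X_inv: "\<And>U. U \<in> invariance_group real_case n \<Longrightarrow>
          distr M (entries_space n) (\<lambda>\<omega>. entries n (U * X \<omega> * cadj U))
        = distr M (entries_space n) (\<lambda>\<omega>. entries n (X \<omega>))"
    and v: "v \<in> carrier_vec n" "vnorm v = 1" "real_case \<Longrightarrow> real_vec v"
    and n: "n \<ge> 1" and K: "K \<ge> 0"
  shows "(\<integral>\<^sup>+\<omega>. ennreal (qf_dev n m K v (X \<omega>)) \<partial>M) \<le> ennreal (324 * K\<^sup>2 / (real n)\<^sup>2)"
proof -
  interpret prob_space M by (rule M)
  let ?s = "\<lambda>S i. if i \<in> S then -1 else (1::real)"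
  let ?I = "\<integral>\<^sup>+\<omega>. ennreal (qf_dev n m K v (X \<omega>)) \<partial>M"
  have Xc: "X \<omega> \<in> carrier_mat n n" if "\<omega> \<in> space M" for \<omega> using X_herm[OF that] hermitian_matD by auto
  have eq: "?I = (\<integral>\<^sup>+\<omega>. ennreal (qf_dev n m K (sign_vec n (?s S)) (X \<omega>)) \<partial>M)" for S
  proof -
    have nw: "vnorm (sign_vec n (?s S)) = 1" by (rule vnorm_sign_vec[OF n]) auto
    obtain U c where U: "unitary_mat n U" "cadj U = U" "cmod c = 1" "U *\<^sub>v v = c \<cdot>\<^sub>v sign_vec n (?s S)"
        "real_vec v \<and> real_vec (sign_vec n (?s S)) \<longrightarrow> real_mat U"
      using householder[OF v(1) sign_vec_carrier v(2) nw] by blast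
    have "U \<in> invariance_group real_case n"
      using U v(3) real_sign_vec by (auto simp: invariance_group_def)
    from nn_integral_qf_dev_conj[OF X_herm X_meas X_inv[OF this] U(1) v(1), of m K]
    have "?I = (\<integral>\<^sup>+\<omega>. ennreal (qf_dev n m K (c \<cdot>\<^sub>v sign_vec n (?s S)) (X \<omega>)) \<partial>M)"
      by (simp only: U(2,4))
    also have "\<dots> = (\<integral>\<^sup>+\<omega>. ennreal (qf_dev n m K (sign_vec n (?s S)) (X \<omega>)) \<partial>M)"
      by (intro nn_integral_cong) (simp add: qf_dev_phase[OF U(3) sign_vec_carrier Xc])
    finally show ?thesis .
  qed
  \<comment> \<open>The integral is the same for all 2^n sign vectors, so 2^n copies of it are the
    integral of the sum; the factor is cancelled at the end.\<close>
  have "(2::ennreal) ^ n * ?I = (\<Sum>S\<in>Pow {..<n}. ?I)" by (simp add: card_Pow)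
  also have "\<dots> = (\<Sum>S\<in>Pow {..<n}. \<integral>\<^sup>+\<omega>. ennreal (qf_dev n m K (sign_vec n (?s S)) (X \<omega>)) \<partial>M)"
    by (intro sum.cong refl) (rule eq)
  also have "\<dots> = (\<integral>\<^sup>+\<omega>. (\<Sum>S\<in>Pow {..<n}. ennreal (qf_dev n m K (sign_vec n (?s S)) (X \<omega>))) \<partial>M)"
    using borel_measurable_qf_dev_random[OF X_herm X_meas sign_vec_carrier]
    by (subst nn_integral_sum) auto
  also have "\<dots> \<le> (\<integral>\<^sup>+\<omega>. ennreal (2 ^ n * (324 * K\<^sup>2 / (real n)\<^sup>2)) \<partial>M)"
  proof (rule nn_integral_mono)
    fix \<omega> assume w: "\<omega> \<in> space M"
    have "(\<Sum>S\<in>Pow {..<n}. qf_dev n m K (sign_vec n (?s S)) (X \<omega>)) =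
        2 ^ n * rad n (\<lambda>e. qf_dev n m K (sign_vec n e) (X \<omega>))" by (simp add: rad_def)
    also have "\<dots> \<le> 2 ^ n * (324 * K\<^sup>2 / (real n)\<^sup>2)"
      using rad_qf_dev_sign_vec[OF X_herm[OF w] n K] by (intro mult_left_mono) auto
    finally show "(\<Sum>S\<in>Pow {..<n}. ennreal (qf_dev n m K (sign_vec n (?s S)) (X \<omega>)))
        \<le> ennreal (2 ^ n * (324 * K\<^sup>2 / (real n)\<^sup>2))"
      by (subst sum_ennreal) (auto simp: qf_dev_nonneg intro!: ennreal_leI)
  qed
  also have "\<dots> = ennreal (2 ^ n * (324 * K\<^sup>2 / (real n)\<^sup>2))" by (simp add: emeasure_space_1)
  also have "\<dots> = 2 ^ n * ennreal (324 * K\<^sup>2 / (real n)\<^sup>2)"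
    by (subst ennreal_mult) (auto simp: ennreal_power[symmetric])
  finally show ?thesis
    by (subst (asm) ennreal_mult_le_mult_iff) (auto simp: power_eq_top_ennreal)
qed

text \<open>The truncated fourth powers have expectations bounded by a multiple of 1/n^2, so their
  sum has finite expectation and is almost surely finite; hence its terms tend to 0. By the bound on
  the even power sums the truncation is eventually inactive.\<close>

lemma AE_quadratic_form_pow:
  fixes X :: "nat \<Rightarrow> 'w \<Rightarrow> complex mat"
  assumes M: "prob_space M"
    and X_herm: "\<And>n \<omega>. \<omega> \<in> space M \<Longrightarrow> hermitian_mat n (X n \<omega>)"
    and X_meas: "\<And>n i k. i < n \<Longrightarrow> k < n \<Longrightarrow> (\<lambda>\<omega>. X n \<omega> $$ (i,k)) \<in> borel_measurable M"
    and X_inv: "\<And>n U. U \<in> invariance_group real_case n \<Longrightarrow>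
          distr M (entries_space n) (\<lambda>\<omega>. entries n (U * X n \<omega> * cadj U))
        = distr M (entries_space n) (\<lambda>\<omega>. entries n (X n \<omega>))"
    and v: "\<And>n. n \<ge> 1 \<Longrightarrow> v n \<in> carrier_vec n" "\<And>n. n \<ge> 1 \<Longrightarrow> vnorm (v n) = 1"
      "\<And>n. n \<ge> 1 \<Longrightarrow> real_case \<Longrightarrow> real_vec (v n)"
    and K: "K \<ge> 0" "AE \<omega> in M. \<forall>\<^sub>F n in sequentially. (\<Sum>i<n. eig (Suc i) (X n \<omega>) ^ (2 * m)) \<le> K * real n"
  shows "AE \<omega> in M. (\<lambda>n. Re (cinner (X n \<omega> ^\<^sub>m m *\<^sub>v v n) (v n)) - (\<Sum>i<n. eig (Suc i) (X n \<omega>) ^ m) / real n) \<longlonglongrightarrow> 0"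
proof -
  \<comment> \<open>Shifted by one, because the moment bound requires dimension at least 1.\<close>
  let ?q = "\<lambda>n \<omega>. qf_dev (Suc n) m K (v (Suc n)) (X (Suc n) \<omega>)"
  have meas: "(\<lambda>\<omega>. ennreal (?q n \<omega>)) \<in> borel_measurable M" for n
    using borel_measurable_qf_dev_random[OF X_herm X_meas v(1)[of "Suc n"]] by simp
  have "(\<integral>\<^sup>+\<omega>. (\<Sum>n. ennreal (?q n \<omega>)) \<partial>M) = (\<Sum>n. \<integral>\<^sup>+\<omega>. ennreal (?q n \<omega>) \<partial>M)"
    by (rule nn_integral_suminf) (rule meas)
  also have "\<dots> \<le> (\<Sum>n. ennreal (324 * K\<^sup>2 / (real (Suc n))\<^sup>2))"
    by (intro suminf_le nn_integral_qf_dev_le[OF M X_herm X_meas X_inv v(1,2,3) _ K(1)]) auto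
  also have "\<dots> = ennreal (\<Sum>n. 324 * K\<^sup>2 / (real (Suc n))\<^sup>2)"
  proof (rule suminf_ennreal2)
    have "summable (\<lambda>n. inverse ((real (Suc n))\<^sup>2))"
      using inverse_power_summable[of 2, where 'a = real] by (subst summable_Suc_iff) auto
    from summable_mult[OF this, of "324 * K\<^sup>2"]
    show "summable (\<lambda>n. 324 * K\<^sup>2 / (real (Suc n))\<^sup>2)" by (simp add: divide_inverse)
  qed auto
  finally have fin: "(\<integral>\<^sup>+\<omega>. (\<Sum>n. ennreal (?q n \<omega>)) \<partial>M) \<noteq> \<infinity>" by (auto simp: top_unique)
  have "AE \<omega> in M. (\<Sum>n. ennreal (?q n \<omega>)) \<noteq> \<infinity>"
    by (rule nn_integral_PInf_AE[OF _ fin]) (use meas in measurable)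
  with K(2) AE_space show ?thesis
  proof (eventually_elim, goal_cases)
    case (1 \<omega>)
    define D where "D = (\<lambda>n. Re (cinner (X n \<omega> ^\<^sub>m m *\<^sub>v v n) (v n)) - (\<Sum>i<n. eig (Suc i) (X n \<omega>) ^ m) / real n)"
    have q: "qf_dev n m K (v n) (X n \<omega>) = (if (\<Sum>i<n. eig (Suc i) (X n \<omega>) ^ (2 * m)) \<le> K * real n then D n ^ 4 else 0)" for n
      unfolding qf_dev_def D_def tr_pow[OF X_herm[OF 1(2)]] tr_pow_power2[OF X_herm[OF 1(2)]] Re_complex_of_real ..
    have "summable (\<lambda>n. ?q n \<omega>)"
      by (rule summable_suminf_not_top) (use 1(3) qf_dev_nonneg in auto)
    hence "(\<lambda>n. ?q n \<omega>) \<longlonglongrightarrow> 0" by (rule summable_LIMSEQ_zero)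
    hence "(\<lambda>n. qf_dev n m K (v n) (X n \<omega>)) \<longlonglongrightarrow> 0" by (subst (asm) filterlim_sequentially_Suc)
    moreover have "\<forall>\<^sub>F n in sequentially. qf_dev n m K (v n) (X n \<omega>) = D n ^ 4"
      using 1(1) by eventually_elim (simp add: q)
    ultimately have "(\<lambda>n. D n ^ 4) \<longlonglongrightarrow> 0" by (rule Lim_transform_eventually)
    \<comment> \<open>Two square roots lead back from the fourth power to the absolute
      value.\<close>
    hence "(\<lambda>n. sqrt (sqrt (D n ^ 4))) \<longlonglongrightarrow> sqrt (sqrt 0)" by (intro tendsto_real_sqrt)
    moreover have "sqrt (sqrt (D n ^ 4)) = \<bar>D n\<bar>" for n
    proof -
      have "D n ^ 4 = ((D n)\<^sup>2)\<^sup>2" by simp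
      thus ?thesis by (simp only: real_sqrt_abs abs_power2)
    qed
    ultimately have "(\<lambda>n. \<bar>D n\<bar>) \<longlonglongrightarrow> 0" by simp
    thus ?case unfolding D_def by (subst (asm) tendsto_rabs_zero_iff)
  qed
qed

section \<open>Weak convergence of weighted spectral measures\<close>

text \<open>The difference is linear in f, so the moments settle all polynomials. Both averages have
  total mass 1 on [-R, R], so replacing f by a polynomial within e/4 costs e/4 in each of them; with
  e/4 for the polynomial itself the total stays below e.\<close>

lemma weighted_average_minus_average_tendsto_0:
  fixes l w :: "nat \<Rightarrow> nat \<Rightarrow> real" and f :: "real \<Rightarrow> real"
  assumes w0: "\<And>n i. w n i \<ge> 0" and w1: "\<forall>\<^sub>F n in sequentially. (\<Sum>i<n. w n i) = 1"
    and mom: "\<And>m. (\<lambda>n. (\<Sum>i<n. w n i * l n i ^ m) - (\<Sum>i<n. l n i ^ m) / real n) \<longlonglongrightarrow> 0"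
    and bd: "\<forall>\<^sub>F n in sequentially. \<forall>i<n. \<bar>l n i\<bar> \<le> R"
    and f: "continuous_on UNIV f"
  shows "(\<lambda>n. (\<Sum>i<n. w n i * f (l n i)) - (\<Sum>i<n. f (l n i)) / real n) \<longlonglongrightarrow> 0"
proof (rule tendstoI)
  fix e :: real assume e: "e > 0"
  obtain q where q: "real_polynomial_function q" "\<And>x. x \<in> {-R..R} \<Longrightarrow> \<bar>f x - q x\<bar> < e / 4"
    using Stone_Weierstrass_real_polynomial_function[of "{-R..R}" f "e / 4"] e f
      continuous_on_subset[OF f] by auto
  obtain a d where ad: "q = (\<lambda>x. \<Sum>m\<le>d. a m * x ^ m)"
    using q(1) unfolding real_polynomial_function_iff_sum by blast
  let ?D = "\<lambda>g n. (\<Sum>i<n. w n i * g (l n i)) - (\<Sum>i<n. g (l n i)) / real n"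
  have "(\<lambda>n. \<Sum>m\<le>d. a m * ?D (\<lambda>x. x ^ m) n) \<longlonglongrightarrow> (\<Sum>m\<le>d. a m * 0)"
    by (intro tendsto_sum tendsto_mult tendsto_const mom)
  moreover have "(\<Sum>m\<le>d. a m * ?D (\<lambda>x. x ^ m) n) = ?D q n" for n
  proof -
    have "(\<Sum>i<n. w n i * q (l n i)) = (\<Sum>m\<le>d. a m * (\<Sum>i<n. w n i * l n i ^ m))"
      unfolding ad sum_distrib_left by (subst sum.swap) (intro sum.cong refl, simp only: mult_ac)
    moreover have "(\<Sum>i<n. q (l n i)) = (\<Sum>m\<le>d. a m * (\<Sum>i<n. l n i ^ m))"
      unfolding ad sum_distrib_left by (rule sum.swap)
    hence "(\<Sum>i<n. q (l n i)) / real n = (\<Sum>m\<le>d. a m * ((\<Sum>i<n. l n i ^ m) / real n))"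
      by (simp only: sum_divide_distrib[of _ "{..d}"] times_divide_eq_right)
    ultimately show ?thesis
      by (simp only: right_diff_distrib sum_subtractf)
  qed
  ultimately have "?D q \<longlonglongrightarrow> 0" by simp
  hence "\<forall>\<^sub>F n in sequentially. \<bar>?D q n\<bar> < e / 4"
    using e by (auto dest: tendstoD[of _ _ _ "e / 4"] simp: dist_real_def)
  thus "\<forall>\<^sub>F n in sequentially. dist (?D f n) 0 < e"
    using w1 bd eventually_ge_at_top[of 1]
  proof eventually_elim
    case (elim n)
    have le: "\<bar>f (l n i) - q (l n i)\<bar> \<le> e / 4" if "i < n" for i
      using q(2)[of "l n i"] elim(3) that by force
    have "\<bar>(\<Sum>i<n. w n i * f (l n i)) - (\<Sum>i<n. w n i * q (l n i))\<bar>
        \<le> (\<Sum>i<n. \<bar>w n i * (f (l n i) - q (l n i))\<bar>)"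
      by (simp only: sum_subtractf[symmetric] right_diff_distrib[symmetric]) (rule sum_abs)
    also have "\<dots> \<le> (\<Sum>i<n. w n i * (e / 4))"
      unfolding abs_mult using w0 le by (intro sum_mono mult_mono) auto
    also have "\<dots> = e / 4" using elim(2) by (simp only: sum_distrib_right[symmetric] mult_1)
    finally have 1: "\<bar>(\<Sum>i<n. w n i * f (l n i)) - (\<Sum>i<n. w n i * q (l n i))\<bar> \<le> e / 4" .
    have "\<bar>(\<Sum>i<n. f (l n i)) - (\<Sum>i<n. q (l n i))\<bar> \<le> (\<Sum>i<n. \<bar>f (l n i) - q (l n i)\<bar>)"
      by (simp only: sum_subtractf[symmetric]) (rule sum_abs)
    also have "\<dots> \<le> (\<Sum>i<n. e / 4)" using le by (intro sum_mono) auto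
    finally have "\<bar>(\<Sum>i<n. f (l n i)) - (\<Sum>i<n. q (l n i))\<bar> / real n \<le> e / 4"
      using elim(4) by (simp add: field_simps)
    hence 2: "\<bar>(\<Sum>i<n. f (l n i)) / real n - (\<Sum>i<n. q (l n i)) / real n\<bar> \<le> e / 4"
      by (simp add: diff_divide_distrib[symmetric] abs_divide)
    show ?case using 1 2 elim(1) e unfolding dist_real_def by linarith
  qed
qed

text \<open>Weak convergence handles the fixed shift \<rho>; uniform continuity of \<phi> on a
  compact interval replaces it by the moving shift. The number of terms is \<open>N n\<close> so
  that the lemma can be applied along a subsequence.\<close>

lemma weighted_average_shift_tendsto:
  fixes l w :: "nat \<Rightarrow> nat \<Rightarrow> real" and \<phi> :: "real \<Rightarrow> real"
  assumes w0: "\<And>n i. w n i \<ge> 0" and w1: "\<forall>\<^sub>F n in sequentially. (\<Sum>i<N n. w n i) = 1"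
    and weak: "\<And>f :: real \<Rightarrow> real. continuous_on UNIV f \<Longrightarrow> bounded (range f) \<Longrightarrow>
        (\<lambda>n. \<Sum>i<N n. w n i * f (l n i)) \<longlonglongrightarrow> (\<integral>t. f t \<partial>\<mu>)"
    and bd: "\<forall>\<^sub>F n in sequentially. \<forall>i<N n. \<bar>l n i\<bar> \<le> R"
    and y: "y \<longlonglongrightarrow> \<rho>"
    and \<phi>: "continuous_on UNIV \<phi>" "bounded (range \<phi>)"
  shows "(\<lambda>n. \<Sum>i<N n. w n i * \<phi> (y n - l n i)) \<longlonglongrightarrow> (\<integral>t. \<phi> (\<rho> - t) \<partial>\<mu>)"
proof -
  have 1: "(\<lambda>n. \<Sum>i<N n. w n i * \<phi> (\<rho> - l n i)) \<longlonglongrightarrow> (\<integral>t. \<phi> (\<rho> - t) \<partial>\<mu>)"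
  proof (rule weak)
    show "continuous_on UNIV (\<lambda>t. \<phi> (\<rho> - t))"
      by (intro continuous_on_compose2[OF \<phi>(1)] continuous_intros) auto
    show "bounded (range (\<lambda>t. \<phi> (\<rho> - t)))"
      by (rule bounded_subset[OF \<phi>(2)]) auto
  qed
  have "(\<lambda>n. (\<Sum>i<N n. w n i * \<phi> (y n - l n i)) - (\<Sum>i<N n. w n i * \<phi> (\<rho> - l n i))) \<longlonglongrightarrow> 0"
  proof (rule tendstoI)
    fix e :: real assume e: "e > 0"
    \<comment> \<open>The last summand 1 leaves room for y n, which is eventually within 1 of
      \<rho>.\<close>
    define K where "K = \<bar>R\<bar> + \<bar>\<rho>\<bar> + 1"
    have "uniformly_continuous_on {-K..K} \<phi>"
      by (rule compact_uniformly_continuous) (use continuous_on_subset[OF \<phi>(1)] in auto)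
    then obtain d where d: "d > 0"
      "\<And>x x'. x \<in> {-K..K} \<Longrightarrow> x' \<in> {-K..K} \<Longrightarrow> dist x' x < d \<Longrightarrow> dist (\<phi> x') (\<phi> x) < e / 2"
      unfolding uniformly_continuous_on_def using e by (metis half_gt_zero)
    have "\<forall>\<^sub>F n in sequentially. dist (y n) \<rho> < min d 1"
      using y d(1) by (intro tendstoD) auto
    thus "\<forall>\<^sub>F n in sequentially. dist ((\<Sum>i<N n. w n i * \<phi> (y n - l n i)) - (\<Sum>i<N n. w n i * \<phi> (\<rho> - l n i))) 0 < e"
      using w1 bd
    proof eventually_elim
      case (elim n)
      have le: "\<bar>\<phi> (y n - l n i) - \<phi> (\<rho> - l n i)\<bar> \<le> e / 2" if "i < N n" for i
      proof -
        have "\<bar>l n i\<bar> \<le> R" using elim(3) that by blast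
        hence "y n - l n i \<in> {-K..K}" "\<rho> - l n i \<in> {-K..K}"
          using elim(1) unfolding K_def dist_real_def by auto
        from d(2)[OF this(2,1)] show ?thesis using elim(1) by (simp add: dist_real_def)
      qed
      have "\<bar>(\<Sum>i<N n. w n i * \<phi> (y n - l n i)) - (\<Sum>i<N n. w n i * \<phi> (\<rho> - l n i))\<bar>
          \<le> (\<Sum>i<N n. \<bar>w n i * (\<phi> (y n - l n i) - \<phi> (\<rho> - l n i))\<bar>)"
        by (simp only: sum_subtractf[symmetric] right_diff_distrib[symmetric]) (rule sum_abs)
      also have "\<dots> \<le> (\<Sum>i<N n. w n i * (e / 2))"
        unfolding abs_mult using w0 le by (intro sum_mono mult_mono) auto
      also have "\<dots> = e / 2" using elim(2) by (simp only: sum_distrib_right[symmetric] mult_1)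
      finally show ?case using e by simp
    qed
  qed
  from tendsto_add[OF this 1] show ?thesis by simp
qed

section \<open>The Cauchy transform in a gap of the support\<close>

text \<open>Only the absence of mass between B and A is demanded, so A need not be an edge of the
  support. If there is no mass beyond B, any point to the right of B can serve as A.\<close>

locale support_gap = prob_space \<mu> for \<mu> :: "real measure" +
  fixes B A :: real
  assumes sets_borel: "sets \<mu> = sets borel" and BA: "B < A"
    and gap: "AE t in \<mu>. t \<le> B \<or> A \<le> t"
begin

lemma measurable_borel: "f \<in> borel_measurable borel \<Longrightarrow> f \<in> borel_measurable \<mu>"
  by (subst measurable_cong_sets[OF sets_borel refl])

lemma integrable_if_bounded_on_support:
  assumes "f \<in> borel_measurable borel" "\<And>t. t \<le> B \<or> A \<le> t \<Longrightarrow> \<bar>f t\<bar> \<le> C"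
  shows "integrable \<mu> (f :: real \<Rightarrow> real)"
  by (rule integrable_const_bound[of _ C])
     (use gap assms in \<open>auto elim!: eventually_mono intro: measurable_borel\<close>)

lemma gap_dist:
  assumes "B + d \<le> z" "z \<le> A - d" "t \<le> B \<or> A \<le> t"
  shows "d \<le> \<bar>z - t\<bar>"
  using assms by auto

lemma integrable_cauchy_kernel:
  assumes "B < z" "z < A"
  shows "integrable \<mu> (\<lambda>t. 1 / (z - t))"
proof -
  define d where "d = min (z - B) (A - z)"
  have d: "d > 0" "B + d \<le> z" "z \<le> A - d" using assms by (auto simp: d_def)
  show ?thesis
  proof (rule integrable_if_bounded_on_support[of _ "1 / d"])
    fix t assume "t \<le> B \<or> A \<le> t"
    from gap_dist[OF d(2,3) this] show "\<bar>1 / (z - t)\<bar> \<le> 1 / d"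
      using d(1) by (auto simp: abs_divide intro!: divide_left_mono mult_pos_pos)
  qed simp
qed

lemma integrable_cauchy_kernel2:
  assumes "B < z" "z < A" "B < z'" "z' < A"
  shows "integrable \<mu> (\<lambda>t. 1 / ((z' - t) * (z - t)))"
proof -
  define d where "d = min (min (z - B) (A - z)) (min (z' - B) (A - z'))"
  have d: "d > 0" "B + d \<le> z" "z \<le> A - d" "B + d \<le> z'" "z' \<le> A - d" using assms by (auto simp: d_def)
  show ?thesis
  proof (rule integrable_if_bounded_on_support[of _ "1 / (d * d)"])
    fix t assume t: "t \<le> B \<or> A \<le> t"
    note g = gap_dist[OF d(2,3) t] gap_dist[OF d(4,5) t]
    have "d * d \<le> \<bar>z' - t\<bar> * \<bar>z - t\<bar>"
      using g d(1) by (intro mult_mono) auto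
    thus "\<bar>1 / ((z' - t) * (z - t))\<bar> \<le> 1 / (d * d)"
      unfolding abs_divide abs_mult abs_one by (intro divide_left_mono mult_pos_pos) (use g d(1) in linarith)+
  qed simp
qed

text \<open>The resolvent identity integrated against \<mu>. Monotonicity and the derivative are
  both read off from it.\<close>

lemma cauchy_transform_diff:
  assumes "B < z" "z < A" "B < z'" "z' < A"
  shows "cauchy_transform \<mu> z' - cauchy_transform \<mu> z = - (z' - z) * (\<integral>t. 1 / ((z' - t) * (z - t)) \<partial>\<mu>)"
proof -
  have "cauchy_transform \<mu> z' - cauchy_transform \<mu> z = (\<integral>t. 1 / (z' - t) - 1 / (z - t) \<partial>\<mu>)"
    unfolding cauchy_transform_def
    by (rule Bochner_Integration.integral_diff[symmetric]) (use integrable_cauchy_kernel assms in auto)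
  also have "\<dots> = (\<integral>t. - (z' - z) * (1 / ((z' - t) * (z - t))) \<partial>\<mu>)"
  proof (rule integral_cong_AE)
    show "AE t in \<mu>. 1 / (z' - t) - 1 / (z - t) = - (z' - z) * (1 / ((z' - t) * (z - t)))"
      using gap by eventually_elim (use assms in \<open>auto simp: divide_simps\<close>)
  qed (auto intro!: measurable_borel)
  finally show ?thesis by (simp only: integral_mult_right_zero)
qed

text \<open>Each t of the support lies on the same side of z and z', so the product kernel is
  strictly positive almost everywhere.\<close>

lemma cauchy_transform_strict_antimono:
  assumes "B < z" "z < z'" "z' < A"
  shows "cauchy_transform \<mu> z' < cauchy_transform \<mu> z"
proof -
  have "(\<integral>t. 0 \<partial>\<mu>) < (\<integral>t. 1 / ((z' - t) * (z - t)) \<partial>\<mu>)"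
  proof (rule integral_less_AE_space)
    show "AE t in \<mu>. 0 < 1 / ((z' - t) * (z - t))"
      using gap by eventually_elim (use assms in \<open>auto simp: zero_less_mult_iff\<close>)
    show "emeasure \<mu> (space \<mu>) \<noteq> 0" by (simp add: emeasure_space_1)
    show "integrable \<mu> (\<lambda>t. 1 / ((z' - t) * (z - t)))"
      by (rule integrable_cauchy_kernel2) (use assms in auto)
  qed simp
  hence "- (z' - z) * (\<integral>t. 1 / ((z' - t) * (z - t)) \<partial>\<mu>) < 0"
    using assms by (intro mult_neg_pos) auto
  thus ?thesis using cauchy_transform_diff[of z z'] assms by simp
qed

lemma deriv_cauchy_transform:
  assumes z: "B < z" "z < A"
  shows "deriv (cauchy_transform \<mu>) z = - (\<integral>t. 1 / (z - t)\<^sup>2 \<partial>\<mu>)"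
proof (rule DERIV_imp_deriv)
  let ?Q = "\<integral>t. 1 / (z - t)\<^sup>2 \<partial>\<mu>"
  \<comment> \<open>Half the distance to the edges: for |h| < d both z and z + h stay at distance d
    from the support, so the error kernel h / ((z - t)^2 (z + h - t)) is at most |h| / d^3.\<close>
  define d where "d = min (z - B) (A - z) / 2"
  have "d > 0" "2 * d \<le> z - B" "2 * d \<le> A - z" using z by (auto simp: d_def)
  hence d: "d > 0" "B + d \<le> z" "z \<le> A - d" "B + 2 * d \<le> z" "z \<le> A - 2 * d" by auto
  have *: "norm ((cauchy_transform \<mu> (z + h) - cauchy_transform \<mu> z) / h - (- ?Q)) \<le> \<bar>h\<bar> / d ^ 3"
    if h: "h \<noteq> 0" "\<bar>h\<bar> < d" for h
  proof -
    have zh: "B < z + h" "z + h < A" "B + d \<le> z + h" "z + h \<le> A - d" using h d by auto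
    have i1: "integrable \<mu> (\<lambda>t. 1 / ((z + h - t) * (z - t)))"
      by (rule integrable_cauchy_kernel2) (use zh z in auto)
    have i2: "integrable \<mu> (\<lambda>t. 1 / (z - t)\<^sup>2)"
      using integrable_cauchy_kernel2[OF z z] by (simp add: power2_eq_square)
    have "(cauchy_transform \<mu> (z + h) - cauchy_transform \<mu> z) / h = - (\<integral>t. 1 / ((z + h - t) * (z - t)) \<partial>\<mu>)"
      using cauchy_transform_diff[OF z zh(1,2)] h by simp
    hence "(cauchy_transform \<mu> (z + h) - cauchy_transform \<mu> z) / h - (- ?Q)
        = (\<integral>t. 1 / (z - t)\<^sup>2 - 1 / ((z + h - t) * (z - t)) \<partial>\<mu>)"
      by (simp add: Bochner_Integration.integral_diff[OF i2 i1])
    also have "norm \<dots> \<le> (\<integral>t. norm (1 / (z - t)\<^sup>2 - 1 / ((z + h - t) * (z - t))) \<partial>\<mu>)"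
      by (rule integral_norm_bound)
    also have "\<dots> \<le> (\<integral>t. \<bar>h\<bar> / d ^ 3 \<partial>\<mu>)"
    proof (rule integral_mono_AE)
      show "AE t in \<mu>. norm (1 / (z - t)\<^sup>2 - 1 / ((z + h - t) * (z - t))) \<le> \<bar>h\<bar> / d ^ 3"
        using gap
      proof eventually_elim
        case (elim t)
        have dz: "d \<le> \<bar>z - t\<bar>" "d \<le> \<bar>z + h - t\<bar>"
          using gap_dist[OF d(2,3) elim] gap_dist[OF zh(3,4) elim] by auto
        hence nz: "z - t \<noteq> 0" "z + h - t \<noteq> 0" using d(1) by auto
        have "1 / (z - t)\<^sup>2 - 1 / ((z + h - t) * (z - t)) = h / ((z - t) * (z - t) * (z + h - t))"
          using nz by (simp add: divide_simps power2_eq_square)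
        hence "norm (1 / (z - t)\<^sup>2 - 1 / ((z + h - t) * (z - t))) = \<bar>h\<bar> / (\<bar>z - t\<bar> * \<bar>z - t\<bar> * \<bar>z + h - t\<bar>)"
          by (simp add: abs_mult abs_divide)
        also have "\<dots> \<le> \<bar>h\<bar> / (d * d * d)"
          using dz d(1) by (intro divide_left_mono mult_mono mult_pos_pos) auto
        finally show ?case by (simp add: power3_eq_cube)
      qed
    qed (use i1 i2 in auto)
    finally show ?thesis by (simp add: prob_space)
  qed
  have "(\<lambda>h. (cauchy_transform \<mu> (z + h) - cauchy_transform \<mu> z) / h - (- ?Q)) \<midarrow>0\<rightarrow> 0"
  proof (rule Lim_null_comparison)
    show "\<forall>\<^sub>F h in at 0. norm ((cauchy_transform \<mu> (z + h) - cauchy_transform \<mu> z) / h - (- ?Q)) \<le> \<bar>h\<bar> / d ^ 3"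
      unfolding eventually_at using d(1) * by (intro exI[of _ d]) (auto simp: dist_real_def)
    have "((\<lambda>h. \<bar>h\<bar> / d ^ 3) \<longlongrightarrow> \<bar>0\<bar> / d ^ 3) (at 0)"
      by (intro tendsto_intros) (use d(1) in auto)
    thus "((\<lambda>h. \<bar>h\<bar> / d ^ 3) \<longlongrightarrow> 0) (at 0)" by simp
  qed
  thus "(cauchy_transform \<mu> has_real_derivative - ?Q) (at z)"
    unfolding DERIV_def by (simp only: LIM_zero_iff)
qed

text \<open>This compares 1/(z - t)^2 with the regularised kernel at the edge, taking the squared
  distance from z to the edge as regularisation. For t beyond that edge the cross term in (z - t)^2
  has the favourable sign. For t across the gap, z is at least (A - B)/2 away, which costs at most
  4/(A - B)^2.\<close>

lemma deriv_cauchy_transform_ge: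
  assumes \<rho>: "\<rho> = B \<or> \<rho> = A" and z: "B < z" "z < A" "\<bar>z - \<rho>\<bar> \<le> (A - B) / 2"
    and C: "(\<integral>t. 1 / ((\<rho> - t)\<^sup>2 + (z - \<rho>)\<^sup>2) \<partial>\<mu>) \<le> C"
  shows "deriv (cauchy_transform \<mu>) z \<ge> - (C + 4 / (A - B)\<^sup>2)"
proof -
  let ?e = "(z - \<rho>)\<^sup>2"
  have e: "?e > 0" using \<rho> z by auto
  have i1: "integrable \<mu> (\<lambda>t. 1 / (z - t)\<^sup>2)"
    using integrable_cauchy_kernel2[OF z(1,2) z(1,2)] by (simp add: power2_eq_square)
  have i2: "integrable \<mu> (\<lambda>t. 1 / ((\<rho> - t)\<^sup>2 + ?e))"
  proof (rule integrable_if_bounded_on_support[of _ "1 / ?e"])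
    fix t
    show "\<bar>1 / ((\<rho> - t)\<^sup>2 + ?e)\<bar> \<le> 1 / ?e"
      using e by (auto simp: abs_divide intro!: divide_left_mono mult_pos_pos add_nonneg_pos)
  qed simp
  have "(\<integral>t. 1 / (z - t)\<^sup>2 \<partial>\<mu>) \<le> (\<integral>t. 1 / ((\<rho> - t)\<^sup>2 + ?e) + 4 / (A - B)\<^sup>2 \<partial>\<mu>)"
  proof (rule integral_mono_AE)
    show "AE t in \<mu>. 1 / (z - t)\<^sup>2 \<le> 1 / ((\<rho> - t)\<^sup>2 + ?e) + 4 / (A - B)\<^sup>2"
      using gap
    proof eventually_elim
      case (elim t)
      have sq: "(z - t)\<^sup>2 = (\<rho> - t)\<^sup>2 + ?e + 2 * ((\<rho> - t) * (z - \<rho>))"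
        by (simp add: power2_eq_square algebra_simps)
      show ?case
      proof (cases "(\<rho> - t) * (z - \<rho>) \<ge> 0")
        case True
        have p: "(\<rho> - t)\<^sup>2 + ?e > 0" using e by (simp add: add_nonneg_pos)
        have "1 / (z - t)\<^sup>2 \<le> 1 / ((\<rho> - t)\<^sup>2 + ?e)"
          unfolding sq by (intro divide_left_mono mult_pos_pos) (use p True in linarith)+
        moreover have "4 / (A - B)\<^sup>2 \<ge> 0" by simp
        ultimately show ?thesis by linarith
      next
        case False
        hence "(A - B) / 2 \<le> \<bar>z - t\<bar>"
          using \<rho> z elim by (auto simp: mult_less_0_iff not_le)
        hence "((A - B) / 2)\<^sup>2 \<le> (z - t)\<^sup>2"
          using BA by (simp add: abs_le_square_iff[symmetric])
        moreover have "((A - B) / 2)\<^sup>2 > 0" using BA by simp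
        ultimately have "1 / (z - t)\<^sup>2 \<le> 1 / ((A - B) / 2)\<^sup>2"
          by (intro divide_left_mono mult_pos_pos) auto
        moreover have "1 / ((\<rho> - t)\<^sup>2 + ?e) \<ge> 0" by simp
        moreover have "1 / ((A - B) / 2)\<^sup>2 = 4 / (A - B)\<^sup>2" by (simp add: power_divide)
        ultimately show ?thesis by linarith
      qed
    qed
  qed (use i1 i2 in auto)
  also have "\<dots> = (\<integral>t. 1 / ((\<rho> - t)\<^sup>2 + ?e) \<partial>\<mu>) + 4 / (A - B)\<^sup>2"
    using i2 by (subst Bochner_Integration.integral_add) (auto simp: prob_space)
  also have "\<dots> \<le> C + 4 / (A - B)\<^sup>2" using C by simp
  finally show ?thesis by (simp add: deriv_cauchy_transform[OF z(1,2)])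
qed

text \<open>A bound on the regularised integrals that is uniform in e bounds the slope near the
  edge: at the point z one takes e = (z - B)^2.\<close>

lemma not_filterlim_deriv_right:
  assumes C: "\<And>e. e > 0 \<Longrightarrow> (\<integral>t. 1 / ((B - t)\<^sup>2 + e) \<partial>\<mu>) \<le> C"
  shows "\<not> filterlim (deriv (cauchy_transform \<mu>)) at_bot (at_right B)"
proof
  assume "filterlim (deriv (cauchy_transform \<mu>)) at_bot (at_right B)"
  hence "\<forall>\<^sub>F z in at_right B. deriv (cauchy_transform \<mu>) z < - (C + 4 / (A - B)\<^sup>2)"
    by (simp add: filterlim_at_bot_dense)
  moreover have "\<forall>\<^sub>F z in at_right B. z \<in> {B<..<(A + B) / 2}"
    by (rule eventually_at_rightI[of _ "(A + B) / 2"]) (use BA in auto)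
  ultimately have "\<forall>\<^sub>F z in at_right B. False"
  proof eventually_elim
    case (elim z)
    have "deriv (cauchy_transform \<mu>) z \<ge> - (C + 4 / (A - B)\<^sup>2)"
      by (rule deriv_cauchy_transform_ge[of B]) (use elim BA C[of "(z - B)\<^sup>2"] in auto)
    thus False using elim by simp
  qed
  thus False by simp
qed

lemma not_filterlim_deriv_left:
  assumes C: "\<And>e. e > 0 \<Longrightarrow> (\<integral>t. 1 / ((A - t)\<^sup>2 + e) \<partial>\<mu>) \<le> C"
  shows "\<not> filterlim (deriv (cauchy_transform \<mu>)) at_bot (at_left A)"
proof
  assume "filterlim (deriv (cauchy_transform \<mu>)) at_bot (at_left A)"
  hence "\<forall>\<^sub>F z in at_left A. deriv (cauchy_transform \<mu>) z < - (C + 4 / (A - B)\<^sup>2)"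
    by (simp add: filterlim_at_bot_dense)
  moreover have "\<forall>\<^sub>F z in at_left A. z \<in> {(A + B) / 2<..<A}"
    by (rule eventually_at_leftI[of "(A + B) / 2"]) (use BA in auto)
  ultimately have "\<forall>\<^sub>F z in at_left A. False"
  proof eventually_elim
    case (elim z)
    have "deriv (cauchy_transform \<mu>) z \<ge> - (C + 4 / (A - B)\<^sup>2)"
      by (rule deriv_cauchy_transform_ge[of A]) (use elim BA C[of "(z - A)\<^sup>2"] in auto)
    thus False using elim by simp
  qed
  thus False by simp
qed

text \<open>\<open>lim_right\<close> is a \<open>Lim\<close>, so convergence has to be proved first:
  by monotonicity the limit is the supremum over (B, \<rho>), possibly infinite. Strictness comes
  from the midpoint between B and \<rho>.\<close>

lemma cauchy_transform_less_lim_right: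
  assumes "B < \<rho>" "\<rho> < A"
  shows "ereal (cauchy_transform \<mu> \<rho>) < lim_right (cauchy_transform \<mu>) B"
proof -
  let ?G = "\<lambda>z. ereal (cauchy_transform \<mu> z)"
  define S where "S = (SUP z\<in>{B<..<\<rho>}. ?G z)"
  have "(?G \<longlongrightarrow> S) (at_right B)"
  proof (rule order_tendstoI)
    fix a assume "a < S"
    then obtain z where z: "B < z" "z < \<rho>" "a < ?G z" by (auto simp: S_def less_SUP_iff)
    show "\<forall>\<^sub>F x in at_right B. a < ?G x"
    proof (rule eventually_at_rightI[OF _ z(1)])
      fix x assume "x \<in> {B<..<z}"
      hence "?G z < ?G x" using cauchy_transform_strict_antimono[of x z] z assms by simp
      thus "a < ?G x" using z(3) by (metis order.strict_trans)
    qed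
  next
    fix a assume a: "S < a"
    show "\<forall>\<^sub>F x in at_right B. ?G x < a"
    proof (rule eventually_at_rightI[OF _ assms(1)])
      fix x assume "x \<in> {B<..<\<rho>}"
      hence "?G x \<le> S" unfolding S_def by (rule SUP_upper)
      thus "?G x < a" using a by (rule order.strict_trans1)
    qed
  qed
  hence "lim_right (cauchy_transform \<mu>) B = S"
    unfolding lim_right_def by (intro tendsto_Lim) auto
  moreover have "?G \<rho> < ?G ((B + \<rho>) / 2)"
    using cauchy_transform_strict_antimono[of "(B + \<rho>) / 2" \<rho>] assms by simp
  moreover have "?G ((B + \<rho>) / 2) \<le> S" unfolding S_def by (rule SUP_upper) (use assms in auto)
  ultimately show ?thesis by (metis order.strict_trans2)
qed

lemma lim_left_less_cauchy_transform:
  assumes "B < \<rho>" "\<rho> < A"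
  shows "lim_left (cauchy_transform \<mu>) A < ereal (cauchy_transform \<mu> \<rho>)"
proof -
  let ?G = "\<lambda>z. ereal (cauchy_transform \<mu> z)"
  define S where "S = (INF z\<in>{\<rho><..<A}. ?G z)"
  have "(?G \<longlongrightarrow> S) (at_left A)"
  proof (rule order_tendstoI)
    fix a assume "S < a"
    then obtain z where z: "z < A" "\<rho> < z" "?G z < a" by (auto simp: S_def INF_less_iff)
    show "\<forall>\<^sub>F x in at_left A. ?G x < a"
    proof (rule eventually_at_leftI[OF _ z(1)])
      fix x assume "x \<in> {z<..<A}"
      hence "?G x < ?G z" using cauchy_transform_strict_antimono[of z x] z assms by simp
      thus "?G x < a" using z(3) by (rule order.strict_trans)
    qed
  next
    fix a assume a: "a < S"
    show "\<forall>\<^sub>F x in at_left A. a < ?G x"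
    proof (rule eventually_at_leftI[OF _ assms(2)])
      fix x assume "x \<in> {\<rho><..<A}"
      hence "S \<le> ?G x" unfolding S_def by (rule INF_lower)
      thus "a < ?G x" using a by (metis order.strict_trans2)
    qed
  qed
  hence "lim_left (cauchy_transform \<mu>) A = S"
    unfolding lim_left_def by (intro tendsto_Lim) auto
  moreover have "?G ((A + \<rho>) / 2) < ?G \<rho>"
    using cauchy_transform_strict_antimono[of \<rho> "(A + \<rho>) / 2"] assms by simp
  moreover have "S \<le> ?G ((A + \<rho>) / 2)" unfolding S_def by (rule INF_lower) (use assms in auto)
  ultimately show ?thesis by (metis order.strict_trans1)
qed

end

section \<open>Perturbations of rank one\<close>

lemma rank_one_perturbation_coords:
  assumes X: "hermitian_mat n X" and P: "P \<in> carrier_mat n n" and U: "eig_unitary n X U"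
    and v: "v \<in> carrier_vec n"
    and Pv: "\<forall>i<n. \<forall>k<n. P $$ (i,k) = t * v $ i * cnj (v $ k)"
    and u: "u \<in> carrier_vec n" "(X + P) *\<^sub>v u = y \<cdot>\<^sub>v u" and i: "i < n"
  shows "(y - complex_of_real (eig (Suc i) X)) * (cadj U *\<^sub>v u) $ i = t * cinner u v * (cadj U *\<^sub>v v) $ i"
proof -
  have Xc: "X \<in> carrier_mat n n" using X hermitian_matD by blast
  have Uc: "cadj U \<in> carrier_mat n n" using U by (simp add: eig_unitary_def unitary_matD)
  have Pu: "P *\<^sub>v u = (t * cinner u v) \<cdot>\<^sub>v v"
    by (rule rank_one_mult_vec[OF P v u(1)]) (simp add: Pv)
  have XP: "(X + P) *\<^sub>v u = X *\<^sub>v u + (t * cinner u v) \<cdot>\<^sub>v v"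
    using Xc P u(1) by (simp add: add_mult_distrib_mat_vec Pu)
  have "cadj U *\<^sub>v (y \<cdot>\<^sub>v u) = cadj U *\<^sub>v (X *\<^sub>v u) + cadj U *\<^sub>v ((t * cinner u v) \<cdot>\<^sub>v v)"
    unfolding u(2)[symmetric] XP using Uc Xc u(1) v
    by (intro mult_add_distrib_mat_vec[of _ n n]) auto
  hence "y \<cdot>\<^sub>v (cadj U *\<^sub>v u) = cadj U *\<^sub>v (X *\<^sub>v u) + (t * cinner u v) \<cdot>\<^sub>v (cadj U *\<^sub>v v)"
    using mult_mat_vec[OF Uc u(1)] mult_mat_vec[OF Uc v] by simp
  hence "(y \<cdot>\<^sub>v (cadj U *\<^sub>v u)) $ i = (cadj U *\<^sub>v (X *\<^sub>v u) + (t * cinner u v) \<cdot>\<^sub>v (cadj U *\<^sub>v v)) $ i"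
    by simp
  hence "y * (cadj U *\<^sub>v u) $ i = (cadj U *\<^sub>v (X *\<^sub>v u)) $ i + t * cinner u v * (cadj U *\<^sub>v v) $ i"
    using Uc i by (simp del: index_mult_mat_vec)
  thus ?thesis unfolding eig_unitary_coords[OF U u(1) i] by (simp add: algebra_simps del: index_mult_mat_vec)
qed

text \<open>With e added, squaring the coordinate equation gives an inequality that involves no
  division by y minus an eigenvalue. It therefore survives when y is an eigenvalue of X, and its
  kernel is bounded and continuous.\<close>

lemma rank_one_perturbation_resolvent_le:
  assumes X: "hermitian_mat n X" and P: "P \<in> carrier_mat n n" and U: "eig_unitary n X U"
    and v: "v \<in> carrier_vec n"
    and Pv: "\<forall>i<n. \<forall>k<n. P $$ (i,k) = complex_of_real \<theta> * v $ i * cnj (v $ k)"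
    and u: "u \<in> carrier_vec n" "(X + P) *\<^sub>v u = complex_of_real y \<cdot>\<^sub>v u" "vnorm u = 1"
    and e: "e > 0"
  shows "\<theta>\<^sup>2 * (cmod (cinner u v))\<^sup>2 *
    (\<Sum>i<n. (cmod ((cadj U *\<^sub>v v) $ i))\<^sup>2 * (1 / ((y - eig (Suc i) X)\<^sup>2 + e))) \<le> 1"
proof -
  have Uu: "unitary_mat n U" using U by (simp add: eig_unitary_def)
  let ?s = "cmod (cinner u v)"
  have "\<theta>\<^sup>2 * ?s\<^sup>2 * (\<Sum>i<n. (cmod ((cadj U *\<^sub>v v) $ i))\<^sup>2 * (1 / ((y - eig (Suc i) X)\<^sup>2 + e)))
      \<le> (\<Sum>i<n. (cmod ((cadj U *\<^sub>v u) $ i))\<^sup>2)"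
    unfolding sum_distrib_left
  proof (rule sum_mono)
    fix i assume "i \<in> {..<n}"
    hence i: "i < n" by simp
    let ?d = "y - eig (Suc i) X"
    have pos: "?d\<^sup>2 + e > 0" using e by (simp add: add_nonneg_pos)
    have "cmod (complex_of_real ?d * (cadj U *\<^sub>v u) $ i) = cmod (complex_of_real \<theta> * cinner u v * (cadj U *\<^sub>v v) $ i)"
      using rank_one_perturbation_coords[OF X P U v Pv u(1,2) i] by simp
    hence "(\<bar>?d\<bar> * cmod ((cadj U *\<^sub>v u) $ i))\<^sup>2 = (\<bar>\<theta>\<bar> * ?s * cmod ((cadj U *\<^sub>v v) $ i))\<^sup>2"
      by (simp only: norm_mult norm_of_real)
    hence "\<theta>\<^sup>2 * ?s\<^sup>2 * (cmod ((cadj U *\<^sub>v v) $ i))\<^sup>2 = ?d\<^sup>2 * (cmod ((cadj U *\<^sub>v u) $ i))\<^sup>2"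
      by (simp only: power_mult_distrib power2_abs)
    also have "\<dots> \<le> (?d\<^sup>2 + e) * (cmod ((cadj U *\<^sub>v u) $ i))\<^sup>2"
      using e by (intro mult_right_mono) auto
    finally show "\<theta>\<^sup>2 * ?s\<^sup>2 * ((cmod ((cadj U *\<^sub>v v) $ i))\<^sup>2 * (1 / (?d\<^sup>2 + e)))
        \<le> (cmod ((cadj U *\<^sub>v u) $ i))\<^sup>2"
      using pos by (simp add: pos_divide_le_eq mult_ac)
  qed
  also have "\<dots> = 1" using unitary_parseval[OF Uu u(1)] u(3) by simp
  finally show ?thesis .
qed

text \<open>Expanding <u, v> in the eigenbasis of X and inserting the coordinate equation yields <u,
  v> again as a common factor, which is then cancelled.\<close>

lemma rank_one_perturbation_secular_equation:
  assumes X: "hermitian_mat n X" and P: "P \<in> carrier_mat n n" and U: "eig_unitary n X U"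
    and v: "v \<in> carrier_vec n"
    and Pv: "\<forall>i<n. \<forall>k<n. P $$ (i,k) = complex_of_real \<theta> * v $ i * cnj (v $ k)"
    and u: "u \<in> carrier_vec n" "(X + P) *\<^sub>v u = complex_of_real y \<cdot>\<^sub>v u"
    and s: "cinner u v \<noteq> 0" and y: "\<And>i. i < n \<Longrightarrow> y \<noteq> eig (Suc i) X"
  shows "\<theta> * (\<Sum>i<n. (cmod ((cadj U *\<^sub>v v) $ i))\<^sup>2 * (1 / (y - eig (Suc i) X))) = 1"
proof -
  have Uu: "unitary_mat n U" using U by (simp add: eig_unitary_def)
  have Uc: "cadj U \<in> carrier_mat n n" using Uu by (simp add: unitary_matD)
  let ?u = "cadj U *\<^sub>v u" and ?v = "cadj U *\<^sub>v v"
  let ?S = "\<Sum>i<n. (cmod (?v $ i))\<^sup>2 * (1 / (y - eig (Suc i) X))"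
  have "cinner u v = cinner ?u ?v"
    by (rule unitary_cinner[OF unitary_mat_cadj[OF Uu] u(1) v, symmetric])
  also have "\<dots> = (\<Sum>i<n. ?u $ i * cnj (?v $ i))"
    using Uc by (simp add: cinner_def del: index_mult_mat_vec)
  also have "\<dots> = (\<Sum>i<n. complex_of_real \<theta> * cinner u v * complex_of_real ((cmod (?v $ i))\<^sup>2 * (1 / (y - eig (Suc i) X))))"
  proof (intro sum.cong refl)
    fix i assume "i \<in> {..<n}"
    hence i: "i < n" by simp
    let ?d = "complex_of_real (y - eig (Suc i) X)"
    have d: "?d \<noteq> 0" using y[OF i] by simp
    have e: "?d * ?u $ i = complex_of_real \<theta> * cinner u v * ?v $ i"
      using rank_one_perturbation_coords[OF X P U v Pv u i] by simp
    have "?d * (?u $ i * cnj (?v $ i)) = complex_of_real \<theta> * cinner u v * (?v $ i * cnj (?v $ i))"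
      by (simp only: mult.assoc[symmetric] e)
    also have "\<dots> = complex_of_real \<theta> * cinner u v * complex_of_real ((cmod (?v $ i))\<^sup>2)"
      by (simp only: complex_norm_square)
    also have "complex_of_real ((cmod (?v $ i))\<^sup>2) = ?d * complex_of_real ((cmod (?v $ i))\<^sup>2 * (1 / (y - eig (Suc i) X)))"
      unfolding of_real_mult[symmetric] using y[OF i] by (simp del: of_real_mult of_real_power)
    also have "complex_of_real \<theta> * cinner u v * (?d * complex_of_real ((cmod (?v $ i))\<^sup>2 * (1 / (y - eig (Suc i) X)))) =
        ?d * (complex_of_real \<theta> * cinner u v * complex_of_real ((cmod (?v $ i))\<^sup>2 * (1 / (y - eig (Suc i) X))))"
      by (rule mult.left_commute)
    finally have "?d * (?u $ i * cnj (?v $ i)) =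
        ?d * (complex_of_real \<theta> * cinner u v * complex_of_real ((cmod (?v $ i))\<^sup>2 * (1 / (y - eig (Suc i) X))))" .
    thus "?u $ i * cnj (?v $ i) =
        complex_of_real \<theta> * cinner u v * complex_of_real ((cmod (?v $ i))\<^sup>2 * (1 / (y - eig (Suc i) X)))"
      by (rule mult_left_cancel[OF d, THEN iffD1])
  qed
  also have "\<dots> = complex_of_real \<theta> * cinner u v * complex_of_real ?S"
    by (simp only: sum_distrib_left[symmetric] of_real_sum[symmetric])
  also have "\<dots> = cinner u v * complex_of_real (\<theta> * ?S)"
    by (simp only: of_real_mult mult_ac)
  finally have "cinner u v * complex_of_real (\<theta> * ?S) = cinner u v * complex_of_real 1" by simp
  hence "complex_of_real (\<theta> * ?S) = complex_of_real 1" by (rule mult_left_cancel[OF s, THEN iffD1])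
  thus ?thesis unfolding of_real_eq_iff .
qed

lemma rank_one_perturbation_rayleigh:
  assumes X: "X \<in> carrier_mat n n" and P: "P \<in> carrier_mat n n" and v: "v \<in> carrier_vec n"
    and Pv: "\<forall>i<n. \<forall>k<n. P $$ (i,k) = complex_of_real \<theta> * v $ i * cnj (v $ k)"
    and x: "x \<in> carrier_vec n"
  shows "Re (cinner ((X + P) *\<^sub>v x) x) = Re (cinner (X *\<^sub>v x) x) + \<theta> * (cmod (cinner x v))\<^sup>2"
proof -
  have Px: "P *\<^sub>v x = (complex_of_real \<theta> * cinner x v) \<cdot>\<^sub>v v"
    by (rule rank_one_mult_vec[OF P v x]) (simp add: Pv)
  have "cinner ((X + P) *\<^sub>v x) x = cinner (X *\<^sub>v x) x + complex_of_real \<theta> * cinner x v * cinner v x"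
    using X P v x by (simp add: add_mult_distrib_mat_vec Px cinner_add_left cinner_smult_left)
  also have "cinner v x = cnj (cinner x v)" using v x by (simp add: cinner_cnj)
  also have "complex_of_real \<theta> * cinner x v * cnj (cinner x v) = complex_of_real (\<theta> * (cmod (cinner x v))\<^sup>2)"
    by (simp only: mult.assoc complex_norm_square of_real_mult)
  finally show ?thesis by simp
qed

lemma hermitian_add: "hermitian_mat n A \<Longrightarrow> hermitian_mat n B \<Longrightarrow> hermitian_mat n (A + B)"
proof -
  assume A: "hermitian_mat n A" and B: "hermitian_mat n B"
  note Ac = hermitian_matD[OF A] and Bc = hermitian_matD[OF B]
  have "cadj (A + B) = A + B"
    by (rule eq_matI) (use Ac(1) Bc(1) hermitian_mat_entry[OF A] hermitian_mat_entry[OF B] in auto)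
  thus ?thesis using Ac Bc by (simp add: hermitian_mat_def)
qed

text \<open>P is nonnegative, vanishes on the hyperplane orthogonal to v, and is at most \<theta> by
  Cauchy-Schwarz; each fact gives one bound. The third one serves k = 0, where there is no
  eigenvalue of X above to interlace with.\<close>

lemma rank_one_perturbation_interlacing:
  assumes X: "hermitian_mat n X" and P: "hermitian_mat n P" and v: "v \<in> carrier_vec n" "vnorm v = 1"
    and \<theta>: "\<theta> > 0"
    and Pv: "\<forall>i<n. \<forall>k<n. P $$ (i,k) = complex_of_real \<theta> * v $ i * cnj (v $ k)"
    and k: "k < n"
  shows "eig (Suc k) X \<le> eig (Suc k) (X + P)"
    and "k \<ge> 1 \<Longrightarrow> eig (Suc k) (X + P) \<le> eig k X"
    and "eig (Suc k) (X + P) \<le> eig 1 X + \<theta>"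
proof -
  note Xc = hermitian_matD(1)[OF X] and Pc = hermitian_matD(1)[OF P]
  note XP = hermitian_add[OF X P]
  note ray = rank_one_perturbation_rayleigh[OF Xc Pc v(1) Pv]
  show "eig (Suc k) X \<le> eig (Suc k) (X + P)"
    using \<theta> by (intro eig_le_if_rayleigh_le[OF X XP k]) (simp add: ray)
  show "eig (Suc k) (X + P) \<le> eig k X" if k1: "k \<ge> 1"
  proof -
    obtain k' where k': "k = Suc k'" using k1 by (cases k) auto
    show ?thesis unfolding k'
      by (rule eig_le_if_rayleigh_le_hyperplane[OF XP X _ v(1)]) (use k k' ray in auto)
  qed
  have "eig (Suc k) (X + P) \<le> eig 1 (X + P)" using k by (intro eig_antimono[OF XP]) auto
  also have "\<dots> \<le> eig 1 X + \<theta>"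
  proof (rule eig_1_le[OF XP])
    fix x :: "complex vec" assume x: "x \<in> carrier_vec n"
    obtain U where U: "eig_unitary n X U" using ex_eig_unitary[OF X] by blast
    have "Re (cinner (X *\<^sub>v x) x) \<le> eig 1 X * (vnorm x)\<^sup>2"
      using rayleigh_le[OF X U x, of 0] k by simp
    moreover have "cmod (cinner x v) \<le> vnorm x"
      using cinner_cauchy_schwarz[of x v] x v by simp
    hence "\<theta> * (cmod (cinner x v))\<^sup>2 \<le> \<theta> * (vnorm x)\<^sup>2"
      using \<theta> by (intro mult_left_mono power_mono) auto
    ultimately show "Re (cinner ((X + P) *\<^sub>v x) x) \<le> (eig 1 X + \<theta>) * (vnorm x)\<^sup>2"
      by (simp add: ray[OF x] distrib_right)
  qed (use k in simp)
  finally show "eig (Suc k) (X + P) \<le> eig 1 X + \<theta>" .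
qed

section \<open>Test functions for weak convergence, and passage to a subsequence\<close>

lemma resolvent_kernel_bounded:
  assumes "(e::real) > 0"
  shows "continuous_on UNIV (\<lambda>s::real. 1 / (s\<^sup>2 + e))" "bounded (range (\<lambda>s::real. 1 / (s\<^sup>2 + e)))"
proof -
  have pos: "s\<^sup>2 + e > 0" for s :: real using assms by (simp add: add_nonneg_pos)
  show "continuous_on UNIV (\<lambda>s::real. 1 / (s\<^sup>2 + e))"
    using pos by (intro continuous_intros) (metis less_irrefl)
  have "\<bar>1 / (s\<^sup>2 + e)\<bar> \<le> 1 / e" for s :: real
    using pos[of s] assms unfolding abs_divide abs_one by (intro divide_left_mono) auto
  thus "bounded (range (\<lambda>s::real. 1 / (s\<^sup>2 + e)))"
    unfolding bounded_iff by auto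
qed

text \<open>It is 1/s for |s| at least \<eta> and the line s/\<eta>^2 inside, hence a bounded
  continuous function that agrees with 1/s away from 0.\<close>

definition trunc_inverse :: "real \<Rightarrow> real \<Rightarrow> real" where
  "trunc_inverse \<eta> s = s / max (s\<^sup>2) (\<eta>\<^sup>2)"

lemma trunc_inverse_eq: "\<eta> > 0 \<Longrightarrow> \<eta> \<le> \<bar>s\<bar> \<Longrightarrow> trunc_inverse \<eta> s = 1 / s"
proof -
  assume "\<eta> > 0" "\<eta> \<le> \<bar>s\<bar>"
  moreover from this have "\<eta>\<^sup>2 \<le> s\<^sup>2" by (metis abs_le_square_iff abs_of_pos)
  ultimately show ?thesis by (auto simp: trunc_inverse_def max_absorb1 power2_eq_square)
qed

lemma trunc_inverse_bounded:
  assumes "\<eta> > 0"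
  shows "continuous_on UNIV (trunc_inverse \<eta>)" "bounded (range (trunc_inverse \<eta>))"
proof -
  have pos: "max (s\<^sup>2) (\<eta>\<^sup>2) > 0" for s using assms by (simp add: less_max_iff_disj)
  show "continuous_on UNIV (trunc_inverse \<eta>)"
    unfolding trunc_inverse_def using pos by (intro continuous_intros) (metis less_irrefl)
  have "\<bar>trunc_inverse \<eta> s\<bar> \<le> 1 / \<eta>" for s
  proof -
    have "\<bar>s\<bar> * \<eta> \<le> max (s\<^sup>2) (\<eta>\<^sup>2)"
    proof (cases "\<bar>s\<bar> \<le> \<eta>")
      case True
      hence "\<bar>s\<bar> * \<eta> \<le> \<eta> * \<eta>" using assms by (intro mult_right_mono) auto
      thus ?thesis by (simp add: power2_eq_square le_max_iff_disj)
    next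
      case False
      hence "\<bar>s\<bar> * \<eta> \<le> \<bar>s\<bar> * \<bar>s\<bar>" using assms by (intro mult_left_mono) auto
      thus ?thesis by (simp add: power2_eq_square le_max_iff_disj)
    qed
    thus ?thesis using pos[of s] assms
      by (simp add: trunc_inverse_def abs_divide pos_divide_le_eq pos_le_divide_eq)
  qed
  thus "bounded (range (trunc_inverse \<eta>))" unfolding bounded_iff by auto
qed

text \<open>The predicate Q carries facts that hold only eventually; on the subsequence they hold at
  every index.\<close>

lemma not_tendsto_0_subseq:
  fixes s :: "nat \<Rightarrow> complex"
  assumes "\<not> s \<longlonglongrightarrow> 0" "\<forall>\<^sub>F n in sequentially. Q n"
  obtains \<delta> r where "\<delta> > 0" "strict_mono (r :: nat \<Rightarrow> nat)" "\<And>n. \<delta> \<le> cmod (s (r n))" "\<And>n. Q (r n)"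
proof -
  obtain \<delta> where \<delta>: "\<delta> > 0" "\<And>N. \<exists>n\<ge>N. \<delta> \<le> cmod (s n)"
    using assms(1) unfolding LIMSEQ_iff by (auto simp: not_less)
  obtain N0 where N0: "\<And>n. n \<ge> N0 \<Longrightarrow> Q n" using assms(2) by (auto simp: eventually_sequentially)
  have inf: "infinite {n. \<delta> \<le> cmod (s n) \<and> Q n}"
    unfolding infinite_nat_iff_unbounded_le
  proof
    fix N
    obtain n where "n \<ge> max N N0" "\<delta> \<le> cmod (s n)" using \<delta>(2) by blast
    thus "\<exists>n\<ge>N. n \<in> {n. \<delta> \<le> cmod (s n) \<and> Q n}" using N0[of n] by auto
  qed
  show ?thesis
    by (rule that[of \<delta> "enumerate {n. \<delta> \<le> cmod (s n) \<and> Q n}"])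
       (use \<delta>(1) strict_mono_enumerate[OF inf] enumerate_in_set[OF inf] in auto)
qed

text \<open>\<open>top\<close> is the case of the rightmost component, where the gap \<open>(B, A)\<close> is replaced by \<open>(B, \<infinity>)\<close>.\<close>
lemma eigenvector_overlap_tendsto_0:
  fixes X P U :: "nat \<Rightarrow> complex mat" and u v :: "nat \<Rightarrow> complex vec" and k :: "nat \<Rightarrow> nat"
    and \<mu> :: "real measure" and A B \<theta> :: real and top :: bool
  assumes X: "\<And>n. hermitian_mat n (X n)" and P: "\<And>n. hermitian_mat n (P n)"
    and U: "\<And>n. eig_unitary n (X n) (U n)"
    and v: "\<And>n. n \<ge> 1 \<Longrightarrow> v n \<in> carrier_vec n" "\<And>n. n \<ge> 1 \<Longrightarrow> vnorm (v n) = 1"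
    and \<theta>: "\<theta> > 0"
    and Pv: "\<And>n. n \<ge> 1 \<Longrightarrow> \<forall>i<n. \<forall>l<n. P n $$ (i,l) = complex_of_real \<theta> * v n $ i * cnj (v n $ l)"
    and k: "\<forall>\<^sub>F n in sequentially. k n < n"
    and u: "\<And>n. k n < n \<Longrightarrow> u n \<in> carrier_vec n" "\<And>n. k n < n \<Longrightarrow> vnorm (u n) = 1"
      "\<And>n. k n < n \<Longrightarrow> (X n + P n) *\<^sub>v u n = complex_of_real (eig (Suc (k n)) (X n + P n)) \<cdot>\<^sub>v u n"
    and lower: "(\<lambda>n. eig (Suc (k n)) (X n)) \<longlonglongrightarrow> B"
    and bd: "\<forall>\<^sub>F n in sequentially. \<forall>i<n. \<bar>eig (Suc i) (X n)\<bar> \<le> R"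
    and weak: "\<And>f :: real \<Rightarrow> real. continuous_on UNIV f \<Longrightarrow> bounded (range f) \<Longrightarrow>
      (\<lambda>n. \<Sum>i<n. (cmod ((cadj (U n) *\<^sub>v v n) $ i))\<^sup>2 * f (eig (Suc i) (X n))) \<longlonglongrightarrow> (\<integral>t. f t \<partial>\<mu>)"
    and \<mu>: "prob_space \<mu>" "sets \<mu> = sets borel"
    and deriv_B: "filterlim (deriv (cauchy_transform \<mu>)) at_bot (at_right B)"
    and top_k: "top \<Longrightarrow> \<forall>n. k n = 0" and top_supp: "top \<Longrightarrow> AE t in \<mu>. t \<le> B"
    and A: "\<not> top \<Longrightarrow> B < A" "\<not> top \<Longrightarrow> AE t in \<mu>. t \<le> B \<or> A \<le> t"
      "\<not> top \<Longrightarrow> filterlim (deriv (cauchy_transform \<mu>)) at_bot (at_left A)"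
      "\<not> top \<Longrightarrow> \<forall>\<^sub>F n in sequentially. k n \<ge> 1"
      "\<not> top \<Longrightarrow> (\<lambda>n. eig (k n) (X n)) \<longlonglongrightarrow> A"
    and excl: "\<not> ((if top then ereal 0 else lim_left (cauchy_transform \<mu>) A) < ereal (1 / \<theta>)
                 \<and> ereal (1 / \<theta>) < lim_right (cauchy_transform \<mu>) B)"
  shows "(\<lambda>n. cinner (u n) (v n)) \<longlonglongrightarrow> 0"
proof (rule ccontr)
  assume neg: "\<not> ?thesis"
  define y where "y = (\<lambda>n. eig (Suc (k n)) (X n + P n))"
  define Q where "Q = (\<lambda>n. k n < n \<and> (\<forall>i<n. \<bar>eig (Suc i) (X n)\<bar> \<le> R) \<and> (\<not> top \<longrightarrow> k n \<ge> 1))"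
  have "\<forall>\<^sub>F n in sequentially. Q n"
    unfolding Q_def using k bd A(4) by (intro eventually_conj) (cases top; simp)+
  from not_tendsto_0_subseq[OF neg this] obtain \<delta> r0 where \<delta>: "\<delta> > 0"
    and r0: "strict_mono (r0 :: nat \<Rightarrow> nat)" "\<And>n. \<delta> \<le> cmod (cinner (u (r0 n)) (v (r0 n)))" "\<And>n. Q (r0 n)"
    by blast
  have y_lower: "eig (Suc (k n)) (X n) \<le> y n" and y_upper: "\<not> top \<Longrightarrow> y n \<le> eig (k n) (X n)"
    and y_top: "y n \<le> eig 1 (X n) + \<theta>" if "Q n" for n
  proof -
    have kn: "k n < n" using that by (simp add: Q_def)
    hence n: "n \<ge> 1" by simp
    note il = rank_one_perturbation_interlacing[OF X P v(1)[OF n] v(2)[OF n] \<theta> Pv[OF n] kn]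
    show "eig (Suc (k n)) (X n) \<le> y n" "y n \<le> eig 1 (X n) + \<theta>"
      using il(1,3) by (simp_all add: y_def)
    show "y n \<le> eig (k n) (X n)" if "\<not> top"
      using il(2) \<open>Q n\<close> that by (simp add: y_def Q_def)
  qed
  have y_mem: "y (r0 n) \<in> {-R..R + \<theta>}" for n
  proof -
    note q = r0(3)[of n]
    have kn: "k (r0 n) < r0 n" and b: "\<And>i. i < r0 n \<Longrightarrow> \<bar>eig (Suc i) (X (r0 n))\<bar> \<le> R"
      using q by (auto simp: Q_def)
    show ?thesis using y_lower[OF q] y_top[OF q] b[OF kn] b[of 0] kn by auto
  qed
  \<comment> \<open>Interlacing confines y to a compact interval, so a further subsequence
    converges.\<close>
  have "\<exists>\<rho>\<in>{-R..R + \<theta>}. \<exists>r1. strict_mono r1 \<and> ((y \<circ> r0) \<circ> r1) \<longlonglongrightarrow> \<rho>"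
    by (rule compact_Icc[unfolded compact_def, rule_format]) (simp only: comp_apply y_mem)
  then obtain \<rho> r1 where r1: "strict_mono (r1 :: nat \<Rightarrow> nat)" "((y \<circ> r0) \<circ> r1) \<longlonglongrightarrow> \<rho>"
    by blast
  define r where "r = r0 \<circ> r1"
  have r: "strict_mono r" "(\<lambda>n. y (r n)) \<longlonglongrightarrow> \<rho>" "\<And>n. \<delta> \<le> cmod (cinner (u (r n)) (v (r n)))" "\<And>n. Q (r n)"
    using r0 r1 strict_mono_o by (auto simp: r_def o_def)
  have sub: "(\<lambda>n. f (r n)) \<longlonglongrightarrow> c" if "f \<longlonglongrightarrow> c" for f :: "nat \<Rightarrow> real" and c
    using LIMSEQ_subseq_LIMSEQ[OF that r(1)] by (simp add: o_def)
  have Qr: "k (r n) < r n" "\<forall>i<r n. \<bar>eig (Suc i) (X (r n))\<bar> \<le> R" "\<not> top \<Longrightarrow> k (r n) \<ge> 1" "r n \<ge> 1" for n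
    using r(4)[of n] by (auto simp: Q_def)
  define w where "w = (\<lambda>n i. (cmod ((cadj (U n) *\<^sub>v v n) $ i))\<^sup>2)"
  define l where "l = (\<lambda>n i. eig (Suc i) (X n))"
  have w1: "(\<Sum>i<r n. w (r n) i) = 1" for n
  proof -
    have "unitary_mat (r n) (U (r n))" using U by (simp add: eig_unitary_def)
    from unitary_parseval[OF this v(1)[OF Qr(4)]] show ?thesis using v(2)[OF Qr(4)] by (simp add: w_def)
  qed
  have lim: "(\<lambda>n. \<Sum>i<r n. w (r n) i * \<phi> (y (r n) - l (r n) i)) \<longlonglongrightarrow> (\<integral>t. \<phi> (\<rho> - t) \<partial>\<mu>)"
    if "continuous_on UNIV \<phi>" "bounded (range \<phi>)" for \<phi> :: "real \<Rightarrow> real"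
  proof (rule weighted_average_shift_tendsto[where R = R])
    show "w (r n) i \<ge> 0" for n i by (simp add: w_def)
    show "\<forall>\<^sub>F n in sequentially. sum (w (r n)) {..<r n} = 1" using w1 by simp
    show "(\<lambda>n. \<Sum>i<r n. w (r n) i * f (l (r n) i)) \<longlonglongrightarrow> (\<integral>t. f t \<partial>\<mu>)"
      if "continuous_on UNIV f" "bounded (range f)" for f :: "real \<Rightarrow> real"
      using sub[OF weak[OF that]] by (simp add: w_def l_def)
    show "\<forall>\<^sub>F n in sequentially. \<forall>i<r n. \<bar>l (r n) i\<bar> \<le> R" using Qr(2) by (simp add: l_def)
  qed (use that r(2) in auto)
  \<comment> \<open>The bound is the same for all e, because \<delta> bounds the overlap from below
    along the whole subsequence. This uniformity is what contradicts an infinite slope at an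
    edge.\<close>
  have H1: "(\<integral>t. 1 / ((\<rho> - t)\<^sup>2 + e) \<partial>\<mu>) \<le> 1 / (\<theta>\<^sup>2 * \<delta>\<^sup>2)" if e: "e > 0" for e
  proof (rule LIMSEQ_le_const2[OF lim[OF resolvent_kernel_bounded[OF e]]], intro exI allI impI)
    fix n
    let ?S = "\<Sum>i<r n. w (r n) i * (1 / ((y (r n) - l (r n) i)\<^sup>2 + e))"
    have S0: "?S \<ge> 0" using e by (intro sum_nonneg mult_nonneg_nonneg divide_nonneg_nonneg add_nonneg_nonneg) (auto simp: w_def)
    have "\<theta>\<^sup>2 * \<delta>\<^sup>2 * ?S \<le> \<theta>\<^sup>2 * (cmod (cinner (u (r n)) (v (r n))))\<^sup>2 * ?S"
      using S0 r(3)[of n] \<delta> by (intro mult_right_mono mult_left_mono power_mono) auto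
    also have "\<dots> \<le> 1"
      using rank_one_perturbation_resolvent_le[OF X hermitian_matD(1)[OF P] U v(1)[OF Qr(4)] Pv[OF Qr(4)] u(1,3,2)[OF Qr(1)] e]
      by (simp add: w_def l_def y_def)
    finally show "?S \<le> 1 / (\<theta>\<^sup>2 * \<delta>\<^sup>2)"
      using \<theta> \<delta> by (simp add: pos_le_divide_eq mult.commute)
  qed
  have B\<rho>: "B \<le> \<rho>"
    by (rule LIMSEQ_le[OF sub[OF lower] r(2)]) (use y_lower[OF r(4)] in auto)
  have \<rho>A: "\<rho> \<le> A" if "\<not> top"
    by (rule LIMSEQ_le[OF r(2) sub[OF A(5)[OF that]]]) (use y_upper[OF r(4) that] in auto)
  \<comment> \<open>In the top case there is no mass beyond B, so any point to the right of \<rho>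
    can close the gap.\<close>
  define A' where "A' = (if top then \<rho> + 1 else A)"
  have sg: "support_gap \<mu> B A'"
  proof -
    interpret prob_space \<mu> by (rule \<mu>(1))
    show ?thesis
    proof
      show "sets \<mu> = sets borel" by (rule \<mu>(2))
      show "B < A'" using A(1) B\<rho> by (auto simp: A'_def)
      show "AE t in \<mu>. t \<le> B \<or> A' \<le> t"
      proof (cases top)
        case True
        from top_supp[OF True] show ?thesis by eventually_elim simp
      next
        case False
        thus ?thesis using A(2) by (simp add: A'_def)
      qed
    qed
  qed
  interpret support_gap \<mu> B A' by (rule sg)
  have "\<rho> \<noteq> B"
    using not_filterlim_deriv_right[of "1 / (\<theta>\<^sup>2 * \<delta>\<^sup>2)"] H1 deriv_B by blast
  hence B\<rho>': "B < \<rho>" using B\<rho> by simp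
  have \<rho>A': "\<rho> < A'"
  proof (cases top)
    case True
    thus ?thesis by (simp add: A'_def)
  next
    case False
    have "\<rho> \<noteq> A"
      using not_filterlim_deriv_left[of "1 / (\<theta>\<^sup>2 * \<delta>\<^sup>2)"] H1 A(3)[OF False] False by (auto simp: A'_def)
    thus ?thesis using \<rho>A[OF False] False by (simp add: A'_def)
  qed
  \<comment> \<open>\<rho> is 2\<eta> away from both ends. Letting y and the neighbouring eigenvalue
    each drift by \<eta>/2 still leaves distance \<eta> between y and the spectrum of X.\<close>
  define \<eta> where "\<eta> = min (\<rho> - B) (A' - \<rho>) / 2"
  have \<eta>: "\<eta> > 0" "B + 2 * \<eta> \<le> \<rho>" "\<rho> \<le> A' - 2 * \<eta>"
  proof -
    have "\<eta> > 0" "2 * \<eta> \<le> \<rho> - B" "2 * \<eta> \<le> A' - \<rho>" using B\<rho>' \<rho>A' by (auto simp: \<eta>_def)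
    thus "\<eta> > 0" "B + 2 * \<eta> \<le> \<rho>" "\<rho> \<le> A' - 2 * \<eta>" by auto
  qed
  have ev1: "\<forall>\<^sub>F n in sequentially. eig (Suc (k (r n))) (X (r n)) < B + \<eta> / 2"
    by (rule order_tendstoD(2)[OF sub[OF lower]]) (use \<eta> in simp)
  have ev2: "\<forall>\<^sub>F n in sequentially. \<rho> - \<eta> / 2 < y (r n)"
    by (rule order_tendstoD(1)[OF r(2)]) (use \<eta> in simp)
  have ev3: "\<forall>\<^sub>F n in sequentially. y (r n) < \<rho> + \<eta> / 2"
    by (rule order_tendstoD(2)[OF r(2)]) (use \<eta> in simp)
  have ev4: "\<forall>\<^sub>F n in sequentially. \<not> top \<longrightarrow> A - \<eta> / 2 < eig (k (r n)) (X (r n))"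
  proof (cases top)
    case False
    have "\<forall>\<^sub>F n in sequentially. A - \<eta> / 2 < eig (k (r n)) (X (r n))"
      by (rule order_tendstoD(1)[OF sub[OF A(5)[OF False]]]) (use \<eta> in simp)
    thus ?thesis by eventually_elim simp
  qed simp
  have "\<forall>\<^sub>F n in sequentially. (\<Sum>i<r n. w (r n) i * trunc_inverse \<eta> (y (r n) - l (r n) i)) = 1 / \<theta>"
    using ev1 ev2 ev3 ev4
  proof eventually_elim
    case (elim n)
    \<comment> \<open>Positions i below k belong to eigenvalues near A or above it, the others to
      eigenvalues near B or below it. In the top case k = 0 and the first group is empty.\<close>
    have far: "\<eta> \<le> \<bar>y (r n) - l (r n) i\<bar>" if i: "i < r n" for i
    proof (cases "i < k (r n)")
      case True
      hence nt: "\<not> top" using top_k by (metis not_less_zero)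
      have "eig (k (r n)) (X (r n)) \<le> l (r n) i"
        unfolding l_def using True Qr(1,4)[of n] i by (intro eig_antimono[OF X]) auto
      thus ?thesis using elim nt \<eta> by (simp add: A'_def)
    next
      case False
      have "l (r n) i \<le> eig (Suc (k (r n))) (X (r n))"
        unfolding l_def using False i by (intro eig_antimono[OF X]) auto
      thus ?thesis using elim \<eta> by simp
    qed
    have ne: "y (r n) \<noteq> eig (Suc i) (X (r n))" if "i < r n" for i
      using far[OF that] \<eta>(1) by (auto simp: l_def)
    have s: "cinner (u (r n)) (v (r n)) \<noteq> 0" using r(3)[of n] \<delta> by auto
    have "\<theta> * (\<Sum>i<r n. w (r n) i * (1 / (y (r n) - l (r n) i))) = 1"
      unfolding w_def l_def y_def
      by (rule rank_one_perturbation_secular_equation[OF X hermitian_matD(1)[OF P] U v(1)[OF Qr(4)] Pv[OF Qr(4)] u(1,3)[OF Qr(1)] s])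
         (use ne in \<open>auto simp: y_def\<close>)
    moreover have "(\<Sum>i<r n. w (r n) i * trunc_inverse \<eta> (y (r n) - l (r n) i)) = (\<Sum>i<r n. w (r n) i * (1 / (y (r n) - l (r n) i)))"
      using far by (intro sum.cong) (auto simp: trunc_inverse_eq[OF \<eta>(1)])
    ultimately show ?case using \<theta> by (simp add: nonzero_eq_divide_eq mult.commute)
  qed
  hence "(\<lambda>n. \<Sum>i<r n. w (r n) i * trunc_inverse \<eta> (y (r n) - l (r n) i)) \<longlonglongrightarrow> 1 / \<theta>"
    by (rule tendsto_eventually)
  with lim[OF trunc_inverse_bounded[OF \<eta>(1)]] have "(\<integral>t. trunc_inverse \<eta> (\<rho> - t) \<partial>\<mu>) = 1 / \<theta>"
    by (rule LIMSEQ_unique)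
  moreover have "(\<integral>t. trunc_inverse \<eta> (\<rho> - t) \<partial>\<mu>) = cauchy_transform \<mu> \<rho>"
    unfolding cauchy_transform_def
  proof (rule integral_cong_AE)
    show "AE t in \<mu>. trunc_inverse \<eta> (\<rho> - t) = 1 / (\<rho> - t)"
      using gap
    proof eventually_elim
      case (elim t)
      have "\<eta> \<le> \<bar>\<rho> - t\<bar>" by (rule gap_dist[OF _ _ elim]) (use \<eta> in auto)
      thus ?case by (rule trunc_inverse_eq[OF \<eta>(1)])
    qed
  qed (auto intro!: measurable_borel simp: trunc_inverse_def)
  ultimately have G: "cauchy_transform \<mu> \<rho> = 1 / \<theta>" by simp
  have "ereal (1 / \<theta>) < lim_right (cauchy_transform \<mu>) B"
    using cauchy_transform_less_lim_right[OF B\<rho>' \<rho>A'] G by simp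
  \<comment> \<open>In the top case the left bound is 0 < 1/\<theta>, that is, positivity of
    \<theta>; otherwise it is monotonicity of G up to A.\<close>
  moreover have "(if top then ereal 0 else lim_left (cauchy_transform \<mu>) A) < ereal (1 / \<theta>)"
    using lim_left_less_cauchy_transform[OF B\<rho>' \<rho>A'] \<theta> G by (auto simp: A'_def)
  ultimately show False using excl by blast
qed

section \<open>The spiked model\<close>

lemma bands_ordered:
  fixes a b :: "nat \<Rightarrow> real"
  assumes ab: "\<And>i. i \<in> {1..L} \<Longrightarrow> a i < b i" and ba: "\<And>i. i \<in> {1..<L} \<Longrightarrow> b (i+1) < a i"
    and "1 \<le> i" "i < k" "k \<le> L"
  shows "b k < a i"
  using assms(4,5)
proof (induct k)
  case (Suc k)
  show ?case
  proof (cases "i = k")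
    case True
    thus ?thesis using ba[of k] Suc assms(3) by simp
  next
    case False
    hence "b k < a i" using Suc by simp
    moreover have "b (Suc k) < a k" using ba[of k] Suc assms(3) by simp
    moreover have "a k < b k" using ab[of k] Suc assms(3) by simp
    ultimately show ?thesis by linarith
  qed
qed simp

lemma AE_mixture_in_bands:
  fixes a b p :: "nat \<Rightarrow> real" and \<mu> :: "nat \<Rightarrow> real measure" and \<mu>X :: "real measure"
  assumes p_sum: "(\<Sum>i=1..L. p i) = 1"
    and mu_prob: "\<And>i. i \<in> {1..L} \<Longrightarrow> prob_space (\<mu> i) \<and> sets (\<mu> i) = sets borel"
    and mu_supp: "\<And>i. i \<in> {1..L} \<Longrightarrow> measure (\<mu> i) {a i..b i} = 1"
    and muX: "prob_space \<mu>X" "sets \<mu>X = sets borel"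
    and muX_eq: "\<And>A. A \<in> sets borel \<Longrightarrow> measure \<mu>X A = (\<Sum>i=1..L. p i * measure (\<mu> i) A)"
  shows "AE t in \<mu>X. \<exists>i\<in>{1..L}. a i \<le> t \<and> t \<le> b i"
proof -
  interpret prob_space \<mu>X by (rule muX(1))
  define S where "S = (\<Union>i\<in>{1..L}. {a i..b i})"
  have S: "S \<in> sets borel" unfolding S_def by (intro sets.finite_UN) auto
  have "measure (\<mu> i) S = 1" if i: "i \<in> {1..L}" for i
  proof -
    interpret m: prob_space "\<mu> i" using mu_prob[OF i] by simp
    have "m.prob {a i..b i} \<le> m.prob S"
      using S mu_prob[OF i] i by (intro m.finite_measure_mono) (auto simp: S_def)
    thus ?thesis using mu_supp[OF i] m.prob_le_1[of S] by linarith
  qed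
  hence "prob S = 1" unfolding muX_eq[OF S] using p_sum by simp
  hence "AE t in \<mu>X. t \<in> S" by (rule AE_prob_1)
  thus ?thesis by eventually_elim (auto simp: S_def)
qed

theorem mainTheorem5:
  fixes M :: "'w measure"
    and real_case :: bool
    and X :: "nat \<Rightarrow> 'w \<Rightarrow> complex mat"
    and P :: "nat \<Rightarrow> complex mat"
    and \<theta> :: real
    and L :: nat
    and p a b :: "nat \<Rightarrow> real"
    and \<mu> :: "nat \<Rightarrow> real measure"
    and \<mu>X :: "real measure"
    and j :: nat
    and u :: "nat \<Rightarrow> 'w \<Rightarrow> complex vec"
  assumes M: "prob_space M"
    \<comment> \<open>X_n: random real symmetric / complex Hermitian n x n matrices\<close>
    and X_herm: "\<And>n \<omega>. \<omega> \<in> space M \<Longrightarrow> hermitian_mat n (X n \<omega>)"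
    and X_real: "\<And>n \<omega>. real_case \<Longrightarrow> \<omega> \<in> space M \<Longrightarrow> real_mat (X n \<omega>)"
    and X_meas: "\<And>n i k. i < n \<Longrightarrow> k < n \<Longrightarrow> (\<lambda>\<omega>. X n \<omega> $$ (i,k)) \<in> borel_measurable M"
    \<comment> \<open>orthogonal (resp. unitary) invariance in distribution\<close>
    and X_inv: "\<And>n U. U \<in> invariance_group real_case n \<Longrightarrow>
          distr M (entries_space n) (\<lambda>\<omega>. entries n (U * X n \<omega> * cadj U))
        = distr M (entries_space n) (\<lambda>\<omega>. entries n (X n \<omega>))"
    \<comment> \<open>the limit measure mu_X = sum_j p_j mu_j\<close>
    and l_pos: "L \<ge> 1"
    and p_pos: "\<And>i. i \<in> {1..L} \<Longrightarrow> p i > 0"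
    and p_sum: "(\<Sum>i=1..L. p i) = 1"
    and mu_prob: "\<And>i. i \<in> {1..L} \<Longrightarrow> prob_space (\<mu> i) \<and> sets (\<mu> i) = sets borel"
    and mu_supp: "\<And>i. i \<in> {1..L} \<Longrightarrow> measure (\<mu> i) {a i..b i} = 1"
    and mu_pos: "\<And>i x y. i \<in> {1..L} \<Longrightarrow> a i \<le> x \<Longrightarrow> x < y \<Longrightarrow> y \<le> b i \<Longrightarrow>
                   measure (\<mu> i) {x<..<y} > 0"
    and ab_order: "\<And>i. i \<in> {1..L} \<Longrightarrow> a i < b i"
    and ba_order: "\<And>i. i \<in> {1..<L} \<Longrightarrow> b (i+1) < a i"
    and muX_prob: "prob_space \<mu>X" and muX_sets: "sets \<mu>X = sets borel"
    and muX_eq: "\<And>A. A \<in> sets borel \<Longrightarrow> measure \<mu>X A = (\<Sum>i=1..L. p i * measure (\<mu> i) A)"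
    \<comment> \<open>a.s. weak convergence of the empirical eigenvalue distribution\<close>
    and esd: "AE \<omega> in M. \<forall>f :: real \<Rightarrow> real. continuous_on UNIV f \<and> bounded (range f) \<longrightarrow>
               (\<lambda>n. (\<Sum>k=1..n. f (eig k (X n \<omega>))) / real n) \<longlonglongrightarrow> (\<integral>t. f t \<partial>\<mu>X)"
    \<comment> \<open>convergence of the edge eigenvalues of each bulk\<close>
    and edge_b: "\<And>i. i \<in> {1..L} \<Longrightarrow> AE \<omega> in M.
       (\<lambda>n. eig (nat \<lceil>real n * (\<Sum>k=1..i-1. p k)\<rceil> + 1) (X n \<omega>)) \<longlonglongrightarrow> b i"
    and edge_a: "\<And>i. i \<in> {1..L} \<Longrightarrow> AE \<omega> in M.
       (\<lambda>n. eig (nat \<lceil>real n * (\<Sum>k=1..i. p k)\<rceil>) (X n \<omega>)) \<longlonglongrightarrow> a i"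
    \<comment> \<open>P_n: deterministic rank one, sole nonzero eigenvalue theta > 0\<close>
    and theta_pos: "\<theta> > 0"
    and P_herm: "\<And>n. hermitian_mat n (P n)"
    and P_real: "\<And>n. real_case \<Longrightarrow> real_mat (P n)"
    and P_eigs: "\<And>n. n \<ge> 1 \<Longrightarrow>
       proots (char_poly (P n)) = add_mset (complex_of_real \<theta>) (replicate_mset (n - 1) 0)"
    \<comment> \<open>hypotheses on j\<close>
    and j_range: "j \<in> {1..L}"
    and not_in_interval: "\<not> ((if j = 1 then ereal 0 else lim_left (cauchy_transform \<mu>X) (a (j-1)))
                              < ereal (1/\<theta>)
                           \<and> ereal (1/\<theta>) < lim_right (cauchy_transform \<mu>X) (b j))"
    and deriv_b: "filterlim (deriv (cauchy_transform \<mu>X)) at_bot (at_right (b j))"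
    and deriv_a: "j \<ge> 2 \<Longrightarrow> filterlim (deriv (cauchy_transform \<mu>X)) at_bot (at_left (a (j-1)))"
    \<comment> \<open>u n: an (arbitrary) unit eigenvector of X_n + P_n for lambda_{ceil(n c_{j-1})+1}\<close>
    and u_eig: "\<And>n \<omega>. \<omega> \<in> space M \<Longrightarrow>
       let k = nat \<lceil>real n * (\<Sum>i=1..j-1. p i)\<rceil> + 1 in k \<le> n \<longrightarrow>
         u n \<omega> \<in> carrier_vec n \<and> vnorm (u n \<omega>) = 1 \<and> (real_case \<longrightarrow> real_vec (u n \<omega>)) \<and>
         (X n \<omega> + P n) *\<^sub>v u n \<omega> = complex_of_real (eig k (X n \<omega> + P n)) \<cdot>\<^sub>v u n \<omega>"
  shows "AE \<omega> in M.
     (\<lambda>n. proj_norm (mat_ker n (complex_of_real \<theta> \<cdot>\<^sub>m 1\<^sub>m n - P n)) (u n \<omega>)) \<longlonglongrightarrow> 0"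
proof -
  interpret prob_space M by (rule M)
  \<comment> \<open>P n is deterministic, so v n is fixed once for all outcomes, as the moment
    estimate requires. The guard is there because dimension 0 has no unit vector.\<close>
  have "\<exists>w. n \<ge> 1 \<longrightarrow> w \<in> carrier_vec n \<and> vnorm w = 1 \<and> (real_case \<longrightarrow> real_vec w) \<and>
      (\<forall>i<n. \<forall>k<n. P n $$ (i,k) = complex_of_real \<theta> * w $ i * cnj (w $ k))" for n
  proof (cases "n \<ge> 1")
    case True
    from rank_one_decomposition[OF P_herm True theta_pos P_eigs[OF True]]
    show ?thesis using P_real by metis
  qed simp
  then obtain v where v: "v n \<in> carrier_vec n" "vnorm (v n) = 1" "real_case \<Longrightarrow> real_vec (v n)"
      "\<forall>i<n. \<forall>k<n. P n $$ (i,k) = complex_of_real \<theta> * v n $ i * cnj (v n $ k)" if "n \<ge> 1" for n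
    by metis
  \<comment> \<open>The outermost edges widened by 1: eventually the extreme eigenvalues, and so all
    of them, lie within these bounds.\<close>
  define R where "R = max \<bar>a L - 1\<bar> \<bar>b 1 + 1\<bar>"
  have top_edge: "AE \<omega> in M. (\<lambda>n. eig 1 (X n \<omega>)) \<longlonglongrightarrow> b 1" using edge_b[of 1] l_pos by simp
  \<comment> \<open>The weights p sum to 1, so for i = L the ceiling in \<open>edge_a\<close> is n
    itself.\<close>
  have bottom_edge: "AE \<omega> in M. (\<lambda>n. eig n (X n \<omega>)) \<longlonglongrightarrow> a L" using edge_a[of L] l_pos p_sum by simp
  have bd: "AE \<omega> in M. \<forall>\<^sub>F n in sequentially. \<forall>i<n. \<bar>eig (Suc i) (X n \<omega>)\<bar> \<le> R"
    using top_edge bottom_edge AE_space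
  proof eventually_elim
    case (elim \<omega>)
    have "\<forall>\<^sub>F n in sequentially. eig 1 (X n \<omega>) < b 1 + 1" by (rule order_tendstoD(2)[OF elim(1)]) simp
    moreover have "\<forall>\<^sub>F n in sequentially. a L - 1 < eig n (X n \<omega>)" by (rule order_tendstoD(1)[OF elim(2)]) simp
    ultimately show ?case
    proof eventually_elim
      case (elim n)
      show ?case
      proof (intro allI impI)
        fix i assume i: "i < n"
        have "eig (Suc i) (X n \<omega>) \<le> eig 1 (X n \<omega>)" "eig n (X n \<omega>) \<le> eig (Suc i) (X n \<omega>)"
          using i by (auto intro!: eig_antimono[OF X_herm[OF \<open>\<omega> \<in> space M\<close>]])
        thus "\<bar>eig (Suc i) (X n \<omega>)\<bar> \<le> R" using elim unfolding R_def by linarith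
      qed
    qed
  qed
  have mom: "AE \<omega> in M. \<forall>m. (\<lambda>n. Re (cinner (X n \<omega> ^\<^sub>m m *\<^sub>v v n) (v n))
      - (\<Sum>i<n. eig (Suc i) (X n \<omega>) ^ m) / real n) \<longlonglongrightarrow> 0"
    unfolding AE_all_countable
  proof
    fix m
    have "AE \<omega> in M. \<forall>\<^sub>F n in sequentially. (\<Sum>i<n. eig (Suc i) (X n \<omega>) ^ (2 * m)) \<le> R ^ (2 * m) * real n"
      using bd
    proof eventually_elim
      case (elim \<omega>)
      thus ?case
      proof eventually_elim
        case (elim n)
        have "(\<Sum>i<n. eig (Suc i) (X n \<omega>) ^ (2 * m)) \<le> (\<Sum>i<n. R ^ (2 * m))"
        proof (rule sum_mono)
          fix i assume "i \<in> {..<n}"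
          hence "\<bar>eig (Suc i) (X n \<omega>)\<bar> ^ (2 * m) \<le> R ^ (2 * m)" using elim by (intro power_mono) auto
          thus "eig (Suc i) (X n \<omega>) ^ (2 * m) \<le> R ^ (2 * m)" by (simp add: power_even_abs)
        qed
        thus ?case by (simp add: mult.commute)
      qed
    qed
    moreover have "R ^ (2 * m) \<ge> 0" by (simp add: power_mult)
    ultimately show "AE \<omega> in M. (\<lambda>n. Re (cinner (X n \<omega> ^\<^sub>m m *\<^sub>v v n) (v n))
      - (\<Sum>i<n. eig (Suc i) (X n \<omega>) ^ m) / real n) \<longlonglongrightarrow> 0"
      by (intro AE_quadratic_form_pow[OF M X_herm X_meas X_inv v(1,2,3)])
  qed
  define c where "c = (\<Sum>i=1..j-1. p i)"
  \<comment> \<open>The theorem's eigenvalue is \<open>eig (Suc (k n))\<close>, so k n is its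
    zero-based position. The same k n is the one-based index of the bottom eigenvalue of the
    component to the right.\<close>
  define k where "k = (\<lambda>n. nat \<lceil>real n * c\<rceil>)"
  have c0: "c \<ge> 0" unfolding c_def using p_pos j_range by (intro sum_nonneg) (auto intro!: less_imp_le)
  have c1: "c < 1"
  proof -
    have "c + p j = (\<Sum>i=1..j. p i)" unfolding c_def using j_range by (cases j) auto
    also have "\<dots> \<le> (\<Sum>i=1..L. p i)" using j_range p_pos by (intro sum_mono2) (auto intro!: less_imp_le)
    finally show ?thesis using p_sum p_pos[OF j_range] by simp
  qed
  \<comment> \<open>As soon as n (1 - c) exceeds 1, rounding n c up stays below n.\<close>
  have k_less: "\<forall>\<^sub>F n in sequentially. k n < n"
    using eventually_gt_at_top[of "nat \<lceil>1 / (1 - c)\<rceil>"]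
  proof eventually_elim
    case (elim n)
    hence "1 / (1 - c) < real n" by linarith
    hence "real n * c + 1 < real n" using c1 by (simp add: pos_divide_less_eq algebra_simps)
    hence "\<lceil>real n * c\<rceil> < int n" by linarith
    moreover have "0 \<le> real n * c" using c0 by simp
    hence "0 \<le> \<lceil>real n * c\<rceil>" by linarith
    ultimately show ?case by (simp add: k_def nat_less_iff)
  qed
  have k_pos: "\<forall>\<^sub>F n in sequentially. k n \<ge> 1" if "j \<noteq> 1"
    using eventually_ge_at_top[of 1]
  proof eventually_elim
    case (elim n)
    have "c > 0" unfolding c_def using that j_range p_pos by (intro sum_pos) auto
    hence "real n * c > 0" using elim by simp
    thus ?case by (simp add: k_def Suc_le_eq)
  qed
  have uD: "u n \<omega> \<in> carrier_vec n" "vnorm (u n \<omega>) = 1"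
    "(X n \<omega> + P n) *\<^sub>v u n \<omega> = complex_of_real (eig (Suc (k n)) (X n \<omega> + P n)) \<cdot>\<^sub>v u n \<omega>"
    if "\<omega> \<in> space M" "k n < n" for n \<omega>
    using u_eig[OF that(1), of n] that(2) by (auto simp: Let_def k_def c_def)
  have lower: "AE \<omega> in M. (\<lambda>n. eig (Suc (k n)) (X n \<omega>)) \<longlonglongrightarrow> b j"
    using edge_b[OF j_range] by (simp add: k_def c_def)
  \<comment> \<open>For j > 1 the upper interlacing neighbour is the last eigenvalue of component j
    - 1, whose limit is \<open>a (j - 1)\<close>.\<close>
  have upper: "AE \<omega> in M. j \<noteq> 1 \<longrightarrow> (\<lambda>n. eig (k n) (X n \<omega>)) \<longlonglongrightarrow> a (j - 1)"
  proof (cases "j = 1")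
    case False
    hence "j - 1 \<in> {1..L}" using j_range by auto
    from edge_a[OF this] show ?thesis by (simp add: k_def c_def)
  qed simp
  have bands: "AE t in \<mu>X. \<exists>i\<in>{1..L}. a i \<le> t \<and> t \<le> b i"
    by (rule AE_mixture_in_bands[OF p_sum mu_prob mu_supp muX_prob muX_sets muX_eq])
  have bands_less: "b i' < a i" if "1 \<le> i" "i < i'" "i' \<le> L" for i i'
    using bands_ordered[of L a b i i'] ab_order ba_order that by blast
  \<comment> \<open>Bands of index at least j end at or before \<open>b j\<close>; the others start
    at or after \<open>a (j - 1)\<close>. For j = 1 only the first kind exists.\<close>
  have gap: "AE t in \<mu>X. t \<le> b j \<or> (j \<noteq> 1 \<and> a (j - 1) \<le> t)"
    using bands
  proof eventually_elim
    case (elim t)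
    then obtain i where i: "i \<in> {1..L}" "a i \<le> t" "t \<le> b i" by blast
    show ?case
    proof (cases "j \<le> i")
      case True
      have "b i \<le> b j"
      proof (cases "i = j")
        case False
        hence "b i < a j" using bands_less[of j i] True i(1) j_range by simp
        thus ?thesis using ab_order[OF j_range] by linarith
      qed simp
      thus ?thesis using i by simp
    next
      case False
      have "a (j - 1) \<le> a i"
      proof (cases "i = j - 1")
        case neq: False
        have "b (j - 1) < a i" by (rule bands_less) (use neq False i(1) j_range in auto)
        moreover have "a (j - 1) < b (j - 1)"
          by (rule ab_order) (use False i(1) j_range in auto)
        ultimately show ?thesis by linarith
      qed simp
      thus ?thesis using i False by simp
    qed
  qed
  show ?thesis
    using mom bd esd lower upper AE_space
  proof eventually_elim
    case (elim \<omega>)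
    note w = \<open>\<omega> \<in> space M\<close>
    \<comment> \<open>The eigenbasis is chosen separately for each outcome: the weights it produces
      are controlled through moments that do not depend on the choice.\<close>
    obtain U where U: "eig_unitary n (X n \<omega>) (U n)" for n
      using ex_eig_unitary[OF X_herm[OF w]] by metis
    let ?w = "\<lambda>n i. (cmod ((cadj (U n) *\<^sub>v v n) $ i))\<^sup>2"
    have weak: "(\<lambda>n. \<Sum>i<n. ?w n i * f (eig (Suc i) (X n \<omega>))) \<longlonglongrightarrow> (\<integral>t. f t \<partial>\<mu>X)"
      if f: "continuous_on UNIV f" "bounded (range f)" for f :: "real \<Rightarrow> real"
    proof -
      have "(\<lambda>n. (\<Sum>i<n. ?w n i * f (eig (Suc i) (X n \<omega>))) - (\<Sum>i<n. f (eig (Suc i) (X n \<omega>))) / real n) \<longlonglongrightarrow> 0"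
      proof (rule weighted_average_minus_average_tendsto_0[OF _ _ _ elim(2) f(1)])
        show "\<forall>\<^sub>F n in sequentially. (\<Sum>i<n. ?w n i) = 1"
          using eventually_ge_at_top[of 1]
        proof eventually_elim
          case (elim n)
          have "unitary_mat n (U n)" using U by (simp add: eig_unitary_def)
          from unitary_parseval[OF this v(1)[OF elim]] show ?case using v(2)[OF elim] by simp
        qed
        fix m
        have "\<forall>\<^sub>F n in sequentially. Re (cinner (X n \<omega> ^\<^sub>m m *\<^sub>v v n) (v n)) - (\<Sum>i<n. eig (Suc i) (X n \<omega>) ^ m) / real n
            = (\<Sum>i<n. ?w n i * eig (Suc i) (X n \<omega>) ^ m) - (\<Sum>i<n. eig (Suc i) (X n \<omega>) ^ m) / real n"
          using eventually_ge_at_top[of 1]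
        proof eventually_elim
          case (elim n)
          show ?case
            unfolding eig_unitary_pow_cinner[OF U v(1)[OF elim]] Re_complex_of_real by (simp only: mult.commute)
        qed
        from Lim_transform_eventually[OF elim(1)[rule_format] this]
        show "(\<lambda>n. (\<Sum>i<n. ?w n i * eig (Suc i) (X n \<omega>) ^ m) - (\<Sum>i<n. eig (Suc i) (X n \<omega>) ^ m) / real n) \<longlonglongrightarrow> 0" .
      qed simp
      moreover have "(\<lambda>n. (\<Sum>i<n. f (eig (Suc i) (X n \<omega>))) / real n) \<longlonglongrightarrow> (\<integral>t. f t \<partial>\<mu>X)"
        using elim(3) f by (simp add: sum.atLeast1_atMost_eq)
      ultimately show ?thesis using tendsto_add by fastforce
    qed
    have "(\<lambda>n. cinner (u n \<omega>) (v n)) \<longlonglongrightarrow> 0"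
    proof (rule eigenvector_overlap_tendsto_0[where X = "\<lambda>n. X n \<omega>" and P = P and U = U and k = k
          and \<theta> = \<theta> and R = R and \<mu> = \<mu>X and B = "b j" and A = "a (j - 1)" and top = "j = 1"])
      show "AE t in \<mu>X. t \<le> b j" if "j = 1"
        using gap by eventually_elim (use that in simp)
      show "AE t in \<mu>X. t \<le> b j \<or> a (j - 1) \<le> t"
        using gap by eventually_elim auto
      show "b j < a (j - 1)" if "j \<noteq> 1"
        by (rule bands_less) (use that j_range in auto)
      show "\<forall>n. k n = 0" if "j = 1" using that by (simp add: k_def c_def)
      show "filterlim (deriv (cauchy_transform \<mu>X)) at_bot (at_left (a (j - 1)))" if "j \<noteq> 1"
        by (rule deriv_a) (use that j_range in auto)
    qed (use X_herm[OF w] P_herm U v theta_pos k_less k_pos uD[OF w] elim weak muX_prob muX_sets deriv_b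
          not_in_interval in simp_all)
    hence "(\<lambda>n. cmod (cinner (u n \<omega>) (v n))) \<longlonglongrightarrow> 0" by (rule tendsto_norm_zero)
    \<comment> \<open>The projection equals the overlap once k n < n, since only then is u n known
      to be a vector of dimension n.\<close>
    moreover have "\<forall>\<^sub>F n in sequentially. cmod (cinner (u n \<omega>) (v n)) =
        proj_norm (mat_ker n (complex_of_real \<theta> \<cdot>\<^sub>m 1\<^sub>m n - P n)) (u n \<omega>)"
      using k_less
    proof eventually_elim
      case (elim n)
      hence n: "n \<ge> 1" by simp
      have "mat_ker n (complex_of_real \<theta> \<cdot>\<^sub>m 1\<^sub>m n - P n) = range (\<lambda>c. c \<cdot>\<^sub>v v n)"
        by (rule mat_ker_rank_one[OF hermitian_matD(1)[OF P_herm] v(1,2)[OF n]])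
           (use theta_pos v(4)[OF n] in auto)
      thus ?case using proj_norm_line[OF v(1,2)[OF n] uD(1)[OF w elim]] by simp
    qed
    ultimately show ?case by (rule Lim_transform_eventually)
  qed
qed

end
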